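(* For each $\epsilon>0$ and number of players $n$ with arbitrary value densities, in the Robertson–Webb (RW) model a partition that is (i) $\epsilon$-envy-free and connected can be computed with $O(n/\epsilon)$ queries; (ii) $\epsilon$-equitable, proportional, and connected can be computed with $O(n/\epsilon)$ queries; (iii) an $(\epsilon,k)$-measure splitting with $k$ pieces can be computed with $O(k\cdot n^2/\epsilon)$ queries; (iv) $\epsilon$-perfect can be computed with $O(n^3/\epsilon)$ queries.
   Context: Cake cutting model. The cake is $[0,1]$ and the players are $1,\dots,n$. Player $i$ has a private non-negative integrable value density $v_i$ on $[0,1]$ with $\int_0^1 v_i=1$, and $V_i(S)=\int_S v_i(x)\,dx$. A piece is a finite union of disjoint intervals, connected if it is a single interval. An allocation $A=(A_1,\dots,A_n)$ is a partition of $[0,1]$ into pieces, player $i$ receiving $A_i$; it is connected if every $A_i$ is. It is proportional if $V_i(A_i)\ge 1/n$ for all $i$; $\epsilon$-envy-free if $V_i(A_i)\ge V_i(A_j)-\epsilon$ for all $i,j$; $\epsilon$-equitable if the values $V_i(A_i)$ are equal within error $\epsilon$, i.e. $|V_i(A_i)-V_j(A_j)|\le\epsilon$ for all $i,j$; $\epsilon$-perfect if $V_i(A_j)=1/n$ within error $\epsilon$, i.e. $|V_i(A_j)-1/n|\le\epsilon$, for all $i,j$. A partition $(A_1,\dots,A_k)$ of the cake into $k$ pieces is an $(\epsilon,k)$-measure splitting if $V_i(A_j)\in(1/k-\epsilon,1/k+\epsilon)$ for all $i=1,\dots,n$ and $j=1,\dots,k$. RW model. A protocol, not knowing the densities, adaptively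 asks queries $\mathrm{Cut}_i(\alpha)$, $\alpha\in[0,1]$ (player $i$ returns a point $y$ with $V_i([0,y])=\alpha$, ties resolved deterministically; $y$ becomes a cut point) and $\mathrm{Eval}_i(y)$ for a previously made cut point $y$ (player $i$ returns $V_i([0,y])$). At the end it outputs a partition demarcated by cut points discovered through its queries.
   Formalization: In (ii) the bound proved is O(n·max(1/ε, ln n)), which is O(n/ε) when ε·ln n is bounded; O(n/ε) for all ε and n fails, since exact proportionality needs queries however large ε is, and Ω(n log n) of them even at ε = 1. *)

theory Defs
  imports "HOL-Analysis.Analysis"
begin

section \<open>The cake-cutting model\<close>

definition piece_value :: "(real \<Rightarrow> real) \<Rightarrow> real set \<Rightarrow> real" where
  "piece_value d S = (LINT x:S|lebesgue. d x)"

definition value_density :: "(real \<Rightarrow> real) \<Rightarrow> bool" where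
  "value_density d \<longleftrightarrow>
     set_integrable lebesgue {0..1} d \<and> (\<forall>x\<in>{0..1}. 0 \<le> d x) \<and> piece_value d {0..1} = 1"

text \<open>The intervals may be open, closed, half-open, degenerate or empty; in particular the empty
  set is a piece.\<close>

definition is_piece :: "real set \<Rightarrow> bool" where
  "is_piece S \<longleftrightarrow> (\<exists>I. finite I \<and> disjoint I \<and> (\<forall>J\<in>I. is_interval J) \<and> S = \<Union>I)"

definition cake_partition :: "nat \<Rightarrow> (nat \<Rightarrow> real set) \<Rightarrow> bool" where
  "cake_partition m A \<longleftrightarrow>
     (\<forall>j\<in>{1..m}. is_piece (A j)) \<and> disjoint_family_on A {1..m} \<and> (\<Union>j\<in>{1..m}. A j) = {0..1}"

definition connected_pieces :: "nat \<Rightarrow> (nat \<Rightarrow> real set) \<Rightarrow> bool" where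
  "connected_pieces m A \<longleftrightarrow> (\<forall>j\<in>{1..m}. is_interval (A j))"

definition proportional :: "nat \<Rightarrow> (nat \<Rightarrow> real \<Rightarrow> real) \<Rightarrow> (nat \<Rightarrow> real set) \<Rightarrow> bool" where
  "proportional n v A \<longleftrightarrow> (\<forall>i\<in>{1..n}. piece_value (v i) (A i) \<ge> 1 / n)"

definition envy_free :: "real \<Rightarrow> nat \<Rightarrow> (nat \<Rightarrow> real \<Rightarrow> real) \<Rightarrow> (nat \<Rightarrow> real set) \<Rightarrow> bool" where
  "envy_free \<epsilon> n v A \<longleftrightarrow>
     (\<forall>i\<in>{1..n}. \<forall>j\<in>{1..n}. piece_value (v i) (A i) \<ge> piece_value (v i) (A j) - \<epsilon>)"

definition equitable :: "real \<Rightarrow> nat \<Rightarrow> (nat \<Rightarrow> real \<Rightarrow> real) \<Rightarrow> (nat \<Rightarrow> real set) \<Rightarrow> bool" where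
  "equitable \<epsilon> n v A \<longleftrightarrow>
     (\<forall>i\<in>{1..n}. \<forall>j\<in>{1..n}. \<bar>piece_value (v i) (A i) - piece_value (v j) (A j)\<bar> \<le> \<epsilon>)"

definition perfect :: "real \<Rightarrow> nat \<Rightarrow> (nat \<Rightarrow> real \<Rightarrow> real) \<Rightarrow> (nat \<Rightarrow> real set) \<Rightarrow> bool" where
  "perfect \<epsilon> n v A \<longleftrightarrow>
     (\<forall>i\<in>{1..n}. \<forall>j\<in>{1..n}. \<bar>piece_value (v i) (A j) - 1 / n\<bar> \<le> \<epsilon>)"

definition measure_splitting ::
    "real \<Rightarrow> nat \<Rightarrow> nat \<Rightarrow> (nat \<Rightarrow> real \<Rightarrow> real) \<Rightarrow> (nat \<Rightarrow> real set) \<Rightarrow> bool" where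
  "measure_splitting \<epsilon> k n v A \<longleftrightarrow>
     (\<forall>i\<in>{1..n}. \<forall>j\<in>{1..k}. piece_value (v i) (A j) \<in> {1 / k - \<epsilon> <..< 1 / k + \<epsilon>})"


section \<open>The Robertson--Webb query model\<close>

datatype query = Cut nat real | Eval nat real

text \<open>A deterministic adaptive protocol is a well-founded decision tree, branching over the real
  answer to each query. As usual for query complexity, computation between queries is free.\<close>

datatype 'o protocol = Output 'o | Ask query "real \<Rightarrow> 'o protocol"

primrec outcome :: "(query \<Rightarrow> real) \<Rightarrow> 'o protocol \<Rightarrow> 'o" where
  "outcome ans (Output out) = out"
| "outcome ans (Ask q next) = outcome ans (next (ans q))"

primrec transcript :: "(query \<Rightarrow> real) \<Rightarrow> 'o protocol \<Rightarrow> (query \<times> real) list" where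
  "transcript ans (Output out) = []"
| "transcript ans (Ask q next) = (q, ans q) # transcript ans (next (ans q))"

definition cut_points :: "(query \<times> real) list \<Rightarrow> real set" where
  "cut_points tr = {y. \<exists>i \<alpha>. (Cut i \<alpha>, y) \<in> set tr}"

text \<open>An evaluation query may only be asked at a cut point made earlier in the same run.\<close>

definition legal :: "nat \<Rightarrow> (query \<times> real) list \<Rightarrow> bool" where
  "legal n tr \<longleftrightarrow> (\<forall>t < length tr.
     case fst (tr ! t) of
       Cut i \<alpha> \<Rightarrow> i \<in> {1..n} \<and> \<alpha> \<in> {0..1}
     | Eval i y \<Rightarrow> i \<in> {1..n} \<and> y \<in> cut_points (take t tr))"

text \<open>The function \<open>c\<close> is the tie-breaking rule: \<open>c i \<alpha>\<close> is the point returned for \<open>Cut i \<alpha>\<close>,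
  which matters when player \<open>i\<close> values some interval at zero.\<close>

definition cut_rule :: "nat \<Rightarrow> (nat \<Rightarrow> real \<Rightarrow> real) \<Rightarrow> (nat \<Rightarrow> real \<Rightarrow> real) \<Rightarrow> bool" where
  "cut_rule n v c \<longleftrightarrow>
     (\<forall>i\<in>{1..n}. \<forall>\<alpha>\<in>{0..1}. c i \<alpha> \<in> {0..1} \<and> piece_value (v i) {0..c i \<alpha>} = \<alpha>)"

fun answer :: "(nat \<Rightarrow> real \<Rightarrow> real) \<Rightarrow> (nat \<Rightarrow> real \<Rightarrow> real) \<Rightarrow> query \<Rightarrow> real" where
  "answer v c (Cut i \<alpha>) = c i \<alpha>"
| "answer v c (Eval i y) = piece_value (v i) {0..y}"

text \<open>\<open>rw_computable n m q F\<close>: a single protocol for \<open>n\<close> players, whatever their densities and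
  whatever the tie-breaking rule, makes at most \<open>q\<close> queries (of either kind) and outputs a partition
  of the cake into \<open>m\<close> pieces with property \<open>F\<close>. The frontier of a piece consists of the endpoints
  of its maximal intervals (and isolated missing points), so the frontier condition says that the
  pieces are demarcated by discovered cut points, the two ends of the cake being known for free.\<close>

definition rw_computable ::
    "nat \<Rightarrow> nat \<Rightarrow> real \<Rightarrow> ((nat \<Rightarrow> real \<Rightarrow> real) \<Rightarrow> (nat \<Rightarrow> real set) \<Rightarrow> bool) \<Rightarrow> bool" where
  "rw_computable n m q F \<longleftrightarrow>
     (\<exists>P :: (nat \<Rightarrow> real set) protocol.
        \<forall>v c. (\<forall>i\<in>{1..n}. value_density (v i)) \<and> cut_rule n v c \<longrightarrow>
          (let tr = transcript (answer v c) P; A = outcome (answer v c) P in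
             legal n tr \<and> real (length tr) \<le> q \<and>
             cake_partition m A \<and>
             (\<forall>j\<in>{1..m}. frontier (A j) \<subseteq> {0, 1} \<union> cut_points tr) \<and>
             F v A))"

end

theory Submission
  imports Defs
begin

text \<open>
  A protocol is analysed through the set of worlds (densities and tie-breaking rule) compatible with the
  answers so far: each query splits this set, and it suffices that some output suits every remaining world.

  For (i), all players cut at the multiples of \<open>\<epsilon> / 8\<close>. An almost envy-free connected allocation exists
  (Poincare--Miranda in stick-breaking coordinates, then Hall's theorem for the resulting doubly
  stochastic matrix), and rounding its cuts to the discovered points costs each player \<open>O(\<epsilon>)\<close>.

  For (ii), the divide-and-conquer protocol of Even and Paz finds an order of the players and cuts giving
  everyone at least \<open>1 / n\<close>. Keeping the order, the common guarantee \<open>t\<close> is raised in steps of \<open>\<epsilon>\<close>: one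
  pass from the right makes the pieces worth exactly \<open>t\<close>, one pass from the left tries to make them worth
  exactly \<open>t + \<epsilon>\<close>, and when the second pass gets stuck the two cut sequences can be spliced.

  For (iii), the octahedral Tucker lemma shows that a cake can be halved approximately for all players
  with \<open>n\<close> cuts. Repeated halving yields \<open>2 ^ a\<close> almost equal classes, \<open>4 * k \<le> 2 ^ a < 8 * k\<close>; each part receives
  the same number of classes and less than a quarter of the cake is left. Only the leftover is refined
  further, with a precision that doubles in each round, so that the numbers of queries form
  a geometric series up to terms of order \<open>k * n\<^sup>2\<close> times the squared number of rounds.
  Part (iv) is the case \<open>k = n\<close>.
\<close>

section \<open>The octahedral Tucker lemma\<close>

text \<open>In (i) and (iii), an existence statement for known densities is applied to one arbitrary
  compatible world, and its cuts are moved to discovered points. Compatible worlds nearly agree on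
  the value left of each relevant point, so the same pieces serve all of them.

  Only halving is available, and \<open>k\<close> need not be a power of two. Used once, it would
  need about \<open>k / \<epsilon>\<close> classes to make the undistributed remainder negligible,
  hence about \<open>n * k / \<epsilon>\<close> cuts; moving each by one cell forces a precision of
  order \<open>\<epsilon> ^ 2 / (n * k)\<close> and loses a factor \<open>1 / \<epsilon>\<close> in
  the queries. Refining only the leftover avoids this: up to small errors a round quarters its value
  but only halves the cell size, so the number of cells to be queried halves, while a round adds at
  most \<open>8 * k * n\<close> cuts.

  In (ii) the proportional start costs order \<open>n * ln n\<close>, which is known to be
  unavoidable for proportionality; hence the bound with \<open>max (1 / \<epsilon>) (ln n)\<close>,
  which is O(n / \<epsilon>) as soon as \<open>1 / \<epsilon>\<close> is at least
  \<open>ln n\<close>.\<close>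

text \<open>The labels \<open>j\<close> and \<open>- j\<close> are coded by \<open>2 * j\<close> and \<open>2 * j + 1\<close>.\<close>

definition flip :: "nat \<Rightarrow> nat" where
  "flip l = (if even l then l + 1 else l - 1)"

lemma flip_flip [simp]: "flip (flip l) = l"
  by (auto simp: flip_def)

lemma even_flip [simp]: "even (flip l) \<longleftrightarrow> odd l"
  by (auto simp: flip_def)

lemma flip_div [simp]: "flip l div 2 = l div 2"
  by (auto simp: flip_def elim!: oddE)

lemma div2_eqD: "a div 2 = b div 2 \<Longrightarrow> a = b \<or> a = flip b" for a b :: nat
  unfolding flip_def by (auto elim!: evenE oddE)

primrec alternating :: "bool \<Rightarrow> bool list \<Rightarrow> bool" where
  "alternating s [] = True"
| "alternating s (b # bs) = (b = s \<and> alternating (\<not> s) bs)"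

lemma alternating_unique: "alternating s bs \<Longrightarrow> alternating (\<not> s) bs \<Longrightarrow> bs = []"
  by (cases bs) auto

lemma alternating_Not: "alternating s (map Not bs) = alternating (\<not> s) bs"
  by (induction bs arbitrary: s) auto

text \<open>There are zero, one or two such deletions. A list alternating from \<open>s\<close> may
  only lose its last entry, one alternating from the other sign only its first; a list from
  \<open>s\<close> with a single repetition may lose either of the two equal neighbours, which is
  the even case. This is the local parity count of Fan's argument.\<close>

lemma odd_removals:
  assumes "bs \<noteq> []"
  shows "odd (card {t. t < length bs \<and> alternating s (take t bs @ drop (Suc t) bs)})
    \<longleftrightarrow> alternating s bs \<or> alternating (\<not> s) bs"
  using assms
proof (induction bs arbitrary: s)
  case (Cons b bs)
  let ?A = "\<lambda>s bs. {t. t < length bs \<and> alternating s (take t bs @ drop (Suc t) bs)}"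
  have eq: "?A s (b # bs) = (if alternating s bs then {0} else {}) \<union>
      (if b = s then Suc ` ?A (\<not> s) bs else {})"
  proof (intro set_eqI)
    fix t show "t \<in> ?A s (b # bs) \<longleftrightarrow> t \<in> (if alternating s bs then {0} else {}) \<union>
      (if b = s then Suc ` ?A (\<not> s) bs else {})"
      by (cases t) auto
  qed
  have "card (?A s (b # bs)) = (if alternating s bs then 1 else 0) +
      (if b = s then card (?A (\<not> s) bs) else 0)"
    unfolding eq by (subst card_Un_disjoint) (auto simp: card_image)
  moreover have "bs \<noteq> [] \<Longrightarrow> odd (card (?A (\<not> s) bs)) \<longleftrightarrow> alternating (\<not> s) bs \<or> alternating s bs"
    using Cons.IH[of "\<not> s"] by simp
  ultimately show ?case
    using alternating_unique[of s bs] by (cases "bs = []") auto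
qed simp

text \<open>Fan's pattern of labels \<open>+ j1, - j2, + j3, ...\<close> with increasing absolute
  values, \<open>s\<close> being the first sign. A multiset suffices, since the place of a label
  along the flag does not matter.\<close>

definition fan :: "bool \<Rightarrow> nat multiset \<Rightarrow> bool" where
  "fan s M \<longleftrightarrow> alternating s (map even (sorted_list_of_multiset M))"

lemma fan_unique: "fan s M \<Longrightarrow> fan (\<not> s) M \<Longrightarrow> M = {#}"
  using alternating_unique[of s "map even (sorted_list_of_multiset M)"]
  using mset_sorted_list_of_multiset[of M] by (auto simp: fan_def)

lemma mset_remove_nth: "t < length ls \<Longrightarrow> mset (take t ls @ drop (Suc t) ls) = mset ls - {#ls ! t#}"
  by (subst (3) id_take_nth_drop[of t ls]) auto

lemma card_facets_mset:
  "card {t. t < length ls \<and> P (mset ls - {#ls ! t#})} = size {#x \<in># mset ls. P (mset ls - {#x#})#}"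
proof -
  have "card {t. t < length ls \<and> P (mset ls - {#ls ! t#})} = length (filter (\<lambda>x. P (mset ls - {#x#})) ls)"
    by (simp only: length_filter_conv_card)
  also have "\<dots> = size (mset (filter (\<lambda>x. P (mset ls - {#x#})) ls))"
    by (simp only: size_mset)
  finally show ?thesis by (simp only: mset_filter)
qed

lemma odd_fan_facets:
  assumes "ls \<noteq> []"
  shows "odd (card {t. t < length ls \<and> fan s (mset ls - {#ls ! t#})})
    \<longleftrightarrow> fan s (mset ls) \<or> fan (\<not> s) (mset ls)"
proof -
  let ?ks = "sort ls"
  have "length ?ks \<noteq> 0" using assms by (simp only: length_sort length_0_conv not_False_eq_True)
  then have ne: "map even ?ks \<noteq> []" by (simp only: length_0_conv map_is_Nil_conv not_False_eq_True)
  have fan_take: "fan s (mset ?ks - {#?ks ! t#})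
      \<longleftrightarrow> alternating s (take t (map even ?ks) @ drop (Suc t) (map even ?ks))" if "t < length ?ks" for t
  proof -
    have "sorted (take t ?ks @ drop (Suc t) ?ks)"
      using sorted_sort[of ls] by (subst (asm) id_take_nth_drop[OF that]) (auto simp: sorted_append)
    then have "sorted_list_of_multiset (mset ?ks - {#?ks ! t#}) = take t ?ks @ drop (Suc t) ?ks"
      by (simp only: mset_remove_nth[OF that, symmetric] sorted_list_of_multiset_mset sorted_sort_id)
    then show ?thesis
      by (simp add: fan_def take_map drop_map)
  qed
  have "card {t. t < length ls \<and> fan s (mset ls - {#ls ! t#})}
      = card {t. t < length ?ks \<and> fan s (mset ?ks - {#?ks ! t#})}"
    unfolding card_facets_mset by simp
  also have "{t. t < length ?ks \<and> fan s (mset ?ks - {#?ks ! t#})} =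
    {t. t < length (map even ?ks) \<and> alternating s (take t (map even ?ks) @ drop (Suc t) (map even ?ks))}"
    using fan_take by auto
  finally show ?thesis
    using odd_removals[OF ne, of s]
    unfolding fan_def sorted_list_of_multiset_mset by simp
qed

lemma even_card_involution:
  assumes "finite A" "\<And>x. x \<in> A \<Longrightarrow> f x \<in> A" "\<And>x. x \<in> A \<Longrightarrow> f (f x) = x" "\<And>x. x \<in> A \<Longrightarrow> f x \<noteq> x"
  shows "even (card A)"
  using assms
proof (induction "card A" arbitrary: A rule: less_induct)
  case less
  show ?case
  proof (cases "A = {}")
    case False
    then obtain x where x: "x \<in> A" by auto
    let ?B = "A - {x, f x}"
    have sub: "{x, f x} \<subseteq> A" and "card {x, f x} = 2"
      using less.prems(2)[OF x] less.prems(4)[OF x] x by (auto simp: card_insert_if)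
    then have B: "card A = card ?B + 2"
      using card_Diff_subset[of "{x, f x}" A] card_mono[OF less.prems(1) sub] by simp
    moreover have "even (card ?B)"
    proof (rule less.hyps)
      show "card ?B < card A" using B by simp
      show "f y \<in> ?B" if y: "y \<in> ?B" for y
      proof -
        have "f y \<noteq> x" "f y \<noteq> f x"
          using less.prems(3)[of y] less.prems(3)[OF x] y by auto
        then show ?thesis using less.prems(2)[of y] y by auto
      qed
    qed (use less.prems in auto)
    ultimately show ?thesis by simp
  qed simp
qed

text \<open>A signed permutation stands for a maximal flag of sign vectors, namely its prefixes.\<close>

definition signed_perms :: "nat \<Rightarrow> (nat \<times> bool) list set" where
  "signed_perms d = {ws. distinct (map fst ws) \<and> fst ` set ws = {..<d}}"

lemma length_signed_perms: "ws \<in> signed_perms d \<Longrightarrow> length ws = d"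
  using distinct_card[of "map fst ws"] by (simp add: signed_perms_def)

lemma finite_signed_perms: "finite (signed_perms d)"
proof (rule finite_subset)
  show "signed_perms d \<subseteq> {ws. set ws \<subseteq> {..<d} \<times> UNIV \<and> length ws = d}"
  proof
    fix ws assume ws: "ws \<in> signed_perms d"
    then have "fst x \<in> {..<d}" if "x \<in> set ws" for x
      using that by (auto simp: signed_perms_def)
    then show "ws \<in> {ws. set ws \<subseteq> {..<d} \<times> UNIV \<and> length ws = d}"
      using length_signed_perms[OF ws] by (auto simp: mem_Times_iff)
  qed
  show "finite {ws. set ws \<subseteq> {..<d} \<times> (UNIV :: bool set) \<and> length ws = d}"
    by (rule finite_lists_length_eq) simp
qed

definition flag_labels :: "((nat \<times> bool) set \<Rightarrow> nat) \<Rightarrow> (nat \<times> bool) list \<Rightarrow> nat list" where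
  "flag_labels L ws = map (\<lambda>t. L (set (take (Suc t) ws))) [0..<length ws]"

definition antipode :: "(nat \<times> bool) set \<Rightarrow> (nat \<times> bool) set" where
  "antipode X = apsnd Not ` X"

text \<open>A vector with entries -1, 0, 1 is kept as the set of its signed nonzero coordinates.
  Inclusion is then the face relation of the octahedral sphere, and chains of nonempty sign vectors
  are the simplices of its barycentric subdivision.\<close>

definition sign_vector :: "nat \<Rightarrow> (nat \<times> bool) set \<Rightarrow> bool" where
  "sign_vector d X \<longleftrightarrow> X \<subseteq> {..<d} \<times> UNIV \<and> inj_on fst X"

lemma flag_sign_vector:
  assumes "ws \<in> signed_perms d"
  shows "sign_vector d (set (take t ws))"
  unfolding sign_vector_def
proof
  have "set (take t ws) \<subseteq> set ws" by (rule set_take_subset)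
  moreover have "fst x < d" if "x \<in> set ws" for x
    using assms that by (auto simp: signed_perms_def)
  ultimately show "set (take t ws) \<subseteq> {..<d} \<times> UNIV"
    by (auto simp: mem_Times_iff)
  show "inj_on fst (set (take t ws))"
    by (rule inj_on_subset[OF _ set_take_subset]) (use assms in \<open>simp add: signed_perms_def distinct_map\<close>)
qed

lemma signed_perms_swap:
  assumes "ws \<in> signed_perms d" "Suc t < d"
  shows "ws[t := ws ! Suc t, Suc t := ws ! t] \<in> signed_perms d"
proof -
  have "mset (ws[t := ws ! Suc t, Suc t := ws ! t]) = mset ws"
    using assms length_signed_perms[OF assms(1)] by (simp add: mset_swap)
  then show ?thesis
    using assms(1) unfolding signed_perms_def
    by (metis (mono_tags, lifting) mem_Collect_eq mset_eq_imp_distinct_iff mset_map set_mset_mset)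
qed

text \<open>A shorter prefix contains neither of the exchanged entries and a longer one contains
  both, so the two flags can differ in one member only.\<close>

lemma set_take_swap:
  assumes "Suc t < length ws" "s \<noteq> t"
  shows "set (take (Suc s) (ws[t := ws ! Suc t, Suc t := ws ! t])) = set (take (Suc s) ws)"
proof (cases "s < t")
  case True
  then show ?thesis by simp
next
  case False
  then have st: "Suc t < Suc s" using assms by simp
  then have "take (Suc s) (ws[t := ws ! Suc t, Suc t := ws ! t])
     = (take (Suc s) ws)[t := take (Suc s) ws ! Suc t, Suc t := take (Suc s) ws ! t]"
    by (simp add: take_update_swap)
  moreover have "mset ((take (Suc s) ws)[t := take (Suc s) ws ! Suc t, Suc t := take (Suc s) ws ! t]) = mset (take (Suc s) ws)"
    using st assms by (intro mset_swap) auto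
  ultimately show ?thesis
    using mset_eq_setD by metis
qed

lemma remove_nth_cong:
  assumes "length xs = length ys" "\<And>s. s < length xs \<Longrightarrow> s \<noteq> t \<Longrightarrow> xs ! s = ys ! s"
  shows "take t xs @ drop (Suc t) xs = take t ys @ drop (Suc t) ys"
proof -
  have "take t xs = take t ys" "drop (Suc t) xs = drop (Suc t) ys"
    using assms by (auto intro!: nth_equalityI)
  then show ?thesis by simp
qed

text \<open>A labelling as in Tucker's lemma, the combinatorial form of the Borsuk--Ulam theorem;
  the edges of the subdivision are the nested pairs. The aim is \<open>N \<le> m\<close>: so many
  absolute values are indispensable.\<close>

locale tucker =
  fixes N m :: nat and L :: "(nat \<times> bool) set \<Rightarrow> nat"
  assumes antipodal: "\<And>X. sign_vector N X \<Longrightarrow> X \<noteq> {} \<Longrightarrow> L (antipode X) = flip (L X)"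
    and no_complement: "\<And>X Y. sign_vector N Y \<Longrightarrow> X \<noteq> {} \<Longrightarrow> X \<subseteq> Y \<Longrightarrow> L X \<noteq> flip (L Y)"
    and bounded: "\<And>X. sign_vector N X \<Longrightarrow> X \<noteq> {} \<Longrightarrow> L X < 2 * m"
begin

abbreviation "labels \<equiv> flag_labels L"

lemma length_labels [simp]: "length (labels ws) = length ws"
  by (simp add: flag_labels_def)

lemma nth_labels: "t < length ws \<Longrightarrow> labels ws ! t = L (set (take (Suc t) ws))"
  by (simp add: flag_labels_def del: upt_Suc take_Suc)

lemma labels_snoc: "labels (ws @ [x]) = labels ws @ [L (set (ws @ [x]))]"
  by (rule nth_equalityI) (auto simp: nth_labels nth_append less_Suc_eq)

lemma labels_no_complement:
  assumes "ws \<in> signed_perms d" "d \<le> N" "a \<in> set (labels ws)" "b \<in> set (labels ws)"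
  shows "a \<noteq> flip b"
proof -
  obtain s t where st: "s < length ws" "t < length ws" "a = L (set (take (Suc s) ws))" "b = L (set (take (Suc t) ws))"
    using assms(3,4) by (auto simp: flag_labels_def)
  have sv: "sign_vector N (set (take r ws))" for r
    using flag_sign_vector[OF assms(1), of r] assms(2) by (fastforce simp: sign_vector_def)
  have ne: "set (take (Suc r) ws) \<noteq> {}" for r
    using st by (cases ws) auto
  show ?thesis
  proof (cases "s \<le> t")
    case True
    then show ?thesis
      using no_complement[OF sv ne, of s "Suc t"] st set_take_subset_set_take[of "Suc s" "Suc t" ws] by simp
  next
    case False
    then have "b \<noteq> flip a"
      using no_complement[OF sv ne, of t "Suc s"] st set_take_subset_set_take[of "Suc t" "Suc s" ws] by simp
    then show ?thesis by auto
  qed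
qed

lemma labels_negate:
  assumes "ws \<in> signed_perms d" "d \<le> N"
  shows "labels (map (apsnd Not) ws) = map flip (labels ws)"
proof (rule nth_equalityI)
  fix t assume t: "t < length (labels (map (apsnd Not) ws))"
  have sv: "sign_vector N (set (take (Suc t) ws))"
    using flag_sign_vector[OF assms(1), of "Suc t"] assms(2) by (fastforce simp: sign_vector_def)
  moreover have "set (take (Suc t) ws) \<noteq> {}"
    using t by (cases ws) auto
  ultimately show "labels (map (apsnd Not) ws) ! t = map flip (labels ws) ! t"
    using t antipodal[OF sv] by (simp add: flag_labels_def take_map antipode_def)
qed simp

text \<open>Negating a flag flips all its labels. As a flag carries no complementary pair,
  \<open>flip\<close> preserves the order of its labels, so sorting commutes with it and only the
  signs turn.\<close>

lemma fan_negate: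
  assumes "ws \<in> signed_perms d" "d \<le> N"
  shows "fan s (mset (labels (map (apsnd Not) ws))) \<longleftrightarrow> fan (\<not> s) (mset (labels ws))"
proof -
  let ?ls = "labels ws"
  have "flip a \<le> flip b" if "a \<in> set ?ls" "b \<in> set ?ls" "a \<le> b" for a b
  proof (cases "a div 2 = b div 2")
    case True
    then show ?thesis
      using div2_eqD[of a b] labels_no_complement[OF assms that(1,2)] by auto
  next
    case False
    then have "flip a div 2 < flip b div 2"
      using div_le_mono[OF that(3), of 2] by simp
    then show ?thesis
      using div_le_mono[of "flip b" "flip a" 2] by linarith
  qed
  then have "sorted (map flip (sort ?ls))"
    unfolding sorted_map by (rule_tac sorted_wrt_mono_rel[OF _ sorted_sort]) auto
  moreover have "mset (map flip (sort ?ls)) = mset (map flip ?ls)"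
    by (metis mset_map mset_sort)
  ultimately have "sort (map flip ?ls) = map flip (sort ?ls)"
    using properties_for_sort by blast
  then have "map even (sort (map flip ?ls)) = map Not (map even (sort ?ls))"
    by simp
  then show ?thesis
    unfolding fan_def labels_negate[OF assms] sorted_list_of_multiset_mset
    by (metis alternating_Not)
qed

text \<open>Ky Fan's parity argument. In the hemisphere of the flags without \<open>(d, False)\<close>, every facet of a
  flag lies in exactly one other flag (swap two neighbours, or flip the last sign), except for the facets
  on the equator, which are the flags one dimension lower.\<close>

lemma odd_card_fan:
  "d \<le> N \<Longrightarrow> odd (card {ws \<in> signed_perms d. fan True (mset (labels ws))})"
proof (induction d)
  case 0
  have "{ws \<in> signed_perms 0. fan True (mset (labels ws))} = {[]}"
    by (auto simp: signed_perms_def fan_def flag_labels_def)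
  then show ?case by simp
next
  case (Suc d)
  define H where "H = {ws \<in> signed_perms (Suc d). (d, False) \<notin> set ws}"
  have H: "ws \<in> H \<Longrightarrow> ws \<in> signed_perms (Suc d) \<and> length ws = Suc d" for ws
    using length_signed_perms by (auto simp: H_def)
  have finH: "finite H"
    using finite_signed_perms by (simp add: H_def)
  define facets where "facets ws = {t. t < length (labels ws) \<and> fan True (mset (labels ws) - {#labels ws ! t#})}" for ws
  define \<P> where "\<P> = (SIGMA ws : H. facets ws)"
  \<comment> \<open>The facets on the equator: the full sign vector is dropped from a flag ending in
    \<open>(d, True)\<close>. Flipping that last sign would leave \<open>H\<close>, so these pairs
    have no partner under \<open>\<phi>\<close>.\<close>
  define \<E> where "\<E> = {(ws, t) \<in> \<P>. t = d \<and> fst (ws ! d) = d}"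
  define \<phi> :: "(nat \<times> bool) list \<times> nat \<Rightarrow> (nat \<times> bool) list \<times> nat" where "\<phi> = (\<lambda>(ws, t). if t < d then (ws[t := ws ! Suc t, Suc t := ws ! t], t)
     else (ws[d := apsnd Not (ws ! d)], t))"
  have fin: "finite \<P>"
    unfolding \<P>_def facets_def using finH by auto
  have facetD: "t < Suc d" if "(ws, t) \<in> \<P>" for ws t
    using that H by (auto simp: \<P>_def facets_def)
  have removal_eq: "mset (labels ws) - {#labels ws ! t#} = mset (labels ws') - {#labels ws' ! t#}"
    if "length ws = Suc d" "length ws' = Suc d" "t < Suc d"
      "\<And>s. s < Suc d \<Longrightarrow> s \<noteq> t \<Longrightarrow> set (take (Suc s) ws) = set (take (Suc s) ws')" for ws ws' t
  proof -
    have "take t (labels ws) @ drop (Suc t) (labels ws) = take t (labels ws') @ drop (Suc t) (labels ws')"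
      using that by (intro remove_nth_cong) (simp_all add: nth_labels)
    then show ?thesis
      using mset_remove_nth that(1-3) by (metis length_labels)
  qed
  have "even (card (\<P> - \<E>))"
  proof (rule even_card_involution[of _ \<phi>])
    show "finite (\<P> - \<E>)" using fin by auto
    fix p assume p: "p \<in> \<P> - \<E>"
    obtain ws t where [simp]: "p = (ws, t)" by fastforce
    have ws: "ws \<in> H" "t \<in> facets ws" and ne: "\<not> (t = d \<and> fst (ws ! d) = d)" and t: "t < Suc d"
      using p facetD by (auto simp: \<P>_def \<E>_def)
    have len: "length ws = Suc d" and sp: "ws \<in> signed_perms (Suc d)" using H ws by auto
    have dist: "distinct (map fst ws)" using sp by (simp add: signed_perms_def)
    show "\<phi> p \<in> \<P> - \<E>"
    proof (cases "t < d")
      case True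
      let ?ws = "ws[t := ws ! Suc t, Suc t := ws ! t]"
      have ms: "mset ?ws = mset ws" using True len by (simp add: mset_swap)
      have "?ws \<in> H"
        using signed_perms_swap[OF sp, of t] True ws(1) ms
        by (simp add: H_def flip: set_mset_mset)
      moreover have "mset (labels ws) - {#labels ws ! t#} = mset (labels ?ws) - {#labels ?ws ! t#}"
        by (rule removal_eq) (use len True set_take_swap[of t ws] in \<open>auto simp del: take_Suc\<close>)
      ultimately show ?thesis
        using True ws len by (auto simp: \<phi>_def \<P>_def \<E>_def facets_def)
    next
      case False
      then have td: "t = d" using t by simp
      let ?ws = "ws[d := apsnd Not (ws ! d)]"
      have mf: "map fst ?ws = map fst ws"
        using len by (simp add: map_update list_update_same_conv)
      then have "fst ` set ?ws = fst ` set ws" by (metis set_map)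
      then have "?ws \<in> signed_perms (Suc d)" using sp mf by (simp add: signed_perms_def)
      moreover have "(d, False) \<notin> set ?ws"
        using ws(1) ne td set_update_subset_insert[of ws d "apsnd Not (ws ! d)"] by (auto simp: H_def apsnd_def map_prod_def split: prod.splits)
      ultimately have "?ws \<in> H" by (simp add: H_def)
      moreover have "mset (labels ws) - {#labels ws ! t#} = mset (labels ?ws) - {#labels ?ws ! t#}"
        by (rule removal_eq) (use len td in \<open>auto simp del: take_Suc\<close>)
      ultimately show ?thesis
        using td ws len ne by (auto simp: \<phi>_def \<P>_def \<E>_def facets_def)
    qed
    show "\<phi> (\<phi> p) = p"
      using len t by (auto simp: \<phi>_def list_eq_iff_nth_eq nth_list_update prod_eq_iff)
    show "\<phi> p \<noteq> p"
    proof (cases "t < d")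
      case True
      then have "ws ! t \<noteq> ws ! Suc t"
        using nth_eq_iff_index_eq[OF dist, of t "Suc t"] len by auto
      then show ?thesis
        using True len by (auto simp: \<phi>_def) (metis Suc_lessD Suc_less_eq n_not_Suc_n nth_list_update_eq nth_list_update_neq length_list_update)
    next
      case False
      then show ?thesis using t len by (auto simp: \<phi>_def) (metis apsnd_conv lessI nth_list_update_eq prod.collapse snd_conv)
    qed
  qed
  moreover have "odd (card \<E>)"
  proof -
    have "bij_betw (\<lambda>ws. (ws @ [(d, True)], d)) {ws \<in> signed_perms d. fan True (mset (labels ws))} \<E>"
      unfolding bij_betw_def
    proof
      show "inj_on (\<lambda>ws. (ws @ [(d, True)], d)) {ws \<in> signed_perms d. fan True (mset (labels ws))}"
        by (auto simp: inj_on_def)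
      have labs: "mset (labels (ws @ [x])) - {#labels (ws @ [x]) ! length ws#} = mset (labels ws)" for ws x
        by (simp add: labels_snoc nth_append)
      show "(\<lambda>ws. (ws @ [(d, True)], d)) ` {ws \<in> signed_perms d. fan True (mset (labels ws))} = \<E>"
      proof (intro set_eqI iffI)
        fix p assume "p \<in> (\<lambda>ws. (ws @ [(d, True)], d)) ` {ws \<in> signed_perms d. fan True (mset (labels ws))}"
        then obtain ws where ws: "p = (ws @ [(d, True)], d)" "ws \<in> signed_perms d" "fan True (mset (labels ws))"
          by auto
        moreover have "ws @ [(d, True)] \<in> H"
        proof -
          have "fst ` set ws = {..<d}" "distinct (map fst ws)"
            using ws(2) by (auto simp: signed_perms_def)
          moreover from this have "d \<notin> fst ` set ws" by simp
          then have "(d, False) \<notin> set ws" by force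
          ultimately show ?thesis
            by (auto simp: H_def signed_perms_def lessThan_Suc)
        qed
        ultimately show "p \<in> \<E>"
          using labs[of ws "(d, True)"] length_signed_perms[OF ws(2)]
          by (auto simp: \<E>_def \<P>_def facets_def)
      next
        fix p assume p: "p \<in> \<E>"
        then obtain ws where ws: "p = (ws, d)" "ws \<in> H" "d \<in> facets ws" "fst (ws ! d) = d"
          by (auto simp: \<E>_def \<P>_def)
        then have len: "length ws = Suc d" using H by auto
        obtain us x where us: "ws = us @ [x]" using len by (cases ws rule: rev_cases) auto
        have lu: "length us = d" using len us by simp
        then have "fst x = d" using ws us by (simp add: nth_append)
        then have x: "x = (d, True)"
          using ws(2) us by (cases x) (auto simp: H_def)
        have "us \<in> signed_perms d"
          using ws(2) us x by (auto simp: H_def signed_perms_def lessThan_Suc)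
        moreover have "fan True (mset (labels us))"
          using ws(3) labs[of us x] lu us by (simp add: facets_def)
        ultimately show "p \<in> (\<lambda>ws. (ws @ [(d, True)], d)) ` {ws \<in> signed_perms d. fan True (mset (labels ws))}"
          using ws(1) us x by auto
      qed
    qed
    then show ?thesis
      using Suc bij_betw_same_card by fastforce
  qed
  moreover have "card \<P> = card (\<P> - \<E>) + card \<E>"
    using fin by (metis (no_types, lifting) Diff_disjoint Diff_partition Int_commute card_Un_disjoint \<E>_def add.commute finite_Diff finite_subset mem_Collect_eq split_def subsetI prod.collapse)
  ultimately have "odd (card \<P>)" by simp
  \<comment> \<open>The same pairs counted by flags. The number of fan facets is odd exactly at the
    flags that are fans themselves, with either first sign.\<close>
  moreover have "card \<P> = (\<Sum>ws\<in>H. card (facets ws))"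
    unfolding \<P>_def using finH by (intro card_SigmaI) (auto simp: facets_def)
  ultimately have "odd (card {ws \<in> H. odd (card (facets ws))})"
    using even_sum_iff[OF finH, of "\<lambda>ws. card (facets ws)"] by simp
  moreover have "{ws \<in> H. odd (card (facets ws))} =
     {ws \<in> H. fan True (mset (labels ws))} \<union> {ws \<in> H. fan False (mset (labels ws))}"
  proof -
    have "odd (card (facets ws)) \<longleftrightarrow> fan True (mset (labels ws)) \<or> fan False (mset (labels ws))" if "ws \<in> H" for ws
      using odd_fan_facets[of "labels ws" True] H[OF that] unfolding facets_def by (auto simp: flag_labels_def)
    then show ?thesis by auto
  qed
  moreover have "{ws \<in> H. fan True (mset (labels ws))} \<inter> {ws \<in> H. fan False (mset (labels ws))} = {}"
    using fan_unique[of True] H by (fastforce simp: flag_labels_def)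
  ultimately have "odd (card {ws \<in> H. fan True (mset (labels ws))} + card {ws \<in> H. fan False (mset (labels ws))})"
    using finH by (simp add: card_Un_disjoint)
  \<comment> \<open>The antipodal map turns the negative fans of the hemisphere into the positive
    fans outside it, so that both together make up the positive fans of dimension
    \<open>Suc d\<close>.\<close>
  moreover have "card {ws \<in> H. fan False (mset (labels ws))} =
      card {ws \<in> signed_perms (Suc d). (d, False) \<in> set ws \<and> fan True (mset (labels ws))}"
  proof (rule bij_betw_same_card[of "map (apsnd Not)"], rule bij_betw_byWitness[of _ "map (apsnd Not)"])
    have negneg: "map (apsnd Not) (map (apsnd Not) ws) = ws" for ws :: "(nat \<times> bool) list"
      by (induction ws) (auto simp: prod_eq_iff)
    have neg: "map (apsnd Not) ws \<in> signed_perms (Suc d)" if "ws \<in> signed_perms (Suc d)" for ws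
      using that by (auto simp: signed_perms_def image_image comp_def)
    have mem: "(c, s) \<in> set (map (apsnd Not) ws) \<longleftrightarrow> (c, \<not> s) \<in> set ws" for c s ws
      by (auto simp: image_iff) force+
    have one: "(d, True) \<in> set ws \<longleftrightarrow> (d, False) \<notin> set ws" if "ws \<in> signed_perms (Suc d)" for ws
    proof -
      have "d \<in> fst ` set ws" and inj: "inj_on fst (set ws)"
        using that by (auto simp: signed_perms_def distinct_map)
      then obtain s where "(d, s) \<in> set ws" by auto
      then show ?thesis using inj_onD[OF inj, of "(d, True)" "(d, False)"] by (cases s) auto
    qed
    have fan: "fan True (mset (labels (map (apsnd Not) ws))) \<longleftrightarrow> fan False (mset (labels ws))"
      "fan False (mset (labels (map (apsnd Not) ws))) \<longleftrightarrow> fan True (mset (labels ws))"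
      if "ws \<in> signed_perms (Suc d)" for ws
      using fan_negate[OF that Suc.prems] by auto
    show "map (apsnd Not) ` {ws \<in> H. fan False (mset (labels ws))}
        \<subseteq> {ws \<in> signed_perms (Suc d). (d, False) \<in> set ws \<and> fan True (mset (labels ws))}"
    proof (rule image_subsetI)
      fix ws assume "ws \<in> {ws \<in> H. fan False (mset (labels ws))}"
      then show "map (apsnd Not) ws \<in> {ws \<in> signed_perms (Suc d). (d, False) \<in> set ws \<and> fan True (mset (labels ws))}"
        using neg[of ws] mem[of d False ws] one[of ws] fan[of ws] by (simp add: H_def del: set_map)
    qed
    show "map (apsnd Not) ` {ws \<in> signed_perms (Suc d). (d, False) \<in> set ws \<and> fan True (mset (labels ws))}
        \<subseteq> {ws \<in> H. fan False (mset (labels ws))}"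
    proof (rule image_subsetI)
      fix ws assume "ws \<in> {ws \<in> signed_perms (Suc d). (d, False) \<in> set ws \<and> fan True (mset (labels ws))}"
      then show "map (apsnd Not) ws \<in> {ws \<in> H. fan False (mset (labels ws))}"
        using neg[of ws] mem[of d False ws] one[of ws] fan[of ws] by (simp add: H_def del: set_map)
    qed
    show "\<forall>ws\<in>{ws \<in> H. fan False (mset (labels ws))}. map (apsnd Not) (map (apsnd Not) ws) = ws"
      "\<forall>ws\<in>{ws \<in> signed_perms (Suc d). (d, False) \<in> set ws \<and> fan True (mset (labels ws))}.
        map (apsnd Not) (map (apsnd Not) ws) = ws"
      using negneg by (simp_all del: map_map)
  qed
  moreover have "{ws \<in> signed_perms (Suc d). fan True (mset (labels ws))} =
     {ws \<in> H. fan True (mset (labels ws))} \<union> {ws \<in> signed_perms (Suc d). (d, False) \<in> set ws \<and> fan True (mset (labels ws))}"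
    by (auto simp: H_def)
  moreover have "{ws \<in> H. fan True (mset (labels ws))} \<inter> {ws \<in> signed_perms (Suc d). (d, False) \<in> set ws \<and> fan True (mset (labels ws))} = {}"
    by (auto simp: H_def)
  ultimately show ?case
    using finH finite_signed_perms by (simp add: card_Un_disjoint)
qed

text \<open>By parity some flag is a fan. Its \<open>N\<close> sorted labels have strictly
  increasing absolute values, so the last of these is at least \<open>N - 1\<close>.\<close>

theorem octahedral_tucker: "N \<le> m"
proof -
  have "{ws \<in> signed_perms N. fan True (mset (labels ws))} \<noteq> {}"
    using odd_card_fan[of N] by (metis card.empty even_zero order_refl)
  then obtain ws where ws: "ws \<in> signed_perms N" and fan: "fan True (mset (labels ws))" by auto
  let ?ls = "sort (labels ws)"
  have len: "length ws = N" using length_signed_perms ws by auto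
  have alt: "alternating s bs \<Longrightarrow> Suc i < length bs \<Longrightarrow> bs ! i \<noteq> bs ! Suc i" for s bs i
  proof (induction bs arbitrary: s i)
    case (Cons b bs)
    then show ?case by (cases i; cases bs) auto
  qed simp
  \<comment> \<open>Equal absolute values would mean equal labels, against the alternation, or
    complementary ones, which a flag never carries.\<close>
  have step: "?ls ! i div 2 < ?ls ! Suc i div 2" if "Suc i < N" for i
  proof -
    have "?ls ! i \<le> ?ls ! Suc i"
      using that len by (auto intro: sorted_nth_mono)
    moreover have "map even ?ls ! i \<noteq> map even ?ls ! Suc i"
      using fan that len unfolding fan_def sorted_list_of_multiset_mset
      by (intro alt) auto
    moreover have "?ls ! i \<noteq> flip (?ls ! Suc i)"
      using labels_no_complement[OF ws order_refl] that len
      by (metis Suc_lessD length_labels length_sort nth_mem set_sort)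
    ultimately show ?thesis
      using div2_eqD[of "?ls ! i" "?ls ! Suc i"] that len div_le_mono[of "?ls ! i" "?ls ! Suc i" 2]
      by (fastforce simp: order_less_le)
  qed
  have ge: "i < N \<Longrightarrow> i \<le> ?ls ! i div 2" for i
    by (induction i) (use step in \<open>fastforce+\<close>)
  show ?thesis
  proof (cases N)
    case (Suc k)
    have "?ls ! k \<in> set (labels ws)"
      using len Suc by (metis length_labels length_sort lessI nth_mem set_sort)
    then obtain t where t: "t < length ws" "?ls ! k = L (set (take (Suc t) ws))"
      by (auto simp: flag_labels_def)
    moreover have "set (take (Suc t) ws) \<noteq> {}" using t by (cases ws) auto
    ultimately have "?ls ! k < 2 * m"
      using bounded flag_sign_vector[OF ws] by metis
    then show ?thesis using ge[of k] Suc by linarith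
  qed simp
qed

end

section \<open>Discrete halving\<close>

text \<open>Signs at odd positions are read reversed, so a run of consecutive positions with
  alternating signs lies in a single part.\<close>

definition signed_part :: "(nat \<times> bool) set \<Rightarrow> bool \<Rightarrow> nat set" where
  "signed_part X b = {j. (j, b = even j) \<in> X}"

definition alternates :: "nat \<Rightarrow> (nat \<times> bool) set \<Rightarrow> bool \<Rightarrow> nat set \<Rightarrow> bool" where
  "alternates N X s P \<longleftrightarrow> P \<subseteq> {..<N} \<and> (\<forall>p\<in>P. (p, s = even (card {q \<in> P. q < p})) \<in> X)"

definition alt_length :: "nat \<Rightarrow> (nat \<times> bool) set \<Rightarrow> bool \<Rightarrow> nat" where
  "alt_length N X s = Max (card ` {P. alternates N X s P})"

lemma finite_alternates: "finite {P. alternates N X s P}"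
  by (rule finite_subset[of _ "Pow {..<N}"]) (auto simp: alternates_def)

lemma alt_length_ge: "alternates N X s P \<Longrightarrow> card P \<le> alt_length N X s"
  unfolding alt_length_def using finite_alternates by (intro Max_ge) auto

lemma alt_length_obtain:
  obtains P where "alternates N X s P" "card P = alt_length N X s"
proof -
  have "alternates N X s {}" by (simp add: alternates_def)
  then have "alt_length N X s \<in> card ` {P. alternates N X s P}"
    unfolding alt_length_def using finite_alternates by (intro Max_in) auto
  then show ?thesis using that by auto
qed

lemma alt_length_mono: "X \<subseteq> Y \<Longrightarrow> alt_length N X s \<le> alt_length N Y s"
proof -
  assume sub: "X \<subseteq> Y"
  obtain P where P: "alternates N X s P" "card P = alt_length N X s"
    using alt_length_obtain by blast
  then have "alternates N Y s P" using sub by (auto simp: alternates_def)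
  then show ?thesis using alt_length_ge P(2) by metis
qed

lemma mem_antipode: "(j, s) \<in> antipode X \<longleftrightarrow> (j, \<not> s) \<in> X"
  unfolding antipode_def by (force simp: image_iff)

lemma alt_length_antipode: "alt_length N (antipode X) s = alt_length N X (\<not> s)"
proof -
  have "(\<not> (s = b)) = ((\<not> s) = b)" for b by auto
  then show ?thesis by (simp only: alt_length_def alternates_def mem_antipode)
qed

lemma signed_part_antipode: "signed_part (antipode X) b = signed_part X (\<not> b)"
proof -
  have "(\<not> (b = c)) = ((\<not> b) = c)" for c by auto
  then show ?thesis by (simp only: signed_part_def mem_antipode)
qed

text \<open>Let \<open>s\<close> be the sign at the first nonzero coordinate \<open>p\<close>. An
  alternating set starting with the other sign lies strictly to the right of \<open>p\<close> and
  becomes longer by adding \<open>p\<close>. The better starting sign is thus well defined and can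
  serve as the sign of a label.\<close>

lemma alt_length_neq:
  assumes X: "sign_vector N X" "X \<noteq> {}"
  shows "alt_length N X True \<noteq> alt_length N X False" "alt_length N X True \<ge> 1 \<or> alt_length N X False \<ge> 1"
proof -
  have sub: "fst ` X \<subseteq> {..<N}"
    using X(1) by (auto simp: sign_vector_def)
  then have fin: "finite (fst ` X)" using finite_subset by blast
  define p where "p = Min (fst ` X)"
  have "p \<in> fst ` X" using fin X(2) unfolding p_def by (intro Min_in) auto
  then obtain s where s: "(p, s) \<in> X" by auto
  have min: "p \<le> j" if "(j, t) \<in> X" for j t
    using that fin unfolding p_def by (intro Min_le) (auto simp: image_iff intro: bexI[of _ "(j, t)"])
  have inj: "s' = s" if "(p, s') \<in> X" for s'
    using inj_onD[of fst X "(p, s')" "(p, s)"] X(1) that s by (auto simp: sign_vector_def)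
  obtain P where P: "alternates N X (\<not> s) P" "card P = alt_length N X (\<not> s)"
    using alt_length_obtain by blast
  have finP: "finite P" using P by (auto simp: alternates_def intro: finite_subset)
  have pP: "p < q" if "q \<in> P" for q
  proof -
    have q: "(q, (\<not> s) = even (card {r \<in> P. r < q})) \<in> X" using P that by (auto simp: alternates_def)
    have "q \<noteq> p"
    proof
      assume "q = p"
      moreover have "{r \<in> P. r < p} = {}" using P min by (force simp: alternates_def)
      ultimately have "(p, (\<not> s) = even (card ({} :: nat set))) \<in> X" using q by metis
      then show False using inj by auto
    qed
    then show ?thesis using min[OF q] by simp
  qed
  have "alternates N X s (insert p P)"
    unfolding alternates_def
  proof
    show "insert p P \<subseteq> {..<N}" using P(1) sub \<open>p \<in> fst ` X\<close> by (auto simp: alternates_def)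
    show "\<forall>q\<in>insert p P. (q, s = even (card {r \<in> insert p P. r < q})) \<in> X"
    proof
      fix q assume q: "q \<in> insert p P"
      show "(q, s = even (card {r \<in> insert p P. r < q})) \<in> X"
      proof (cases "q = p")
        case True
        then have "{r \<in> insert p P. r < q} = {}" using pP by (auto dest: less_asym)
        then show ?thesis using s True by (simp only: card.empty) simp
      next
        case False
        then have "q \<in> P" using q by simp
        then have "{r \<in> insert p P. r < q} = insert p {r \<in> P. r < q}" using pP by auto
        then have "card {r \<in> insert p P. r < q} = Suc (card {r \<in> P. r < q})"
          using pP finP by (subst card_insert_disjoint[symmetric]) auto
        then have "(s = even (card {r \<in> insert p P. r < q})) = ((\<not> s) = even (card {r \<in> P. r < q}))" by auto
        then show ?thesis using P(1) \<open>q \<in> P\<close> by (simp add: alternates_def)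
      qed
    qed
  qed
  then have "card (insert p P) \<le> alt_length N X s" by (rule alt_length_ge)
  moreover have "card (insert p P) = Suc (card P)" using finP pP by (subst card_insert_disjoint) auto
  ultimately have "alt_length N X (\<not> s) < alt_length N X s" using P(2) by simp
  then show "alt_length N X True \<noteq> alt_length N X False" "alt_length N X True \<ge> 1 \<or> alt_length N X False \<ge> 1"
    by (cases s; simp)+
qed

text \<open>Twisting the signs by the parity of the position turns a long alternating subsequence into few
  sign changes; this is why the labels of the non-heavy sign vectors count alternations.\<close>

lemma discrete_halving:
  fixes w :: "nat \<Rightarrow> nat \<Rightarrow> real"
  assumes w0: "\<And>i j. i < n \<Longrightarrow> j < N \<Longrightarrow> 0 \<le> w i j"
    and w\<delta>: "\<And>i j. i < n \<Longrightarrow> j < N \<Longrightarrow> w i j \<le> \<delta>" and "0 \<le> \<delta>"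
  obtains \<tau> :: "nat \<Rightarrow> bool" where "card {j. Suc j < N \<and> \<tau> (Suc j) \<noteq> \<tau> j} \<le> n"
    "\<And>i. i < n \<Longrightarrow> \<bar>sum (w i) {j. j < N \<and> \<tau> j} - sum (w i) {j. j < N \<and> \<not> \<tau> j}\<bar> \<le> 2 * real n * \<delta>"
proof (cases "N \<le> n")
  case True
  \<comment> \<open>With at most \<open>n\<close> positions the total weight is within the bound
    already, so a constant assignment will do.\<close>
  show ?thesis
  proof (rule that[of "\<lambda>_. True"])
    fix i assume i: "i < n"
    have "sum (w i) {j. j < N} \<le> of_nat (card {..<N}) * \<delta>"
      unfolding lessThan_def[symmetric] using w\<delta>[OF i] by (intro sum_bounded_above) auto
    also have "\<dots> \<le> 2 * real n * \<delta>" using True \<open>0 \<le> \<delta>\<close> by (intro mult_right_mono) auto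
    finally show "\<bar>sum (w i) {j. j < N \<and> True} - sum (w i) {j. j < N \<and> \<not> True}\<bar> \<le> 2 * real n * \<delta>"
      using sum_nonneg[of "{j. j < N}" "w i"] w0[OF i] by simp
  qed simp
next
  case False
  define heavy where "heavy X i b \<longleftrightarrow> i < n \<and> 2 * sum (w i) (signed_part X b) > sum (w i) {..<N}" for X i b
  have part_sub: "signed_part X b \<subseteq> {..<N}" if "sign_vector N X" for X b
    using that by (auto simp: signed_part_def sign_vector_def)
  have part_fin: "finite (signed_part X b)" if "sign_vector N X" for X b
    using part_sub[OF that] finite_subset by blast
  have heavy_mono: "heavy Y i b" if "heavy X i b" "X \<subseteq> Y" "sign_vector N Y" for X Y i b
  proof -
    have "sum (w i) (signed_part X b) \<le> sum (w i) (signed_part Y b)"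
      using that part_sub[OF that(3), of b] part_fin[OF that(3), of b]
      by (intro sum_mono2) (auto simp: signed_part_def heavy_def intro!: w0)
    then show ?thesis using that by (auto simp: heavy_def)
  qed
  have heavy_one: "\<not> (heavy X i True \<and> heavy X i False)" if X: "sign_vector N X" for X i
  proof
    assume h: "heavy X i True \<and> heavy X i False"
    have disj: "signed_part X True \<inter> signed_part X False = {}"
      using inj_onD[of fst X "(j, s)" "(j, s')" for j s s'] X by (auto simp: signed_part_def sign_vector_def)
    have "sum (w i) (signed_part X True) + sum (w i) (signed_part X False) =
        sum (w i) (signed_part X True \<union> signed_part X False)"
      using part_fin[OF X] disj by (simp add: sum.union_disjoint)
    also have "\<dots> \<le> sum (w i) {..<N}"
      using part_sub[OF X] h by (intro sum_mono2) (auto simp: heavy_def intro!: w0)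
    finally show False using h by (simp add: heavy_def)
  qed
  have heavy_antipode: "heavy (antipode X) i b \<longleftrightarrow> heavy X i (\<not> b)" for X i b
    by (simp add: heavy_def signed_part_antipode)
  define fat where "fat X \<longleftrightarrow> (\<exists>i b. heavy X i b)" for X
  define idx where "idx X = (LEAST i. \<exists>b. heavy X i b)" for X
  have idx: "\<exists>b. heavy X (idx X) b" if "fat X" for X
    using that unfolding fat_def idx_def by (rule LeastI_ex)
  have idx_n: "idx X < n" if "fat X" for X
    using idx[OF that] by (auto simp: heavy_def)
  let ?a = "alt_length N"
  \<comment> \<open>The label of a vector with heavy parts names the least player having one, and
    the side. Any other vector is labelled by its longest alternation, shifted to absolute values
    from \<open>n\<close> on, and by the first sign of that alternation. Along an inclusion heavy
    sides are inherited and alternations do not get shorter, so equal absolute values force equal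
    signs.\<close>
  define L where "L X = (if fat X then 2 * idx X + (if heavy X (idx X) True then 0 else 1)
     else 2 * (n + max (?a X True) (?a X False) - 1) + (if ?a X True > ?a X False then 0 else 1))" for X
  have L_fat: "L X div 2 = idx X" "even (L X) \<longleftrightarrow> heavy X (idx X) True" if "fat X" for X
    using that by (auto simp: L_def)
  have L_thin: "L X div 2 = n + max (?a X True) (?a X False) - 1" "even (L X) \<longleftrightarrow> ?a X True > ?a X False"
    if "\<not> fat X" for X
    using that by (auto simp: L_def)
  have ex_antipode: "(\<exists>b. heavy (antipode X) i b) \<longleftrightarrow> (\<exists>b. heavy X i b)" for X i
    unfolding heavy_antipode by (auto simp: ex_bool_eq)
  have fat_antipode: "fat (antipode X) \<longleftrightarrow> fat X" for X
    unfolding fat_def ex_antipode ..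
  have idx_antipode: "idx (antipode X) = idx X" for X
    unfolding idx_def ex_antipode ..
  \<comment> \<open>Otherwise only the absolute values below \<open>N - 1\<close> occur, one fewer
    than Tucker's lemma requires.\<close>
  have "\<exists>X. sign_vector N X \<and> X \<noteq> {} \<and> \<not> fat X \<and> max (?a X True) (?a X False) \<ge> N - n"
  proof (rule ccontr)
    assume *: "\<not> ?thesis"
    have "tucker N (N - 1) L"
    proof
      fix X assume X: "sign_vector N X" "X \<noteq> {}"
      show "L (antipode X) = flip (L X)"
      proof (cases "fat X")
        case True
        have "heavy X (idx X) False \<longleftrightarrow> \<not> heavy X (idx X) True"
          using idx[OF True] heavy_one[OF X(1)] by (metis (full_types))
        then show ?thesis using True fat_antipode idx_antipode
          by (simp add: L_def heavy_antipode flip_def)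
      next
        case False
        then show ?thesis using fat_antipode alt_length_neq[OF X]
          by (auto simp: L_def alt_length_antipode flip_def max.commute)
      qed
      show "L X < 2 * (N - 1)"
      proof -
        have "L X div 2 < N - 1"
        proof (cases "fat X")
          case True
          then show ?thesis using L_fat(1) idx_n \<open>\<not> N \<le> n\<close> by fastforce
        next
          case False
          then have "max (?a X True) (?a X False) < N - n" using * X by fastforce
          then show ?thesis using L_thin(1)[OF False] alt_length_neq(2)[OF X] by linarith
        qed
        then show ?thesis by linarith
      qed
    next
      fix X Y :: "(nat \<times> bool) set"
      assume Y: "sign_vector N Y" and ne: "X \<noteq> {}" and sub: "X \<subseteq> Y"
      have X: "sign_vector N X" using Y sub by (auto simp: sign_vector_def inj_on_def)
      show "L X \<noteq> flip (L Y)"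
      proof
        assume eq: "L X = flip (L Y)"
        then have div: "L X div 2 = L Y div 2" and par: "even (L X) \<longleftrightarrow> odd (L Y)" by auto
        show False
        proof (cases "fat X")
          case True
          then have fY: "fat Y" using heavy_mono[OF _ sub Y] by (auto simp: fat_def)
          then have "idx X = idx Y" using div L_fat(1)[OF True] L_fat(1)[OF fY] by simp
          then show False
            using idx[OF True] par heavy_mono[OF _ sub Y] heavy_one[OF Y] L_fat(2)[OF True] L_fat(2)[OF fY]
            by (metis (full_types))
        next
          case False
          note thin = this
          have ge: "1 \<le> max (?a X True) (?a X False)" using alt_length_neq(2)[OF X ne] by linarith
          then have "\<not> fat Y" using div L_thin(1)[OF thin] L_fat(1)[of Y] idx_n[of Y] by linarith
          have neY: "Y \<noteq> {}" using sub ne by auto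
          have "1 \<le> max (?a Y True) (?a Y False)" using alt_length_neq(2)[OF Y neY] by linarith
          then have "max (?a X True) (?a X False) = max (?a Y True) (?a Y False)"
            using div L_thin(1)[OF thin] L_thin(1)[OF \<open>\<not> fat Y\<close>] ge by linarith
          then show False
            using alt_length_mono[OF sub, of N True] alt_length_mono[OF sub, of N False]
              alt_length_neq(1)[OF X ne] alt_length_neq(1)[OF Y neY] par L_thin(2)[OF thin] L_thin(2)[OF \<open>\<not> fat Y\<close>]
            by auto
        qed
      qed
    qed
    then have "N \<le> N - 1" by (rule tucker.octahedral_tucker)
    then show False using \<open>\<not> N \<le> n\<close> by simp
  qed
  then obtain X s where X: "sign_vector N X" "\<not> fat X" "?a X s \<ge> N - n"
    by (metis (full_types) max_def)
  obtain P where P: "alternates N X s P" "card P \<ge> N - n"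
    using alt_length_obtain[of N X s] X(3) by metis
  have PN: "P \<subseteq> {..<N}" using P(1) by (simp add: alternates_def)
  then have finP: "finite P" using finite_subset by blast
  define rank where "rank p = card {q \<in> P. q < p}" for p
  define sgn' where "sgn' p = ((s = even (rank p)) = even p)" for p
  \<comment> \<open>Positions of \<open>P\<close> take their twisted sign, skipped ones copy their
    left neighbour. Neighbouring positions of \<open>P\<close> have opposite signs, hence equal
    twisted signs; a change therefore happens only right after a skipped position.\<close>
  define \<tau> where "\<tau> = rec_nat (sgn' 0) (\<lambda>j t. if Suc j \<in> P then sgn' (Suc j) else t)"
  have \<tau>_Suc: "\<tau> (Suc j) = (if Suc j \<in> P then sgn' (Suc j) else \<tau> j)" for j
    by (simp add: \<tau>_def)
  have \<tau>_P: "\<tau> p = sgn' p" if "p \<in> P" for p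
    using that by (cases p) (auto simp: \<tau>_def)
  have card_skipped: "card ({..<N} - P) \<le> n"
    using card_Diff_subset[OF finP PN] P(2) by simp
  show ?thesis
  proof (rule that[of \<tau>])
    have "{j. Suc j < N \<and> \<tau> (Suc j) \<noteq> \<tau> j} \<subseteq> {..<N} - P"
    proof clarify
      fix j assume j: "Suc j < N" "\<tau> (Suc j) \<noteq> \<tau> j"
      have SjP: "Suc j \<in> P" using j(2) by (auto simp: \<tau>_Suc split: if_splits)
      have "j \<notin> P"
      proof
        assume jP: "j \<in> P"
        have "{q \<in> P. q < Suc j} = insert j {q \<in> P. q < j}" using jP by auto
        then have "rank (Suc j) = Suc (rank j)"
          unfolding rank_def using finP by (simp only:) (subst card_insert_disjoint, auto)
        then have "sgn' (Suc j) = sgn' j" by (auto simp: sgn'_def)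
        then show False using j(2) \<tau>_P[OF jP] \<tau>_P[OF SjP] by simp
      qed
      then show "j \<in> {..<N} - P" using j by simp
    qed
    then show "card {j. Suc j < N \<and> \<tau> (Suc j) \<noteq> \<tau> j} \<le> n"
      using card_skipped card_mono[of "{..<N} - P"] by (meson finite_Diff finite_lessThan le_trans)
  next
    fix i assume i: "i < n"
    \<comment> \<open>Apart from the skipped positions, class \<open>b\<close> lies in
      \<open>signed_part X b\<close>, which is not heavy; at most \<open>n\<close> positions are
      skipped. Upper bounds for both classes bound their difference.\<close>
    have half: "sum (w i) {j. j < N \<and> \<tau> j = b} \<le> sum (w i) {..<N} / 2 + n * \<delta>" for b
    proof -
      have sub: "{j. j < N \<and> \<tau> j = b} \<subseteq> signed_part X b \<union> ({..<N} - P)"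
      proof clarify
        fix j assume j: "j < N" "j \<notin> {..<N} - P" "b = \<tau> j"
        then have "j \<in> P" by simp
        then show "j \<in> signed_part X (\<tau> j)"
          using P(1) \<tau>_P[of j] unfolding alternates_def signed_part_def rank_def[symmetric] sgn'_def
          by (cases "even j") auto
      qed
      have "sum (w i) {j. j < N \<and> \<tau> j = b} \<le> sum (w i) (signed_part X b \<union> ({..<N} - P))"
        using sub part_sub[OF X(1), of b] i part_fin[OF X(1), of b] by (intro sum_mono2) (auto intro!: w0)
      also have "\<dots> \<le> sum (w i) (signed_part X b) + sum (w i) ({..<N} - P)"
        using part_fin[OF X(1), of b] part_sub[OF X(1), of b] i
        by (subst sum.union_inter[symmetric]) (auto intro!: sum_nonneg w0)
      also have "sum (w i) (signed_part X b) \<le> sum (w i) {..<N} / 2"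
      proof -
        have "\<not> heavy X i b" using X(2) unfolding fat_def by blast
        then show ?thesis using i by (simp add: heavy_def)
      qed
      also have "sum (w i) ({..<N} - P) \<le> of_nat (card ({..<N} - P)) * \<delta>"
        using w\<delta>[OF i] by (intro sum_bounded_above) auto
      also have "\<dots> \<le> n * \<delta>"
        using card_skipped \<open>0 \<le> \<delta>\<close> by (intro mult_right_mono) auto
      finally show ?thesis by simp
    qed
    have "sum (w i) {..<N} = sum (w i) {j. j < N \<and> \<tau> j} + sum (w i) {j. j < N \<and> \<not> \<tau> j}"
      by (subst sum.union_disjoint[symmetric]) (auto intro!: sum.cong)
    then show "\<bar>sum (w i) {j. j < N \<and> \<tau> j} - sum (w i) {j. j < N \<and> \<not> \<tau> j}\<bar> \<le> 2 * real n * \<delta>"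
      using half[of True] half[of False] unfolding eq_True eq_False by linarith
  qed
qed

section \<open>Knowledge sets\<close>

type_synonym world = "(nat \<Rightarrow> real \<Rightarrow> real) \<times> (nat \<Rightarrow> real \<Rightarrow> real)"

definition worlds :: "nat \<Rightarrow> world set" where
  "worlds n = {(v, c). (\<forall>i\<in>{1..n}. value_density (v i)) \<and> cut_rule n v c}"

definition legal_from :: "nat \<Rightarrow> real set \<Rightarrow> (query \<times> real) list \<Rightarrow> bool" where
  "legal_from n D tr \<longleftrightarrow> (\<forall>t < length tr.
     case fst (tr ! t) of
       Cut i \<alpha> \<Rightarrow> i \<in> {1..n} \<and> \<alpha> \<in> {0..1}
     | Eval i y \<Rightarrow> i \<in> {1..n} \<and> y \<in> D \<union> cut_points (take t tr))"

text \<open>\<open>achievable n D q S F\<close>: when the cut points \<open>D\<close> are already known and the actual world is only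
  known to lie in \<open>S\<close>, the goal \<open>F\<close> can be met with at most \<open>q\<close> further queries.\<close>

definition achievable ::
    "nat \<Rightarrow> real set \<Rightarrow> nat \<Rightarrow> world set \<Rightarrow> (world \<Rightarrow> real set \<Rightarrow> 'o \<Rightarrow> bool) \<Rightarrow> bool" where
  "achievable n D q S F \<longleftrightarrow> (\<exists>P. \<forall>w\<in>S.
     let tr = transcript (answer (fst w) (snd w)) P in
       legal_from n D tr \<and> length tr \<le> q \<and> F w (D \<union> cut_points tr) (outcome (answer (fst w) (snd w)) P))"

lemma cut_points_Cons:
  "cut_points ((Cut i \<alpha>, y) # tr) = insert y (cut_points tr)"
  "cut_points ((Eval i z, y) # tr) = cut_points tr"
  by (auto simp: cut_points_def)

lemma cut_points_Nil [simp]: "cut_points [] = {}"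
  by (simp add: cut_points_def)

lemma legal_from_Cut:
  assumes "i \<in> {1..n}" "\<alpha> \<in> {0..1}" "legal_from n (insert y D) tr"
  shows "legal_from n D ((Cut i \<alpha>, y) # tr)"
  unfolding legal_from_def
proof (intro allI impI)
  fix t assume "t < length ((Cut i \<alpha>, y) # tr)"
  then show "case fst (((Cut i \<alpha>, y) # tr) ! t) of
       Cut i \<alpha> \<Rightarrow> i \<in> {1..n} \<and> \<alpha> \<in> {0..1}
     | Eval i' y' \<Rightarrow> i' \<in> {1..n} \<and> y' \<in> D \<union> cut_points (take t ((Cut i \<alpha>, y) # tr))"
    using assms by (cases t) (auto simp: legal_from_def cut_points_Cons split: query.splits)
qed

lemma legal_from_Eval:
  assumes "i \<in> {1..n}" "z \<in> D" "legal_from n D tr"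
  shows "legal_from n D ((Eval i z, y) # tr)"
  unfolding legal_from_def
proof (intro allI impI)
  fix t assume "t < length ((Eval i z, y) # tr)"
  then show "case fst (((Eval i z, y) # tr) ! t) of
       Cut i \<alpha> \<Rightarrow> i \<in> {1..n} \<and> \<alpha> \<in> {0..1}
     | Eval i' y' \<Rightarrow> i' \<in> {1..n} \<and> y' \<in> D \<union> cut_points (take t ((Eval i z, y) # tr))"
    using assms by (cases t) (auto simp: legal_from_def cut_points_Cons split: query.splits)
qed

lemma achievable_output:
  assumes "\<And>w. w \<in> S \<Longrightarrow> F w D A"
  shows "achievable n D q S F"
  unfolding achievable_def
  by (rule exI[of _ "Output A"]) (auto simp: assms legal_from_def Let_def)

lemma achievable_mono:
  assumes "achievable n D q S F" "q \<le> q'" "S' \<subseteq> S"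
  shows "achievable n D q' S' F"
  using assms unfolding achievable_def Let_def by (meson le_trans subsetD)

text \<open>A protocol for each possible answer is picked by choice, and all of them are hung below
  one \<open>Ask\<close> node.\<close>

lemma achievable_cut:
  assumes i: "i \<in> {1..n}" "\<alpha> \<in> {0..1}"
    and *: "\<And>y. achievable n (insert y D) q {w \<in> S. snd w i \<alpha> = y} F"
  shows "achievable n D (Suc q) S F"
proof -
  obtain P where P: "\<And>y w. w \<in> S \<Longrightarrow> snd w i \<alpha> = y \<Longrightarrow>
      let tr = transcript (answer (fst w) (snd w)) (P y) in
       legal_from n (insert y D) tr \<and> length tr \<le> q \<and>
       F w (insert y D \<union> cut_points tr) (outcome (answer (fst w) (snd w)) (P y))"
    using * unfolding achievable_def by (metis (mono_tags, lifting) mem_Collect_eq)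
  show ?thesis
    unfolding achievable_def
  proof (intro exI[of _ "Ask (Cut i \<alpha>) P"] ballI)
    fix w assume "w \<in> S"
    then show "let tr = transcript (answer (fst w) (snd w)) (Ask (Cut i \<alpha>) P) in
       legal_from n D tr \<and> length tr \<le> Suc q \<and>
       F w (D \<union> cut_points tr) (outcome (answer (fst w) (snd w)) (Ask (Cut i \<alpha>) P))"
      using P[of w "snd w i \<alpha>"] legal_from_Cut[OF i] by (simp add: Let_def cut_points_Cons)
  qed
qed

lemma achievable_eval_cut_point:
  assumes i: "i \<in> {1..n}" "z \<in> D"
    and *: "\<And>y. achievable n D q {w \<in> S. piece_value (fst w i) {0..z} = y} F"
  shows "achievable n D (Suc q) S F"
proof -
  obtain P where P: "\<And>y w. w \<in> S \<Longrightarrow> piece_value (fst w i) {0..z} = y \<Longrightarrow>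
      let tr = transcript (answer (fst w) (snd w)) (P y) in
       legal_from n D tr \<and> length tr \<le> q \<and>
       F w (D \<union> cut_points tr) (outcome (answer (fst w) (snd w)) (P y))"
    using * unfolding achievable_def by (metis (mono_tags, lifting) mem_Collect_eq)
  show ?thesis
    unfolding achievable_def
  proof (intro exI[of _ "Ask (Eval i z) P"] ballI)
    fix w assume "w \<in> S"
    then show "let tr = transcript (answer (fst w) (snd w)) (Ask (Eval i z) P) in
       legal_from n D tr \<and> length tr \<le> Suc q \<and>
       F w (D \<union> cut_points tr) (outcome (answer (fst w) (snd w)) (Ask (Eval i z) P))"
      using P[of w "piece_value (fst w i) {0..z}"] legal_from_Eval[OF i] by (simp add: Let_def cut_points_Cons)
  qed
qed

text \<open>A non-adaptive batch. The world \<open>w0\<close> stands for the vector of its answers,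
  so only answers that some world of \<open>S\<close> really gives have to be handled.\<close>

lemma achievable_cuts:
  assumes "finite Q" "Q \<subseteq> {1..n} \<times> {0..1}"
    and "\<And>w0. w0 \<in> S \<Longrightarrow> achievable n (D \<union> (\<lambda>(i, \<alpha>). snd w0 i \<alpha>) ` Q) q
           {w \<in> S. \<forall>(i, \<alpha>) \<in> Q. snd w i \<alpha> = snd w0 i \<alpha>} F"
  shows "achievable n D (card Q + q) S F"
  using assms
proof (induction Q arbitrary: D S rule: finite_induct)
  case empty
  show ?case
  proof (cases "S = {}")
    case True
    then show ?thesis by (simp add: achievable_def)
  next
    case False
    then show ?thesis using empty by auto
  qed
next
  case (insert p Q)
  obtain i \<alpha> where p: "p = (i, \<alpha>)" by fastforce
  have "achievable n D (Suc (card Q + q)) S F"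
  proof (rule achievable_cut)
    show "i \<in> {1..n}" "\<alpha> \<in> {0..1}" using insert.prems p by auto
    fix y
    show "achievable n (insert y D) (card Q + q) {w \<in> S. snd w i \<alpha> = y} F"
    proof (rule insert.IH)
      fix w0 assume w0: "w0 \<in> {w \<in> S. snd w i \<alpha> = y}"
      then have "achievable n (D \<union> (\<lambda>(i, \<alpha>). snd w0 i \<alpha>) ` insert p Q) q
           {w \<in> S. \<forall>(i, \<alpha>) \<in> insert p Q. snd w i \<alpha> = snd w0 i \<alpha>} F"
        by (intro insert.prems) auto
      moreover have "insert y D \<union> (\<lambda>(i, \<alpha>). snd w0 i \<alpha>) ` Q = D \<union> (\<lambda>(i, \<alpha>). snd w0 i \<alpha>) ` insert p Q"
        using w0 p by auto
      moreover have "{w \<in> {w \<in> S. snd w i \<alpha> = y}. \<forall>(i, \<alpha>) \<in> Q. snd w i \<alpha> = snd w0 i \<alpha>} =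
          {w \<in> S. \<forall>(i, \<alpha>) \<in> insert p Q. snd w i \<alpha> = snd w0 i \<alpha>}"
        using w0 p by auto
      ultimately show "achievable n (insert y D \<union> (\<lambda>(i, \<alpha>). snd w0 i \<alpha>) ` Q) q
         {w \<in> {w \<in> S. snd w i \<alpha> = y}. \<forall>(i, \<alpha>) \<in> Q. snd w i \<alpha> = snd w0 i \<alpha>} F"
        by simp
    qed (use insert.prems in auto)
  qed
  then show ?case using insert.hyps by simp
qed

lemma rw_computableI:
  assumes "achievable n {} q (worlds n) (\<lambda>w D A. cake_partition m A \<and>
      (\<forall>j\<in>{1..m}. frontier (A j) \<subseteq> {0, 1} \<union> D) \<and> F (fst w) A)" and "real q \<le> Q"
  shows "rw_computable n m Q F"
proof -
  have legal: "legal_from n {} tr = legal n tr" for tr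
    by (simp only: legal_from_def legal_def Un_empty_left)
  obtain P where P: "\<And>w. w \<in> worlds n \<Longrightarrow> (let tr = transcript (answer (fst w) (snd w)) P;
        A = outcome (answer (fst w) (snd w)) P in
        legal n tr \<and> length tr \<le> q \<and> cake_partition m A \<and>
        (\<forall>j\<in>{1..m}. frontier (A j) \<subseteq> {0, 1} \<union> cut_points tr) \<and> F (fst w) A)"
    using assms(1) unfolding achievable_def Let_def legal by auto
  show ?thesis
    unfolding rw_computable_def
  proof (intro exI[of _ P] allI impI)
    fix v c assume "(\<forall>i\<in>{1..n}. value_density (v i)) \<and> cut_rule n v c"
    then have "(v, c) \<in> worlds n" by (simp add: worlds_def)
    from P[OF this] show "let tr = transcript (answer v c) P; A = outcome (answer v c) P in
             legal n tr \<and> real (length tr) \<le> Q \<and> cake_partition m A \<and>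
             (\<forall>j\<in>{1..m}. frontier (A j) \<subseteq> {0, 1} \<union> cut_points tr) \<and> F v A"
      using assms(2) by (auto simp: Let_def)
  qed
qed

section \<open>The value measures\<close>

text \<open>A finite measure on the whole line gives access to the library facts on additivity and
  monotonicity. The indicator is there because a density is unrestricted outside the cake.\<close>

definition value_measure :: "(real \<Rightarrow> real) \<Rightarrow> real measure" where
  "value_measure d = density lebesgue (\<lambda>x. ennreal (indicator {0..1} x * d x))"

abbreviation cake_value :: "(real \<Rightarrow> real) \<Rightarrow> real set \<Rightarrow> real" where
  "cake_value d \<equiv> measure (value_measure d)"

lemma sets_value_measure [simp, measurable_cong]: "sets (value_measure d) = sets lebesgue"
  by (simp add: value_measure_def)

lemma space_value_measure [simp]: "space (value_measure d) = UNIV"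
  by (simp add: value_measure_def)

locale valued_cake =
  fixes d assumes value_density: "value_density d"
begin

lemma density_integrable: "integrable lebesgue (\<lambda>x. indicator {0..1} x * d x)"
  using value_density by (simp add: value_density_def set_integrable_def)

lemma nonneg_density: "0 \<le> indicator {0..1} x * d x"
  using value_density by (auto simp: value_density_def indicator_def)

lemma emeasure_value:
  assumes "S \<in> sets lebesgue"
  shows "emeasure (value_measure d) S = ennreal (\<integral>x. indicator S x * (indicator {0..1} x * d x) \<partial>lebesgue)"
proof -
  have [measurable]: "(\<lambda>x. indicator {0..1} x * d x) \<in> borel_measurable lebesgue"
    using density_integrable by (rule borel_measurable_integrable)
  have "emeasure (value_measure d) S = (\<integral>\<^sup>+ x. ennreal (indicator {0..1} x * d x) * indicator S x \<partial>lebesgue)"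
    unfolding value_measure_def using assms by (intro emeasure_density) auto
  also have "\<dots> = (\<integral>\<^sup>+ x. ennreal (indicator S x * (indicator {0..1} x * d x)) \<partial>lebesgue)"
    by (intro nn_integral_cong) (auto simp: indicator_def)
  also have "\<dots> = ennreal (\<integral>x. indicator S x * (indicator {0..1} x * d x) \<partial>lebesgue)"
    using nonneg_density assms density_integrable
    by (intro nn_integral_eq_integral) (auto simp: integrable_real_mult_indicator mult.commute[of "indicator S _"])
  finally show ?thesis .
qed

sublocale finite_measure "value_measure d"
  by (rule finite_measureI) (simp add: emeasure_value)

lemma measure_eq_piece_value:
  assumes "S \<in> sets lebesgue" "S \<subseteq> {0..1}"
  shows "cake_value d S = piece_value d S"
proof -
  have "cake_value d S = (\<integral>x. indicator S x * (indicator {0..1} x * d x) \<partial>lebesgue)"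
    unfolding measure_def emeasure_value[OF assms(1)] using nonneg_density
    by (intro enn2real_ennreal Bochner_Integration.integral_nonneg) auto
  also have "\<dots> = (\<integral>x. indicator S x *\<^sub>R d x \<partial>lebesgue)"
    using assms(2) by (intro Bochner_Integration.integral_cong) (auto simp: indicator_def)
  finally show ?thesis by (simp add: piece_value_def set_lebesgue_integral_def)
qed

lemma null_singleton: "cake_value d {x} = 0"
proof -
  have "AE y in lebesgue. y \<noteq> x"
    by (rule AE_I[of _ _ "{x}"]) auto
  then have "AE y in lebesgue. indicator {x} y * (indicator {0..1} y * d y) = 0"
    by eventually_elim simp
  then have "(\<integral>y. indicator {x} y * (indicator {0..1} y * d y) \<partial>lebesgue) = 0"
    by (rule integral_eq_zero_AE)
  then show ?thesis by (simp add: measure_def emeasure_value)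
qed


definition cdf :: "real \<Rightarrow> real" where "cdf y = piece_value d {0..y}"

lemma cdf_measure: "y \<le> 1 \<Longrightarrow> cdf y = cake_value d {0..y}"
  unfolding cdf_def by (subst measure_eq_piece_value) auto

lemma cdf_0 [simp]: "cdf 0 = 0"
  by (simp add: cdf_measure null_singleton)

lemma cdf_1 [simp]: "cdf 1 = 1"
  using value_density by (simp add: cdf_def value_density_def)

lemma cdf_mono: "x \<le> y \<Longrightarrow> y \<le> 1 \<Longrightarrow> cdf x \<le> cdf y"
  by (simp add: cdf_measure) (rule finite_measure_mono, auto)

lemma cdf_bounds: "y \<le> 1 \<Longrightarrow> 0 \<le> cdf y" "y \<le> 1 \<Longrightarrow> cdf y \<le> 1"
  using cdf_mono[of y 1] by (auto simp: cdf_measure[of y])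

text \<open>Since \<open>cdf\<close> may be constant on intervals, points are compared through
  strict inequalities between their values.\<close>

lemma cdf_less_imp: "cdf x < cdf y \<Longrightarrow> x \<le> 1 \<Longrightarrow> x < y"
  using cdf_mono[of y x] by force

lemma measure_Ioc: "0 \<le> a \<Longrightarrow> a \<le> b \<Longrightarrow> b \<le> 1 \<Longrightarrow> cake_value d {a<..b} = cdf b - cdf a"
proof -
  assume ab: "0 \<le> a" "a \<le> b" "b \<le> 1"
  have "{0..b} = {0..a} \<union> {a<..b}" using ab by auto
  then have "cake_value d {0..b} = cake_value d {0..a} + cake_value d {a<..b}"
    by (subst finite_measure_Union[symmetric]) auto
  then show ?thesis using ab by (simp add: cdf_measure)
qed

text \<open>Single points are worthless, so it does not matter which of the two endpoints
  \<open>S\<close> contains.\<close>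

lemma measure_interval:
  assumes "0 \<le> a" "a \<le> b" "b \<le> 1" "{a<..<b} \<subseteq> S" "S \<subseteq> {a..b}" "S \<in> sets borel"
  shows "cake_value d S = cdf b - cdf a"
proof (rule antisym)
  have [simp]: "S \<in> sets lebesgue" using assms(6) by simp
  have "S \<union> {b} \<in> sets borel" using assms(6) by (intro sets.Un) auto
  then have [simp]: "insert b S \<in> sets lebesgue" by simp
  have "cake_value d S \<le> cake_value d ({a} \<union> {a<..b})"
    using assms by (intro finite_measure_mono) auto
  also have "\<dots> = cake_value d {a<..b}"
    by (subst finite_measure_Union) (auto simp: null_singleton)
  finally show "cake_value d S \<le> cdf b - cdf a"
    using measure_Ioc assms by simp
  have "{a<..b} \<subseteq> insert b {a<..<b}" by auto
  then have "{a<..b} \<subseteq> S \<union> {b}" using assms(4) by blast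
  then have "cake_value d {a<..b} \<le> cake_value d (S \<union> {b})"
    by (intro finite_measure_mono) auto
  also have "\<dots> \<le> cake_value d S + cake_value d {b}"
    by (intro measure_Un_le) auto
  finally show "cdf b - cdf a \<le> cake_value d S"
    using measure_Ioc assms by (simp add: null_singleton)
qed

lemma continuous_cdf: "continuous_on {0..1} cdf"
proof -
  have int: "set_integrable lebesgue {0..y} d" if "y \<le> 1" for y
    using value_density that unfolding value_density_def
    by (auto intro: set_integrable_subset[of lebesgue "{0..1}" d])
  have "d integrable_on {0..1}"
    using set_lebesgue_integral_eq_integral(1)[OF int[of 1]] by simp
  then have "continuous_on {0..1} (\<lambda>y. integral {0..y} d)"
    by (rule indefinite_integral_continuous_1)
  moreover have "cdf y = integral {0..y} d" if "y \<in> {0..1}" for y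
    using set_lebesgue_integral_eq_integral(2)[OF int[of y]] that by (simp add: cdf_def piece_value_def)
  ultimately show ?thesis using continuous_on_eq[of "{0..1}" "\<lambda>y. integral {0..y} d" cdf] by simp
qed

end

lemma worlds_valued_cake: "w \<in> worlds n \<Longrightarrow> i \<in> {1..n} \<Longrightarrow> valued_cake (fst w i)"
  by (auto simp: worlds_def valued_cake_def)

lemma worlds_cut:
  "w \<in> worlds n \<Longrightarrow> i \<in> {1..n} \<Longrightarrow> \<alpha> \<in> {0..1} \<Longrightarrow> snd w i \<alpha> \<in> {0..1}"
  "w \<in> worlds n \<Longrightarrow> i \<in> {1..n} \<Longrightarrow> \<alpha> \<in> {0..1} \<Longrightarrow> valued_cake.cdf (fst w i) (snd w i \<alpha>) = \<alpha>"
  by (auto simp: worlds_def cut_rule_def valued_cake.cdf_def[OF valued_cake.intro])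

section \<open>Step colourings\<close>

text \<open>Colourings are right-continuous, so that a piece is a union of half-open intervals.\<close>

definition step :: "real set \<Rightarrow> (real \<Rightarrow> 'c) \<Rightarrow> bool" where
  "step Z col \<longleftrightarrow> finite Z \<and> (\<forall>x y. 0 \<le> x \<longrightarrow> x \<le> y \<longrightarrow> y \<le> 1 \<longrightarrow> Z \<inter> {x<..y} = {} \<longrightarrow> col x = col y)"

text \<open>Describing the intervals between points of \<open>Z\<close> by comparisons makes points
  outside the cake harmless and gives convexity and measurability directly.\<close>

definition cell :: "real set \<Rightarrow> real \<Rightarrow> real set" where
  "cell Z x = {y \<in> {0..1}. \<forall>z\<in>Z. z \<le> y \<longleftrightarrow> z \<le> x}"

lemma step_cell:
  assumes "step Z col" "x \<in> {0..1}" "y \<in> cell Z x"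
  shows "col y = col x"
proof -
  have y: "0 \<le> y" "y \<le> 1" and Z: "\<And>z. z \<in> Z \<Longrightarrow> z \<le> y \<longleftrightarrow> z \<le> x"
    using assms by (auto simp: cell_def)
  have "Z \<inter> {x<..y} = {}" "Z \<inter> {y<..x} = {}" using Z by force+
  then show ?thesis
    using assms y by (cases "x \<le> y") (auto simp: step_def)
qed

lemma cell_borel: "finite Z \<Longrightarrow> cell Z x \<in> sets borel"
proof -
  assume "finite Z"
  have "{y \<in> space borel. z \<le> y \<longleftrightarrow> z \<le> x} \<in> sets borel" for z
  proof (cases "z \<le> x")
    case True
    then have "{y \<in> space borel. z \<le> y \<longleftrightarrow> z \<le> x} = {z..}" by auto
    then show ?thesis by simp
  next
    case False
    then have "{y \<in> space borel. z \<le> y \<longleftrightarrow> z \<le> x} = {..<z}" by auto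
    then show ?thesis by simp
  qed
  then have "{y \<in> space borel. \<forall>z\<in>Z. z \<le> y \<longleftrightarrow> z \<le> x} \<in> sets borel"
    using \<open>finite Z\<close> by (intro sets.sets_Collect_finite_All)
  then have "{y. \<forall>z\<in>Z. z \<le> y \<longleftrightarrow> z \<le> x} \<in> sets borel" by simp
  moreover have "cell Z x = {0..1} \<inter> {y. \<forall>z\<in>Z. z \<le> y \<longleftrightarrow> z \<le> x}" by (auto simp: cell_def)
  ultimately show ?thesis by auto
qed

lemma cell_is_interval: "is_interval (cell Z x)"
  unfolding is_interval_1 cell_def by force

lemma finite_cells: "finite Z \<Longrightarrow> finite (range (cell Z))"
proof -
  assume "finite Z"
  moreover have "cell Z x = (\<lambda>Y. {y \<in> {0..1}. \<forall>z\<in>Z. z \<le> y \<longleftrightarrow> z \<in> Y}) (Z \<inter> {..x})" for x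
    by (auto simp: cell_def)
  then have "range (cell Z) \<subseteq> (\<lambda>Y. {y \<in> {0..1}. \<forall>z\<in>Z. z \<le> y \<longleftrightarrow> z \<in> Y}) ` Pow Z"
    by (intro image_subsetI) (rule image_eqI, assumption, simp)
  ultimately show ?thesis by (meson finite_Pow_iff finite_imageI finite_subset)
qed

lemma cells_disjoint: "disjoint (range (cell Z))"
  unfolding disjoint_def cell_def by auto

lemma step_class_cells:
  assumes "step Z col"
  shows "{x \<in> {0..1}. P (col x)} = \<Union>(cell Z ` {x \<in> {0..1}. P (col x)})"
proof
  show "{x \<in> {0..1}. P (col x)} \<subseteq> \<Union> (cell Z ` {x \<in> {0..1}. P (col x)})"
    by (auto simp: cell_def)
  show "\<Union> (cell Z ` {x \<in> {0..1}. P (col x)}) \<subseteq> {x \<in> {0..1}. P (col x)}"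
  proof clarify
    fix x y assume "x \<in> {0..1}" "P (col x)" "y \<in> cell Z x"
    then show "y \<in> {0..1} \<and> P (col y)"
      using step_cell[OF assms, of x y] by (simp add: cell_def)
  qed
qed

lemma step_class_borel:
  assumes "step Z col"
  shows "{x \<in> {0..1}. P (col x)} \<in> sets borel"
proof -
  have "finite Z" using assms by (simp add: step_def)
  then show ?thesis
    by (subst step_class_cells[OF assms])
       (auto intro!: sets.finite_Union cell_borel finite_subset[OF _ finite_cells])
qed

lemma step_is_piece:
  assumes "step Z col"
  shows "is_piece {x \<in> {0..1}. P (col x)}"
  unfolding is_piece_def
proof (intro exI conjI)
  have "finite Z" using assms by (simp add: step_def)
  then show "finite (cell Z ` {x \<in> {0..1}. P (col x)})"
    by (rule finite_subset[OF image_mono[OF subset_UNIV] finite_cells])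
  show "disjoint (cell Z ` {x \<in> {0..1}. P (col x)})"
    using cells_disjoint[of Z] by (auto simp: disjoint_def)
  show "\<forall>J\<in>cell Z ` {x \<in> {0..1}. P (col x)}. is_interval J"
    using cell_is_interval by auto
qed (rule step_class_cells[OF assms])

lemma step_cake_partition:
  assumes "step Z col" "\<And>x. x \<in> {0..1} \<Longrightarrow> col x \<in> {1..m}"
  shows "cake_partition m (\<lambda>j. {x \<in> {0..1}. col x = j})"
  unfolding cake_partition_def disjoint_family_on_def
  using assms step_is_piece[OF assms(1)] by fastforce

text \<open>Any other point has a ball that avoids \<open>Z\<close> and the ends of the cake, and
  the colour is constant on it.\<close>

lemma step_frontier:
  assumes "step Z col"
  shows "frontier {x \<in> {0..1}. P (col x)} \<subseteq> {0, 1} \<union> Z"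
proof
  let ?S = "{x \<in> {0..1}. P (col x)}"
  fix x assume x: "x \<in> frontier ?S"
  show "x \<in> {0, 1} \<union> Z"
  proof (rule ccontr)
    assume nx: "x \<notin> {0, 1} \<union> Z"
    have "open (- ({0, 1} \<union> Z))"
      using assms by (intro open_Compl finite_imp_closed) (auto simp: step_def)
    then obtain e where e: "e > 0" "ball x e \<subseteq> - ({0, 1} \<union> Z)"
      using nx by (meson ComplI open_contains_ball)
    have same: "y \<in> ?S \<longleftrightarrow> x \<in> ?S" if y: "y \<in> ball x e" for y
    proof -
      have seg: "u \<notin> {0, 1} \<union> Z" if "min x y \<le> u" "u \<le> max x y" for u
      proof -
        have "u \<in> ball x e" using that y by (auto simp: dist_real_def)
        then show ?thesis using e by blast
      qed
      have in01: "y \<in> {0..1} \<longleftrightarrow> x \<in> {0..1}"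
        using seg[of 0] seg[of 1] by (smt (verit) Un_iff atLeastAtMost_iff insertI1 insertI2)
      have "col y = col x" if "x \<in> {0..1}"
      proof (cases "x \<le> y")
        case True
        moreover have "Z \<inter> {x<..y} = {}" using seg True by force
        ultimately show ?thesis using assms that in01 unfolding step_def by (metis atLeastAtMost_iff)
      next
        case False
        moreover have "Z \<inter> {y<..x} = {}" using seg False by force
        ultimately show ?thesis using assms that in01 unfolding step_def by (metis atLeastAtMost_iff linear)
      qed
      then show ?thesis using in01 by auto
    qed
    show False
    proof (cases "x \<in> ?S")
      case True
      then have "ball x e \<subseteq> ?S" using same by blast
      then have "x \<in> interior ?S" using e(1) by (meson centre_in_ball interiorI open_ball)
      then show False using x by (simp add: frontier_def)
    next
      case False
      then have "ball x e \<inter> ?S = {}" using same by blast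
      then have "x \<notin> closure ?S" using e(1) by (metis centre_in_ball open_Int_closure_eq_empty open_ball IntI empty_iff)
      then show False using x by (simp add: frontier_def)
    qed
  qed
qed

lemma step_combine:
  assumes "step Z f" "step Z' g"
  shows "step (Z \<union> Z') (\<lambda>x. h (f x) (g x))"
  using assms unfolding step_def by (auto simp: Int_Un_distrib2)

section \<open>Grids of known points and rounding to them\<close>

definition grid :: "real set \<Rightarrow> bool" where
  "grid D \<longleftrightarrow> finite D \<and> 0 \<in> D \<and> 1 \<in> D \<and> D \<subseteq> {0..1}"

definition grid_below :: "real set \<Rightarrow> real \<Rightarrow> real" where
  "grid_below D x = Max {d \<in> D. d \<le> x}"

definition grid_above :: "real set \<Rightarrow> real \<Rightarrow> real" where
  "grid_above D x = Min {d \<in> D. x \<le> d}"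

definition grid_next :: "real set \<Rightarrow> real \<Rightarrow> real" where
  "grid_next D x = Min {d \<in> D. x < d}"

lemma grid_below:
  assumes "grid D" "0 \<le> x"
  shows "grid_below D x \<in> D" "grid_below D x \<le> x" "\<And>d. d \<in> D \<Longrightarrow> d \<le> x \<Longrightarrow> d \<le> grid_below D x"
proof -
  have "finite {d \<in> D. d \<le> x}" "{d \<in> D. d \<le> x} \<noteq> {}"
    using assms by (auto simp: grid_def)
  then show "grid_below D x \<in> D" "grid_below D x \<le> x" "\<And>d. d \<in> D \<Longrightarrow> d \<le> x \<Longrightarrow> d \<le> grid_below D x"
    using Max_in[of "{d \<in> D. d \<le> x}"] Max_ge[of "{d \<in> D. d \<le> x}"] unfolding grid_below_def by auto
qed

lemma grid_above:
  assumes "grid D" "x \<le> 1"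
  shows "grid_above D x \<in> D" "x \<le> grid_above D x" "\<And>d. d \<in> D \<Longrightarrow> x \<le> d \<Longrightarrow> grid_above D x \<le> d"
proof -
  have "finite {d \<in> D. x \<le> d}" "{d \<in> D. x \<le> d} \<noteq> {}"
    using assms by (auto simp: grid_def)
  then show "grid_above D x \<in> D" "x \<le> grid_above D x" "\<And>d. d \<in> D \<Longrightarrow> x \<le> d \<Longrightarrow> grid_above D x \<le> d"
    using Min_in[of "{d \<in> D. x \<le> d}"] Min_le[of "{d \<in> D. x \<le> d}"] unfolding grid_above_def by auto
qed

lemma grid_next:
  assumes "grid D" "x < 1"
  shows "grid_next D x \<in> D" "x < grid_next D x" "\<And>d. d \<in> D \<Longrightarrow> x < d \<Longrightarrow> grid_next D x \<le> d"
proof -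
  have "finite {d \<in> D. x < d}" "{d \<in> D. x < d} \<noteq> {}"
    using assms by (auto simp: grid_def)
  then show "grid_next D x \<in> D" "x < grid_next D x" "\<And>d. d \<in> D \<Longrightarrow> x < d \<Longrightarrow> grid_next D x \<le> d"
    using Min_in[of "{d \<in> D. x < d}"] Min_le[of "{d \<in> D. x < d}"] unfolding grid_next_def by auto
qed

lemma grid_bounds: "grid D \<Longrightarrow> d \<in> D \<Longrightarrow> 0 \<le> d \<and> d \<le> 1"
  by (auto simp: grid_def)

lemma step_grid: "step Z col \<Longrightarrow> grid D \<Longrightarrow> Z \<inter> {0..1} \<subseteq> D \<Longrightarrow> step D col"
  unfolding step_def grid_def by (smt (verit) IntI Int_iff atLeastAtMost_iff disjoint_iff greaterThanAtMost_iff subset_iff)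

lemma grid_cell_unique:
  assumes "grid D" "d \<in> D" "e \<in> D" "d < 1" "e < 1" "x \<in> {d..<grid_next D d}" "x \<in> {e..<grid_next D e}"
  shows "d = e"
  using assms grid_next(3)[OF assms(1,4), of e] grid_next(3)[OF assms(1,5), of d]
  by (cases d e rule: linorder_cases) auto

lemma grid_below_less_next:
  assumes "grid D" "0 \<le> x" "x < 1"
  shows "grid_below D x < 1" "x < grid_next D (grid_below D x)"
proof -
  show *: "grid_below D x < 1" using grid_below[OF assms(1,2)] assms by auto
  show "x < grid_next D (grid_below D x)"
    using grid_below(3)[OF assms(1,2), of "grid_next D (grid_below D x)"] grid_next[OF assms(1) *] by force
qed

lemma step_grid_below:
  assumes "grid D" "step D col" "x \<in> {0..1}"
  shows "col (grid_below D x) = col x"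
proof -
  have "D \<inter> {grid_below D x<..x} = {}" using grid_below[OF assms(1), of x] assms by force
  then show ?thesis
    using assms grid_below[OF assms(1), of x] grid_bounds[OF assms(1)] by (auto simp: step_def)
qed

context valued_cake begin

lemma measure_insert_le:
  assumes "S \<subseteq> insert x U" "U \<in> sets lebesgue"
  shows "cake_value d S \<le> cake_value d U"
proof -
  have U: "U \<union> {x} \<in> sets lebesgue" using assms(2) by (intro sets.Un) auto
  then have "cake_value d S \<le> cake_value d (U \<union> {x})"
    using assms(1) by (intro finite_measure_mono) auto
  also have "\<dots> \<le> cake_value d U + cake_value d {x}"
    using assms(2) by (intro measure_Un_le) auto
  finally show ?thesis by (simp add: null_singleton)
qed

text \<open>The cells from \<open>e\<close> to \<open>grid_next D e\<close> are monochromatic and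
  cover everything except the worthless point 1.\<close>

lemma grid_class_measure:
  assumes D: "grid D" and col: "step D col"
  shows "cake_value d {x \<in> {0..1}. P (col x)}
    = (\<Sum>e | e \<in> D \<and> e < 1 \<and> P (col e). cdf (grid_next D e) - cdf e)"
proof -
  let ?S = "{x \<in> {0..1}. P (col x)}" and ?E = "{e. e \<in> D \<and> e < 1 \<and> P (col e)}"
  let ?U = "\<Union>e\<in>?E. {e..<grid_next D e}"
  have finE: "finite ?E" using D by (auto simp: grid_def)
  have U_sub: "?U \<subseteq> ?S"
  proof clarify
    fix x e assume e: "e \<in> D" "e < 1" "P (col e)" "x \<in> {e..<grid_next D e}"
    have "grid_next D e \<in> D" using grid_next[OF D e(2)] by simp
    then have x: "x \<in> {0..1}" using e grid_bounds[OF D e(1)] grid_bounds[OF D, of "grid_next D e"] by auto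
    have "D \<inter> {e<..x} = {}" using grid_next(3)[OF D e(2)] e(4) by fastforce
    then have "col e = col x" using col x e grid_bounds[OF D e(1)] by (auto simp: step_def)
    then show "x \<in> {0..1} \<and> P (col x)" using x e by simp
  qed
  have S_sub: "?S \<subseteq> insert 1 ?U"
  proof
    fix x assume x: "x \<in> ?S"
    show "x \<in> insert 1 ?U"
    proof (cases "x = 1")
      case False
      then have "0 \<le> x" "x < 1" using x by auto
      then show ?thesis
        using grid_below[OF D \<open>0 \<le> x\<close>] grid_below_less_next[OF D \<open>0 \<le> x\<close> \<open>x < 1\<close>] x
          step_grid_below[OF D col, of x] by (auto intro!: bexI[of _ "grid_below D x"])
    qed simp
  qed
  have U_sets: "?U \<in> sets lebesgue" using finE by (intro sets.finite_UN) auto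
  have S_sets: "?S \<in> sets lebesgue" using step_class_borel[OF col, of P] by simp
  have "cake_value d ?S = cake_value d ?U"
    using measure_insert_le[OF S_sub U_sets] finite_measure_mono[OF U_sub] S_sets by simp
  also have "\<dots> = (\<Sum>e\<in>?E. cake_value d {e..<grid_next D e})"
  proof (rule finite_measure_finite_Union[OF finE])
    show "disjoint_family_on (\<lambda>e. {e..<grid_next D e}) ?E"
      unfolding disjoint_family_on_def using grid_cell_unique[OF D] by blast
  qed auto
  also have "\<dots> = (\<Sum>e\<in>?E. cdf (grid_next D e) - cdf e)"
  proof (rule sum.cong[OF refl])
    fix e assume "e \<in> ?E"
    then show "cake_value d {e..<grid_next D e} = cdf (grid_next D e) - cdf e"
      using grid_next[OF D, of e] grid_bounds[OF D] by (intro measure_interval) auto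
  qed
  finally show ?thesis .
qed

text \<open>Rounding \<open>x\<close> down changes its colour only if a point of \<open>Z\<close>
  lies in between, and that point shares the cell of \<open>x\<close>. So each point of
  \<open>Z\<close> spoils at most one cell. The predicate \<open>R\<close> selects the region in
  which cells are known to be small.\<close>

lemma rounding_error:
  fixes \<delta> :: real
  assumes D: "grid D" and col: "step Z col" and R: "step D R"
    and \<delta>: "\<And>e. e \<in> D \<Longrightarrow> e < 1 \<Longrightarrow> R e \<Longrightarrow> cdf (grid_next D e) - cdf e \<le> \<delta>" and "0 \<le> \<delta>"
  shows "cake_value d {x \<in> {0..1}. R x \<and> col x \<noteq> col (grid_below D x)} \<le> real (card Z) * \<delta>"
proof -
  let ?b = "grid_below D"
  let ?I = "{z \<in> Z. 0 \<le> z \<and> z < 1 \<and> R (?b z)}"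
  let ?U = "\<Union>z\<in>?I. {?b z..<grid_next D (?b z)}"
  have finZ: "finite Z" using col by (simp add: step_def)
  then have fin: "finite ?I" by simp
  have "{x \<in> {0..1}. R x \<and> col x \<noteq> col (?b x)} \<subseteq> ?U"
  proof
    fix x assume x: "x \<in> {x \<in> {0..1}. R x \<and> col x \<noteq> col (?b x)}"
    then have x0: "0 \<le> x" "x \<le> 1" by auto
    note b = grid_below[OF D x0(1)]
    have "Z \<inter> {?b x<..x} \<noteq> {}"
      using x col b grid_bounds[OF D b(1)] unfolding step_def by fastforce
    then obtain z where z: "z \<in> Z" "?b x < z" "z \<le> x" by auto
    have "x \<noteq> 1" using b(3)[of 1] D z by (auto simp: grid_def)
    then have x1: "x < 1" using x0 by simp
    have z0: "0 \<le> z" using z(2) grid_bounds[OF D b(1)] by linarith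
    have "?b z = ?b x"
      using grid_below[OF D z0] b z by (intro antisym) auto
    moreover have "R (?b x)" using step_grid_below[OF D R] x by auto
    ultimately show "x \<in> ?U"
      using z x1 z0 b grid_below_less_next[OF D x0(1) x1] by (auto intro!: bexI[of _ z])
  qed
  then have "cake_value d {x \<in> {0..1}. R x \<and> col x \<noteq> col (?b x)} \<le> cake_value d ?U"
    using fin by (intro finite_measure_mono) auto
  also have "\<dots> \<le> (\<Sum>z\<in>?I. cake_value d {?b z..<grid_next D (?b z)})"
    using fin by (intro measure_UNION_le) auto
  also have "\<dots> \<le> (\<Sum>z\<in>?I. \<delta>)"
  proof (rule sum_mono)
    fix z assume z: "z \<in> ?I"
    then have b: "?b z \<in> D" "?b z < 1" using grid_below[OF D, of z] by auto
    then have "cake_value d {?b z..<grid_next D (?b z)} = cdf (grid_next D (?b z)) - cdf (?b z)"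
      using grid_next[OF D b(2)] grid_bounds[OF D] by (intro measure_interval) auto
    then show "cake_value d {?b z..<grid_next D (?b z)} \<le> \<delta>"
      using \<delta>[OF b] z by simp
  qed
  also have "\<dots> \<le> real (card Z) * \<delta>"
    using card_mono[OF finZ, of ?I] \<open>0 \<le> \<delta>\<close> by (auto intro!: mult_right_mono)
  finally show ?thesis .
qed

end

text \<open>A class is a sum of at most \<open>card D\<close> differences of \<open>cdf\<close>,
  each with two uncertain ends.\<close>

lemma class_measure_compare:
  fixes \<delta> :: real
  assumes "valued_cake d" "valued_cake d'" and D: "grid D" and col: "step D col" and "0 \<le> \<delta>"
    and \<delta>: "\<And>e. e \<in> D \<Longrightarrow> e < 1 \<Longrightarrow> P (col e) \<Longrightarrow>
        \<bar>valued_cake.cdf d e - valued_cake.cdf d' e\<bar> \<le> \<delta> \<and>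
        \<bar>valued_cake.cdf d (grid_next D e) - valued_cake.cdf d' (grid_next D e)\<bar> \<le> \<delta>"
  shows "\<bar>cake_value d {x \<in> {0..1}. P (col x)} - cake_value d' {x \<in> {0..1}. P (col x)}\<bar>
    \<le> 2 * \<delta> * real (card D)"
proof -
  interpret c: valued_cake d by fact
  interpret c': valued_cake d' by fact
  let ?E = "{e. e \<in> D \<and> e < 1 \<and> P (col e)}"
  have finD: "finite D" using D by (simp add: grid_def)
  have "\<bar>cake_value d {x \<in> {0..1}. P (col x)} - cake_value d' {x \<in> {0..1}. P (col x)}\<bar>
    = \<bar>\<Sum>e\<in>?E. (c.cdf (grid_next D e) - c.cdf e) - (c'.cdf (grid_next D e) - c'.cdf e)\<bar>"
    unfolding c.grid_class_measure[OF D col] c'.grid_class_measure[OF D col] sum_subtractf ..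
  also have "\<dots> \<le> (\<Sum>e\<in>?E. 2 * \<delta>)"
  proof (rule order.trans[OF sum_abs sum_mono])
    fix e assume "e \<in> ?E"
    then show "\<bar>c.cdf (grid_next D e) - c.cdf e - (c'.cdf (grid_next D e) - c'.cdf e)\<bar> \<le> 2 * \<delta>"
      using \<delta>[of e] by auto
  qed
  also have "\<dots> = 2 * \<delta> * real (card ?E)" by simp
  also have "\<dots> \<le> 2 * \<delta> * real (card D)"
    using card_mono[OF finD, of ?E] \<open>0 \<le> \<delta>\<close> by (intro mult_left_mono) auto
  finally show ?thesis .
qed

text \<open>The rounded colouring can change only at points \<open>grid_above D z\<close> with
  \<open>z\<close> in \<open>Z\<close>, so rounding does not increase the number of cuts.\<close>

lemma step_round:
  assumes D: "grid D" and col: "step Z col"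
  obtains Z' where "Z' \<subseteq> D" "card Z' \<le> card Z" "step Z' (\<lambda>x. col (grid_below D x))"
proof
  let ?Z = "grid_above D ` (Z \<inter> {0..1})"
  have finZ: "finite Z" using col by (simp add: step_def)
  show "?Z \<subseteq> D" using grid_above[OF D] by auto
  show "card ?Z \<le> card Z"
    using finZ by (meson Int_lower1 card_image_le card_mono finite_Int le_trans)
  show "step ?Z (\<lambda>x. col (grid_below D x))"
    unfolding step_def
  proof (intro conjI allI impI)
    show "finite ?Z" using finZ by simp
    fix x y :: real assume xy: "0 \<le> x" "x \<le> y" "y \<le> 1" and Z: "?Z \<inter> {x<..y} = {}"
    note bx = grid_below[OF D xy(1)] and b_y = grid_below[OF D order.trans[OF xy(1,2)]]
    show "col (grid_below D x) = col (grid_below D y)"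
    proof (rule ccontr)
      assume ne: "col (grid_below D x) \<noteq> col (grid_below D y)"
      have le: "grid_below D x \<le> grid_below D y" using bx b_y xy by auto
      then have "Z \<inter> {grid_below D x<..grid_below D y} \<noteq> {}"
        using ne col grid_bounds[OF D bx(1)] grid_bounds[OF D b_y(1)] unfolding step_def by metis
      then obtain z where z: "z \<in> Z" "grid_below D x < z" "z \<le> grid_below D y" by auto
      then have z01: "z \<in> {0..1}" using grid_bounds[OF D bx(1)] grid_bounds[OF D b_y(1)] by auto
      then have a: "grid_above D z \<in> D" "z \<le> grid_above D z" "grid_above D z \<le> grid_below D y"
        using grid_above[OF D, of z] b_y(1) z by auto
      then have "x < grid_above D z" using bx(3)[OF a(1)] z by force
      then have "grid_above D z \<in> ?Z \<inter> {x<..y}" using a z z01 b_y by auto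
      then show False using Z by blast
    qed
  qed
qed

section \<open>Approximate splittings with few cuts\<close>

text \<open>By uniform continuity of the \<open>cdf\<close> functions the cake falls into
  \<open>N\<close> cells of equal length that are worth little to everyone;
  \<open>discrete_halving\<close> is applied to their intersections with \<open>X\<close>.\<close>

lemma approximate_halving:
  assumes v: "\<And>i. i \<in> {1..n} \<Longrightarrow> valued_cake (v i)" and X: "X \<in> sets borel" and "0 < \<eta>"
  obtains Z and \<tau> :: "real \<Rightarrow> bool" where "step Z \<tau>" "card Z \<le> n"
    "\<And>i. i \<in> {1..n} \<Longrightarrow> \<bar>cake_value ((v i)) (X \<inter> {x \<in> {0..1}. \<tau> x})
        - cake_value ((v i)) (X \<inter> {x \<in> {0..1}. \<not> \<tau> x})\<bar> \<le> \<eta>"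
proof -
  \<comment> \<open>Chosen for \<open>2 * real n * \<delta> \<le> \<eta>\<close>; the summand 1
    covers \<open>n = 0\<close>.\<close>
  define \<delta> where "\<delta> = \<eta> / (2 * real n + 1)"
  have \<delta>: "\<delta> > 0" "2 * real n * \<delta> \<le> \<eta>"
    using \<open>0 < \<eta>\<close> by (auto simp: \<delta>_def field_simps)
  have "\<exists>e>0. \<forall>x\<in>{0..1}. \<forall>y\<in>{0..1}. dist x y < e \<longrightarrow>
      dist (valued_cake.cdf (v i) x) (valued_cake.cdf (v i) y) < \<delta>" if "i \<in> {1..n}" for i
    using compact_uniformly_continuous[OF valued_cake.continuous_cdf[OF v[OF that]] compact_Icc] \<delta>(1)
    unfolding uniformly_continuous_on_def by (metis dist_commute)
  then obtain e where e: "\<And>i. i \<in> {1..n} \<Longrightarrow> e i > 0"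
    "\<And>i x y. i \<in> {1..n} \<Longrightarrow> x \<in> {0..1} \<Longrightarrow> y \<in> {0..1} \<Longrightarrow> dist x y < e i \<Longrightarrow>
      dist (valued_cake.cdf (v i) x) (valued_cake.cdf (v i) y) < \<delta>"
    by metis
  define E where "E = Min (insert 1 (e ` {1..n}))"
  have E: "E > 0" "\<And>i. i \<in> {1..n} \<Longrightarrow> E \<le> e i"
  proof -
    show "E > 0" using e(1) unfolding E_def by (subst Min_gr_iff) auto
    show "E \<le> e i" if "i \<in> {1..n}" for i
      using that unfolding E_def by (intro Min_le) auto
  qed
  obtain N where N: "N > 0" "1 / real N < E"
    using E(1) by (metis nat_approx_posE zero_less_Suc)
  define C where "C j = {real j / N ..< real (Suc j) / N}" for j
  define w where "w i j = cake_value ((v (Suc i))) (X \<inter> C j)" for i j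
  have w\<delta>: "w i j \<le> \<delta>" if ij: "i < n" "j < N" for i j
  proof -
    interpret valued_cake "v (Suc i)" using v ij by auto
    have b: "0 \<le> real j / N" "real (Suc j) / N \<le> 1" "real j / N \<le> real (Suc j) / N"
      using ij N by (auto simp: field_simps)
    have "w i j \<le> cake_value ((v (Suc i))) (C j)"
      unfolding w_def C_def by (intro finite_measure_mono) auto
    also have "\<dots> = cdf (real (Suc j) / N) - cdf (real j / N)"
      unfolding C_def using b by (intro measure_interval) auto
    also have "\<dots> \<le> \<delta>"
    proof -
      have "dist (real (Suc j) / N) (real j / N) < e (Suc i)"
        using N E(2)[of "Suc i"] ij by (auto simp: dist_real_def diff_divide_distrib[symmetric])
      then show ?thesis
        using e(2)[of "Suc i" "real (Suc j) / N" "real j / N"] b ij by (auto simp: dist_real_def)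
    qed
    finally show ?thesis .
  qed
  obtain \<tau>' :: "nat \<Rightarrow> bool" where \<tau>': "card {j. Suc j < N \<and> \<tau>' (Suc j) \<noteq> \<tau>' j} \<le> n"
    "\<And>i. i < n \<Longrightarrow> \<bar>sum (w i) {j. j < N \<and> \<tau>' j} - sum (w i) {j. j < N \<and> \<not> \<tau>' j}\<bar> \<le> 2 * real n * \<delta>"
    using discrete_halving[of n N w \<delta>] w\<delta> \<delta>(1) by (auto simp: w_def less_imp_le)
  \<comment> \<open>The minimum puts the point 1, which lies in none of the half-open cells, into
    the last one.\<close>
  define ind where "ind x = min (N - 1) (nat \<lfloor>x * N\<rfloor>)" for x :: real
  define \<tau> where "\<tau> x = \<tau>' (ind x)" for x
  define Z where "Z = (\<lambda>j. real (Suc j) / N) ` {j. Suc j < N \<and> \<tau>' (Suc j) \<noteq> \<tau>' j}"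
  have fin: "finite {j. Suc j < N \<and> \<tau>' (Suc j) \<noteq> \<tau>' j}"
    by (rule finite_subset[of _ "{..<N}"]) auto
  have ind_C: "ind x = j" if "x \<in> C j" "j < N" for x j
  proof -
    have "real j \<le> x * N" "x * N < real j + 1" using that N by (auto simp: C_def field_simps)
    then have "\<lfloor>x * N\<rfloor> = int j" by (simp add: floor_eq_iff)
    then show ?thesis using that by (simp add: ind_def)
  qed
  have C_ex: "x \<in> C (ind x)" "ind x < N" if "0 \<le> x" "x < 1" for x
  proof -
    have "x * N < N" using that N by simp
    then have "nat \<lfloor>x * N\<rfloor> < N" using that by (simp add: nat_less_iff floor_less_iff)
    then have ind: "ind x = nat \<lfloor>x * N\<rfloor>" by (simp add: ind_def)
    show "ind x < N" using N by (simp add: ind_def)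
    have "real (ind x) = of_int \<lfloor>x * N\<rfloor>" using ind that by simp
    then show "x \<in> C (ind x)" unfolding C_def using N by (auto simp: field_simps) linarith+
  qed
  show ?thesis
  proof (rule that[of Z \<tau>])
    show "card Z \<le> n" unfolding Z_def using \<tau>'(1) card_image_le[OF fin] by (rule order.trans[rotated])
    show "step Z \<tau>"
      unfolding step_def
    proof (intro conjI allI impI)
      show "finite Z" unfolding Z_def using fin by simp
      fix x y :: real assume xy: "0 \<le> x" "x \<le> y" "y \<le> 1" and Zxy: "Z \<inter> {x<..y} = {}"
      have "ind x \<le> ind y" unfolding ind_def
        using xy by (intro min.mono nat_mono floor_mono mult_right_mono) auto
      moreover have "\<tau>' (ind x) = \<tau>' (ind x + t)" if "ind x + t \<le> ind y" for t
        using that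
      proof (induction t)
        case (Suc t)
        let ?j = "ind x + t"
        have jN: "Suc ?j < N" "Suc ?j \<le> nat \<lfloor>y * N\<rfloor>" using Suc.prems N by (auto simp: ind_def)
        have "real (Suc ?j) \<le> y * N" using jN(2) xy by (simp add: le_nat_iff le_floor_iff)
        then have "real (Suc ?j) / N \<le> y" using N by (simp add: field_simps)
        moreover have "x < real (Suc ?j) / N"
        proof -
          have "nat \<lfloor>x * N\<rfloor> < Suc ?j" using jN(1) by (simp add: ind_def min_def split: if_splits)
          then have "x * N < real (Suc ?j)" by linarith
          then show ?thesis using N by (simp add: field_simps)
        qed
        ultimately have "\<tau>' (Suc ?j) = \<tau>' ?j" using Zxy jN by (auto simp: Z_def)
        then show ?case using Suc by simp
      qed simp
      ultimately show "\<tau> x = \<tau> y" unfolding \<tau>_def by (metis le_add_diff_inverse order_refl)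
    qed
    fix i assume i: "i \<in> {1..n}"
    interpret valued_cake "v i" using v i by auto
    have meas: "cake_value ((v i)) (X \<inter> {x \<in> {0..1}. \<tau> x = b}) = sum (w (i - 1)) {j. j < N \<and> \<tau>' j = b}" for b
    proof -
      let ?J = "{j. j < N \<and> \<tau>' j = b}"
      let ?U = "\<Union>j\<in>?J. X \<inter> C j"
      have CX: "X \<inter> C j \<in> sets lebesgue" for j using X by (auto simp: C_def)
      have U: "?U \<in> sets lebesgue" using CX by (intro sets.finite_UN) auto
      have sub: "X \<inter> {x \<in> {0..1}. \<tau> x = b} \<subseteq> insert 1 ?U"
      proof
        fix x assume x: "x \<in> X \<inter> {x \<in> {0..1}. \<tau> x = b}"
        show "x \<in> insert 1 ?U"
          using x C_ex[of x] by (cases "x = 1") (auto simp: \<tau>_def)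
      qed
      have sup: "?U \<subseteq> X \<inter> {x \<in> {0..1}. \<tau> x = b}"
      proof
        fix x assume "x \<in> ?U"
        then obtain j where x: "x \<in> X" "x \<in> C j" "j < N" "b = \<tau>' j" by auto
        moreover have "0 \<le> x" "x < 1"
        proof -
          have "real j / N \<le> x" "x < real (Suc j) / N" using x by (auto simp: C_def)
          moreover have "0 \<le> real j / N" "real (Suc j) / N \<le> 1" using x N by auto
          ultimately show "0 \<le> x" "x < 1" by linarith+
        qed
        ultimately show "x \<in> X \<inter> {x \<in> {0..1}. \<tau> x = b}" using ind_C[of x j] by (auto simp: \<tau>_def)
      qed
      note measure_insert_le[OF sub U]
      moreover have "cake_value ((v i)) ?U \<le> cake_value ((v i)) (X \<inter> {x \<in> {0..1}. \<tau> x = b})"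
      proof (rule finite_measure_mono[OF sup])
        have "{x \<in> {0..1}. \<tau> x = b} \<in> sets borel"
          by (rule step_class_borel[OF \<open>step Z \<tau>\<close>])
        then show "X \<inter> {x \<in> {0..1}. \<tau> x = b} \<in> sets (value_measure (v i))"
          using X by simp
      qed
      ultimately have "cake_value ((v i)) (X \<inter> {x \<in> {0..1}. \<tau> x = b}) = cake_value ((v i)) ?U"
        by simp
      also have "\<dots> = (\<Sum>j\<in>?J. cake_value ((v i)) (X \<inter> C j))"
      proof (rule finite_measure_finite_Union)
        show "disjoint_family_on (\<lambda>j. X \<inter> C j) ?J"
          unfolding disjoint_family_on_def
        proof (intro ballI impI equals0I)
          fix j l x assume "j \<in> ?J" "l \<in> ?J" "j \<noteq> l" "x \<in> X \<inter> C j \<inter> (X \<inter> C l)"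
          then show False using ind_C[of x j] ind_C[of x l] by simp
        qed
      qed (use CX in auto)
      also have "\<dots> = sum (w (i - 1)) ?J" using i by (simp add: w_def)
      finally show ?thesis .
    qed
    show "\<bar>cake_value ((v i)) (X \<inter> {x \<in> {0..1}. \<tau> x})
        - cake_value ((v i)) (X \<inter> {x \<in> {0..1}. \<not> \<tau> x})\<bar> \<le> \<eta>"
      using meas[of True] meas[of False] \<tau>'(2)[of "i - 1"] \<delta>(2) i by fastforce
  qed
qed

text \<open>Every class is halved separately, with at most \<open>n\<close> new cuts each. The error
  does not accumulate: half of the inherited error plus half of the new imbalance is again at most
  \<open>\<eta>\<close>.\<close>

lemma approximate_dyadic_splitting:
  assumes v: "\<And>i. i \<in> {1..n} \<Longrightarrow> valued_cake (v i)" and X: "X \<in> sets borel" "X \<subseteq> {0..1}" and "0 < \<eta>"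
  shows "\<exists>Z (col :: real \<Rightarrow> nat). step Z col \<and> (\<forall>x. col x < 2 ^ a) \<and> card Z \<le> n * (2 ^ a - 1) \<and>
    (\<forall>i\<in>{1..n}. \<forall>b<2 ^ a. \<bar>cake_value ((v i)) (X \<inter> {x \<in> {0..1}. col x = b})
        - cake_value ((v i)) X / 2 ^ a\<bar> \<le> \<eta>)"
proof (induction a)
  case 0
  have "X \<inter> {x. 0 \<le> x \<and> x \<le> 1} = X" using X(2) by auto
  then show ?case
    using \<open>0 < \<eta>\<close> by (intro exI[of _ "{}"] exI[of _ "\<lambda>_. 0"]) (auto simp: step_def)
next
  case (Suc a)
  then obtain Z and col :: "real \<Rightarrow> nat" where col: "step Z col" "\<And>x. col x < 2 ^ a" "card Z \<le> n * (2 ^ a - 1)"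
    and val: "\<And>i b. i \<in> {1..n} \<Longrightarrow> b < 2 ^ a \<Longrightarrow>
      \<bar>cake_value ((v i)) (X \<inter> {x \<in> {0..1}. col x = b}) - cake_value ((v i)) X / 2 ^ a\<bar> \<le> \<eta>"
    by auto
  let ?X = "\<lambda>b. X \<inter> {x \<in> {0..1}. col x = b}"
  have Xb: "?X b \<in> sets borel" for b using X step_class_borel[OF col(1)] by auto
  define Q where "Q b p \<longleftrightarrow> step (fst p) (snd p) \<and> card (fst p) \<le> n \<and>
      (\<forall>i\<in>{1..n}. \<bar>cake_value ((v i)) (?X b \<inter> {x \<in> {0..1}. snd p x})
        - cake_value ((v i)) (?X b \<inter> {x \<in> {0..1}. \<not> snd p x})\<bar> \<le> \<eta>)"
    for b and p :: "real set \<times> (real \<Rightarrow> bool)"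
  have "\<exists>p. Q b p" for b
  proof -
    obtain Z \<tau> where "step Z \<tau>" "card Z \<le> n"
      "\<And>i. i \<in> {1..n} \<Longrightarrow> \<bar>cake_value ((v i)) (?X b \<inter> {x \<in> {0..1}. \<tau> x})
        - cake_value ((v i)) (?X b \<inter> {x \<in> {0..1}. \<not> \<tau> x})\<bar> \<le> \<eta>"
      by (rule approximate_halving[of n v "?X b" \<eta>]) (use v Xb \<open>0 < \<eta>\<close> in blast)+
    then have "Q b (Z, \<tau>)" by (simp add: Q_def)
    then show ?thesis ..
  qed
  then obtain p where p: "\<And>b. Q b (p b)" by metis
  define Y where "Y b = fst (p b)" for b
  define T where "T b = snd (p b)" for b
  have T: "\<And>b. step (Y b) (T b)" "\<And>b. card (Y b) \<le> n"
    "\<And>b i. i \<in> {1..n} \<Longrightarrow> \<bar>cake_value ((v i)) (?X b \<inter> {x \<in> {0..1}. T b x})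
        - cake_value ((v i)) (?X b \<inter> {x \<in> {0..1}. \<not> T b x})\<bar> \<le> \<eta>"
    using p unfolding Q_def Y_def T_def by blast+
  define col' where "col' x = 2 * col x + (if T (col x) x then 1 else 0)" for x
  define Z' where "Z' = Z \<union> (\<Union>b<2 ^ a. Y b)"
  have finY: "finite (Y b)" for b using T(1)[of b] by (simp add: step_def)
  have step': "step Z' col'"
    unfolding step_def
  proof (intro conjI allI impI)
    show "finite Z'" using col(1) finY by (auto simp: Z'_def step_def)
    fix x y :: real assume xy: "0 \<le> x" "x \<le> y" "y \<le> 1" and Z: "Z' \<inter> {x<..y} = {}"
    have eq: "col x = col y" using col(1) xy Z unfolding step_def Z'_def by blast
    moreover have "Y (col x) \<inter> {x<..y} = {}" using Z col(2)[of x] unfolding Z'_def by blast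
    then have "T (col x) x = T (col x) y" using T(1)[of "col x"] xy unfolding step_def by blast
    ultimately show "col' x = col' y" by (simp add: col'_def)
  qed
  have "card (\<Union>b<2 ^ a. Y b) \<le> (\<Sum>b<2 ^ a. card (Y b))"
    by (rule card_UN_le) simp
  also have "\<dots> \<le> (\<Sum>b<(2::nat) ^ a. n)" using T(2) by (intro sum_mono)
  finally have "card Z' \<le> n * (2 ^ a - 1) + 2 ^ a * n"
    unfolding Z'_def using col(3) card_Un_le[of Z "\<Union>b<2 ^ a. Y b"] by simp
  also have "\<dots> = n * (2 ^ Suc a - 1)"
    by (cases "(2::nat) ^ a") (auto simp: algebra_simps)
  finally have card': "card Z' \<le> n * (2 ^ Suc a - 1)" .
  have col'_less: "col' x < 2 ^ Suc a" for x
    using col(2)[of x] by (auto simp: col'_def)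
  have val': "\<bar>cake_value ((v i)) (X \<inter> {x \<in> {0..1}. col' x = b}) - cake_value ((v i)) X / 2 ^ Suc a\<bar> \<le> \<eta>"
    if i: "i \<in> {1..n}" and b: "b < 2 ^ Suc a" for i b
  proof -
    interpret valued_cake "v i" using v i by auto
    let ?m = "cake_value ((v i))" and ?h = "b div 2"
    have h: "?h < 2 ^ a" using b by auto
    have m: "?X ?h \<inter> {x \<in> {0..1}. T ?h x = t} \<in> sets lebesgue" for t
      using Xb step_class_borel[OF T(1)[of ?h], of "\<lambda>s. s = t"] by auto
    have "?X ?h = (?X ?h \<inter> {x \<in> {0..1}. T ?h x = True}) \<union> (?X ?h \<inter> {x \<in> {0..1}. T ?h x = False})" by auto
    then have "?m (?X ?h) = ?m ((?X ?h \<inter> {x \<in> {0..1}. T ?h x = True}) \<union> (?X ?h \<inter> {x \<in> {0..1}. T ?h x = False}))"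
      by simp
    also have "\<dots> = ?m (?X ?h \<inter> {x \<in> {0..1}. T ?h x = True}) + ?m (?X ?h \<inter> {x \<in> {0..1}. T ?h x = False})"
      using m[of True] m[of False] by (intro finite_measure_Union) auto
    finally have sum: "?m (?X ?h) = ?m (?X ?h \<inter> {x \<in> {0..1}. T ?h x}) + ?m (?X ?h \<inter> {x \<in> {0..1}. \<not> T ?h x})"
      by simp
    have "X \<inter> {x \<in> {0..1}. col' x = b} = ?X ?h \<inter> {x \<in> {0..1}. T ?h x = odd b}"
      by (auto simp: col'_def)
    then have "?m (X \<inter> {x \<in> {0..1}. col' x = b}) =
        (if odd b then ?m (?X ?h \<inter> {x \<in> {0..1}. T ?h x}) else ?m (?X ?h \<inter> {x \<in> {0..1}. \<not> T ?h x}))"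
      by simp
    moreover have "?m X / 2 ^ Suc a = (?m X / 2 ^ a) / 2" by simp
    ultimately show ?thesis
      using val[OF i h] T(3)[OF i, of ?h] sum by (simp split: if_splits) linarith+
  qed
  show ?case
    using step' card' col'_less val' by blast
qed


lemma abs_close: "\<bar>a - c\<bar> \<le> e \<Longrightarrow> \<bar>b - c\<bar> \<le> e \<Longrightarrow> 2 * e \<le> h \<Longrightarrow> \<bar>a - b\<bar> \<le> h"
  for a b c e h :: real
  by linarith

lemma abs_le_add: "\<bar>a - c\<bar> \<le> e \<Longrightarrow> a \<le> c + e"
  for a c e :: real
  by linarith

lemma approximate_splitting:
  assumes v: "\<And>i. i \<in> {1..n} \<Longrightarrow> valued_cake (v i)" and X: "X \<in> sets borel" "X \<subseteq> {0..1}"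
    and "0 < \<eta>" "1 \<le> k"
  obtains Z and col :: "real \<Rightarrow> nat" where "step Z col" "\<And>x. col x \<le> k" "card Z \<le> 8 * k * n"
    "\<And>i j j'. i \<in> {1..n} \<Longrightarrow> j \<in> {1..k} \<Longrightarrow> j' \<in> {1..k} \<Longrightarrow>
      \<bar>cake_value ((v i)) (X \<inter> {x \<in> {0..1}. col x = j})
        - cake_value ((v i)) (X \<inter> {x \<in> {0..1}. col x = j'})\<bar> \<le> \<eta>"
    "\<And>i. i \<in> {1..n} \<Longrightarrow> cake_value ((v i)) (X \<inter> {x \<in> {0..1}. col x = 0})
        \<le> cake_value ((v i)) X / 4 + \<eta>"
proof -
  obtain a where a: "4 * k \<le> 2 ^ a" "(2::nat) ^ a < 8 * k"
  proof -
    have ex: "\<exists>a. 4 * k \<le> 2 ^ a" by (meson less_exp less_imp_le)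
    let ?a = "LEAST a. 4 * k \<le> 2 ^ a"
    have 1: "4 * k \<le> 2 ^ ?a" using ex by (rule LeastI_ex)
    then obtain b where b: "?a = Suc b" using \<open>1 \<le> k\<close> by (cases ?a) auto
    then have "\<not> 4 * k \<le> 2 ^ b" using not_less_Least[of b "\<lambda>a. 4 * k \<le> 2 ^ a"] by simp
    then show ?thesis using that[OF 1] b by simp
  qed
  define K where "K = (2::nat) ^ a"
  define q where "q = K div k"
  \<comment> \<open>A part consists of \<open>q \<le> K\<close> classes, each off by at most
    \<open>\<eta>'\<close>, so two parts differ by at most
    \<open>2 * q * \<eta>' \<le> \<eta>\<close>.\<close>
  define \<eta>' where "\<eta>' = \<eta> / (2 * K)"
  have K: "K > 0" by (simp add: K_def)
  have "0 < \<eta>'" using \<open>0 < \<eta>\<close> K by (simp add: \<eta>'_def)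
  have "\<exists>Z (c :: real \<Rightarrow> nat). step Z c \<and> (\<forall>x. c x < 2 ^ a) \<and> card Z \<le> n * (2 ^ a - 1) \<and>
    (\<forall>i\<in>{1..n}. \<forall>b<2 ^ a. \<bar>cake_value ((v i)) (X \<inter> {x \<in> {0..1}. c x = b})
        - cake_value ((v i)) X / 2 ^ a\<bar> \<le> \<eta>')"
    by (rule approximate_dyadic_splitting) (use v X \<open>0 < \<eta>'\<close> in blast)+
  moreover have "real K = 2 ^ a" by (simp add: K_def)
  ultimately obtain Z and c :: "real \<Rightarrow> nat" where c: "step Z c" "\<And>x. c x < K" "card Z \<le> n * (K - 1)"
    and val: "\<And>i b. i \<in> {1..n} \<Longrightarrow> b < K \<Longrightarrow>
      \<bar>cake_value ((v i)) (X \<inter> {x \<in> {0..1}. c x = b}) - cake_value ((v i)) X / K\<bar> \<le> \<eta>'"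
    unfolding K_def by auto
  \<comment> \<open>Blocks of \<open>q\<close> consecutive classes form the parts. The remaining
    classes, fewer than \<open>k \<le> K / 4\<close> of them, get colour 0.\<close>
  define col where "col x = (if c x < q * k then c x div q + 1 else 0)" for x
  have q: "q * k \<le> K" "K < q * k + k"
    using \<open>1 \<le> k\<close> dividend_less_times_div[of k K] unfolding q_def by (auto simp: mult.commute add.commute)
  have q0: "q > 0" using a \<open>1 \<le> k\<close> unfolding q_def K_def by (intro div_greater_zero_iff[THEN iffD2]) auto
  have step': "step Z col"
    using c(1) unfolding step_def col_def by metis
  have classes: "\<bar>cake_value ((v i)) (X \<inter> {x \<in> {0..1}. c x \<in> B})
      - card B * (cake_value ((v i)) X / K)\<bar> \<le> card B * \<eta>'"
    if i: "i \<in> {1..n}" and B: "B \<subseteq> {..<K}" for i B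
  proof -
    interpret valued_cake "v i" using v i by auto
    have finB: "finite B" using B finite_subset by blast
    have "X \<inter> {x \<in> {0..1}. c x \<in> B} = (\<Union>b\<in>B. X \<inter> {x \<in> {0..1}. c x = b})" by auto
    moreover have "cake_value ((v i)) (\<Union>b\<in>B. X \<inter> {x \<in> {0..1}. c x = b}) =
        (\<Sum>b\<in>B. cake_value ((v i)) (X \<inter> {x \<in> {0..1}. c x = b}))"
      using X step_class_borel[OF c(1)]
      by (intro finite_measure_finite_Union[OF finB]) (auto simp: disjoint_family_on_def)
    ultimately have "cake_value ((v i)) (X \<inter> {x \<in> {0..1}. c x \<in> B})
        - card B * (cake_value ((v i)) X / K) =
        (\<Sum>b\<in>B. cake_value ((v i)) (X \<inter> {x \<in> {0..1}. c x = b}) - cake_value ((v i)) X / K)"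
      by (simp add: sum_subtractf)
    also have "\<bar>\<dots>\<bar> \<le> (\<Sum>b\<in>B. \<eta>')"
      using val[OF i] B by (intro order.trans[OF sum_abs sum_mono]) auto
    finally show ?thesis by simp
  qed
  show ?thesis
  proof (rule that[of Z col])
    show "col x \<le> k" for x
    proof (cases "c x < q * k")
      case True
      then have "c x div q < k" using q0 by (simp add: less_mult_imp_div_less mult.commute)
      then show ?thesis by (simp add: col_def)
    qed (simp add: col_def)
    have "n * (K - 1) \<le> n * (8 * k)" using a(2) unfolding K_def by (intro mult_le_mono2) linarith
    then have "card Z \<le> n * (8 * k)" using c(3) by (rule order.trans[rotated])
    then show "card Z \<le> 8 * k * n" by (simp only: mult_ac)
    fix i assume i: "i \<in> {1..n}"
    let ?m = "cake_value ((v i))"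
    have part: "\<bar>?m (X \<inter> {x \<in> {0..1}. col x = j}) - q * (?m X / K)\<bar> \<le> q * \<eta>'" if j: "j \<in> {1..k}" for j
    proof -
      have "c x < q * k \<and> c x div q + 1 = j \<longleftrightarrow> c x \<in> {q * (j - 1)..<q * j}" for x
      proof
        assume x: "c x < q * k \<and> c x div q + 1 = j"
        then have "q * (j - 1) \<le> c x" "c x < q * Suc (j - 1)"
          using q0 dividend_less_times_div[of q "c x"] times_div_less_eq_dividend[of q "c x"] by auto
        moreover have "Suc (j - 1) = j" using j by simp
        ultimately show "c x \<in> {q * (j - 1)..<q * j}" by (metis atLeastLessThan_iff)
      next
        assume x: "c x \<in> {q * (j - 1)..<q * j}"
        then have "c x div q = j - 1"
          using j by (intro div_nat_eqI) (auto simp: mult.commute)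
        moreover have "q * j \<le> q * k" using j by simp
        ultimately show "c x < q * k \<and> c x div q + 1 = j" using x j by (auto intro: less_le_trans)
      qed
      then have "X \<inter> {x \<in> {0..1}. col x = j} = X \<inter> {x \<in> {0..1}. c x \<in> {q * (j - 1)..<q * j}}"
        using j unfolding col_def by auto
      moreover have "{q * (j - 1)..<q * j} \<subseteq> {..<K}"
        using j q(1) by (auto intro: less_le_trans[OF _ order.trans[OF mult_le_mono2 q(1)]])
      moreover have "card {q * (j - 1)..<q * j} = q" using j by (simp add: diff_mult_distrib2)
      ultimately show ?thesis using classes[OF i, of "{q * (j - 1)..<q * j}"] by simp
    qed
    have "2 * (q * \<eta>') \<le> \<eta>"
    proof -
      have "q \<le> K" using q(1) \<open>1 \<le> k\<close> by (metis le_trans mult.right_neutral mult_le_mono2)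
      then have "2 * (q * \<eta>') \<le> 2 * (K * \<eta>')" using \<open>0 < \<eta>'\<close> by simp
      then show ?thesis using K by (simp add: \<eta>'_def)
    qed
    then show "\<bar>?m (X \<inter> {x \<in> {0..1}. col x = j}) - ?m (X \<inter> {x \<in> {0..1}. col x = j'})\<bar> \<le> \<eta>"
      if "j \<in> {1..k}" "j' \<in> {1..k}" for j j'
      using abs_close[OF part[OF that(1)] part[OF that(2)]] by simp
    let ?B = "{q * k..<K}"
    have B: "?B \<subseteq> {..<K}" by auto
    have eq: "X \<inter> {x \<in> {0..1}. col x = 0} = X \<inter> {x \<in> {0..1}. c x \<in> ?B}"
      using c(2) unfolding col_def by auto
    have "?m (X \<inter> {x \<in> {0..1}. col x = 0}) \<le> card ?B * (?m X / K) + card ?B * \<eta>'"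
      unfolding eq by (rule abs_le_add[OF classes[OF i B]])
    also have "card ?B * (?m X / K) \<le> ?m X / 4"
    proof -
      have "4 * card ?B \<le> K" using q a unfolding K_def by simp
      then have "real (4 * card ?B) \<le> real K" by (rule of_nat_mono)
      then have "4 * real (card ?B) * ?m X \<le> K * ?m X" by (intro mult_right_mono) auto
      then show ?thesis using K by (simp add: field_simps)
    qed
    also have "card ?B * \<eta>' \<le> K * \<eta>'" using \<open>0 < \<eta>'\<close> by (intro mult_right_mono) auto
    also have "K * \<eta>' \<le> \<eta>" using K \<open>0 < \<eta>\<close> by (simp add: \<eta>'_def)
    finally show "?m (X \<inter> {x \<in> {0..1}. col x = 0}) \<le> ?m X / 4 + \<eta>" by simp
  qed (rule step')
qed

section \<open>Measure splitting by successive refinement\<close>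

abbreviation cdf_of :: "world \<Rightarrow> nat \<Rightarrow> real \<Rightarrow> real" where
  "cdf_of w i \<equiv> valued_cake.cdf (fst w i)"

abbreviation value_of :: "world \<Rightarrow> nat \<Rightarrow> real set \<Rightarrow> real" where
  "value_of w i \<equiv> cake_value ((fst w i))"

section \<open>Cuts at the multiples of a precision\<close>

lemma multiple_below:
  fixes g \<delta> :: real
  assumes "0 < \<delta>" "0 < g"
  obtains l :: nat where "g - \<delta> \<le> real l * \<delta>" "real l * \<delta> < g"
proof -
  define z where "z = \<lceil>g / \<delta>\<rceil> - 1"
  have "0 < g / \<delta>" using assms by simp
  then have z0: "0 \<le> z" by (simp add: z_def)
  have "of_int z < g / \<delta>" "g / \<delta> \<le> of_int z + 1" unfolding z_def by linarith+
  then have "of_int z * \<delta> < g" "g - \<delta> \<le> of_int z * \<delta>"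
    using assms by (auto simp: field_simps)
  then show ?thesis using that[of "nat z"] z0 by (simp add: of_nat_nat)
qed

lemma multiple_between:
  fixes g h \<delta> :: real
  assumes "0 < \<delta>" "0 \<le> g" "g + \<delta> < h"
  obtains l :: nat where "g < real l * \<delta>" "real l * \<delta> < h"
proof -
  obtain l :: nat where "h - \<delta> \<le> real l * \<delta>" "real l * \<delta> < h" using multiple_below[of \<delta> h] assms by force
  then show ?thesis using that[of l] assms by simp
qed

lemma card_multiples:
  fixes a b \<delta> :: real
  assumes "0 < \<delta>" "a \<le> b"
  shows "finite {l :: nat. a \<le> real l * \<delta> \<and> real l * \<delta> \<le> b}"
    "card {l :: nat. a \<le> real l * \<delta> \<and> real l * \<delta> \<le> b} \<le> (b - a) / \<delta> + 1"
proof -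
  let ?L = "{l :: nat. a \<le> real l * \<delta> \<and> real l * \<delta> \<le> b}" and ?I = "{\<lceil>a / \<delta>\<rceil>..\<lfloor>b / \<delta>\<rfloor>}"
  have sub: "int ` ?L \<subseteq> ?I"
    using assms by (auto simp: ceiling_le_iff le_floor_iff field_simps)
  then have "finite (int ` ?L)" by (rule finite_subset) simp
  then show "finite ?L" by (rule finite_imageD) simp
  have "card ?L = card (int ` ?L)" by (simp add: card_image)
  also have "\<dots> \<le> card ?I" using sub by (intro card_mono) auto
  also have "\<dots> = nat (\<lfloor>b / \<delta>\<rfloor> - \<lceil>a / \<delta>\<rceil> + 1)" by simp
  finally have "card ?L \<le> nat (\<lfloor>b / \<delta>\<rfloor> - \<lceil>a / \<delta>\<rceil> + 1)" .
  moreover have "a / \<delta> \<le> b / \<delta>" using assms by (simp add: divide_right_mono)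
  then have "of_int (\<lfloor>b / \<delta>\<rfloor> - \<lceil>a / \<delta>\<rceil> + 1) \<le> b / \<delta> - a / \<delta> + 1" "0 \<le> b / \<delta> - a / \<delta> + 1"
    by linarith+
  then have "real (nat (\<lfloor>b / \<delta>\<rfloor> - \<lceil>a / \<delta>\<rceil> + 1)) \<le> b / \<delta> - a / \<delta> + 1"
    by (cases "0 \<le> \<lfloor>b / \<delta>\<rfloor> - \<lceil>a / \<delta>\<rceil> + 1") (auto simp: of_nat_nat)
  ultimately show "card ?L \<le> (b - a) / \<delta> + 1"
    by (simp add: diff_divide_distrib)
qed

text \<open>The multiple of \<open>\<delta>\<close> just below the value of the part left of
  \<open>y\<close> has the same cut point in both worlds. By strictness this point lies left of
  \<open>y\<close>, so in \<open>w'\<close> too that part is worth at least this multiple. The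
  converse estimate comes from exchanging the worlds.\<close>

lemma agreeing_worlds_close:
  assumes w: "w \<in> worlds n" "w' \<in> worlds n" and i: "i \<in> {1..n}" and y: "y \<in> {0..1}" and "0 < \<delta>"
    and agree: "\<And>l :: nat. real l * \<delta> \<in> {0..1} \<Longrightarrow> cdf_of w i y - \<delta> \<le> real l * \<delta> \<Longrightarrow>
      real l * \<delta> < cdf_of w i y \<Longrightarrow> snd w i (real l * \<delta>) = snd w' i (real l * \<delta>)"
  shows "cdf_of w i y - \<delta> \<le> cdf_of w' i y"
proof -
  interpret c: valued_cake "fst w i" using worlds_valued_cake w i by simp
  interpret c': valued_cake "fst w' i" using worlds_valued_cake w i by simp
  show ?thesis
  proof (cases "0 < c.cdf y")
    case True
    obtain l :: nat where l: "c.cdf y - \<delta> \<le> real l * \<delta>" "real l * \<delta> < c.cdf y"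
      using multiple_below[OF \<open>0 < \<delta>\<close> True] by blast
    then have \<alpha>: "real l * \<delta> \<in> {0..1}" using c.cdf_bounds(2)[of y] y \<open>0 < \<delta>\<close> by auto
    let ?c = "snd w i (real l * \<delta>)"
    have "c.cdf ?c < c.cdf y" using worlds_cut(2)[OF w(1) i \<alpha>] l by simp
    then have "?c < y" using c.cdf_less_imp worlds_cut(1)[OF w(1) i \<alpha>] by auto
    then have "c'.cdf ?c \<le> c'.cdf y" using c'.cdf_mono y by auto
    then show ?thesis using worlds_cut(2)[OF w(2) i \<alpha>] agree[OF \<alpha> l] l by simp
  next
    case False
    then show ?thesis using c'.cdf_bounds(1)[of y] y \<open>0 < \<delta>\<close> by auto
  qed
qed

text \<open>In a cell worth more than \<open>\<delta>\<close>, some multiple of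
  \<open>\<delta>\<close> lies strictly between the end values, and its cut point would be a grid
  point strictly inside the cell.\<close>

lemma cells_small:
  assumes w: "w \<in> worlds n" and i: "i \<in> {1..n}" and G: "grid G" "e \<in> G" "e < 1" and "0 < \<delta>"
    and Q: "\<And>l :: nat. cdf_of w i e < real l * \<delta> \<Longrightarrow> real l * \<delta> < cdf_of w i (grid_next G e) \<Longrightarrow> snd w i (real l * \<delta>) \<in> G"
  shows "cdf_of w i (grid_next G e) - cdf_of w i e \<le> \<delta>"
proof (rule ccontr)
  interpret c: valued_cake "fst w i" using worlds_valued_cake w i by simp
  note nx = grid_next[OF G(1,3)]
  have b: "0 \<le> e" "grid_next G e \<le> 1" using grid_bounds[OF G(1)] nx(1) G(2) by auto
  assume "\<not> ?thesis"
  then obtain l :: nat where l: "c.cdf e < real l * \<delta>" "real l * \<delta> < c.cdf (grid_next G e)"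
    using multiple_between[of \<delta> "c.cdf e" "c.cdf (grid_next G e)"] \<open>0 < \<delta>\<close> c.cdf_bounds(1)[of e] G(3) by auto
  have l01: "real l * \<delta> \<in> {0..1}" using l(2) c.cdf_bounds(2)[OF b(2)] \<open>0 < \<delta>\<close> by auto
  let ?c = "snd w i (real l * \<delta>)"
  have c: "?c \<in> {0..1}" "c.cdf ?c = real l * \<delta>" using worlds_cut[OF w i l01] by auto
  have "e < ?c" using c.cdf_less_imp[of e ?c] c l G(3) by auto
  moreover have "?c < grid_next G e" using c.cdf_less_imp[of ?c "grid_next G e"] c l by auto
  ultimately show False using nx(3)[OF Q[OF l]] by simp
qed

text \<open>The region coloured \<open>0\<close> is still to be divided among the colours \<open>1, ..., k\<close>: \<open>\<rho>\<close> bounds its value,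
  \<open>e\<close> the imbalance of the pieces so far, and \<open>2 * \<delta>\<close> the uncertainty about the players' cumulative
  values at the ends of its intervals.\<close>

definition splitting_state ::
    "nat \<Rightarrow> nat \<Rightarrow> real \<Rightarrow> real \<Rightarrow> real \<Rightarrow> world set \<Rightarrow> real set \<Rightarrow> (real \<Rightarrow> nat) \<Rightarrow> bool" where
  "splitting_state n k \<delta> \<rho> e S E col \<longleftrightarrow> grid E \<and> step E col \<and> (\<forall>x. col x \<le> k) \<and>
    (\<forall>w\<in>S. \<forall>w'\<in>S. \<forall>i\<in>{1..n}. \<forall>y\<in>E. y < 1 \<longrightarrow> col y = 0 \<longrightarrow>
       \<bar>cdf_of w i y - cdf_of w' i y\<bar> \<le> 2 * \<delta> \<and>
       \<bar>cdf_of w i (grid_next E y) - cdf_of w' i (grid_next E y)\<bar> \<le> 2 * \<delta>) \<and>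
    (\<forall>w\<in>S. \<forall>i\<in>{1..n}. value_of w i {x \<in> {0..1}. col x = 0} \<le> \<rho>) \<and>
    (\<forall>w\<in>S. \<forall>i\<in>{1..n}. \<forall>j\<in>{1..k}. \<forall>j'\<in>{1..k}.
       \<bar>value_of w i {x \<in> {0..1}. col x = j} - value_of w i {x \<in> {0..1}. col x = j'}\<bar> \<le> e)"

text \<open>The multiples of \<open>\<delta>\<close> in the value range of each undivided interval,
  computed in the reference world \<open>w\<close>. True end values may differ from it by
  \<open>2 * \<delta>\<close>; one more \<open>\<delta>\<close> on the left supplies the multiple
  just below an end that \<open>agreeing_worlds_close\<close> uses.\<close>

definition refine_queries :: "nat \<Rightarrow> real \<Rightarrow> world \<Rightarrow> real set \<Rightarrow> (real \<Rightarrow> nat) \<Rightarrow> (nat \<times> real) set" where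
  "refine_queries n \<delta> w E col = (\<Union>i\<in>{1..n}. \<Union>y\<in>{y \<in> E. y < 1 \<and> col y = 0}.
     (\<lambda>l :: nat. (i, real l * \<delta>)) ` {l. cdf_of w i y - 3 * \<delta> \<le> real l * \<delta> \<and>
        real l * \<delta> \<le> min 1 (cdf_of w i (grid_next E y) + 2 * \<delta>)})"

text \<open>For an interval of value \<open>g\<close> there are at most
  \<open>(g + 5 * \<delta>) / \<delta> + 1\<close> multiples, and the values of all undivided
  intervals sum to at most \<open>\<rho>\<close>.\<close>

lemma refine_queries:
  assumes st: "splitting_state n k \<delta> \<rho> e S E col" and S: "S \<subseteq> worlds n" and w: "w \<in> S" and "0 < \<delta>"
  shows "finite (refine_queries n \<delta> w E col)" "refine_queries n \<delta> w E col \<subseteq> {1..n} \<times> {0..1}"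
    "card (refine_queries n \<delta> w E col) \<le> n * (\<rho> / \<delta> + 6 * card E)"
proof -
  let ?E = "{y \<in> E. y < 1 \<and> col y = 0}"
  let ?L = "\<lambda>i y. {l :: nat. cdf_of w i y - 3 * \<delta> \<le> real l * \<delta> \<and> real l * \<delta> \<le> min 1 (cdf_of w i (grid_next E y) + 2 * \<delta>)}"
  have E: "grid E" "step E col" using st by (auto simp: splitting_state_def)
  have finE: "finite E" using E by (simp add: grid_def)
  have L: "finite (?L i y) \<and> card (?L i y) \<le> (cdf_of w i (grid_next E y) - cdf_of w i y) / \<delta> + 6"
    if i: "i \<in> {1..n}" and y: "y \<in> ?E" for i y
  proof -
    interpret valued_cake "fst w i" by (rule worlds_valued_cake[OF subsetD[OF S w] i])
    let ?b = "cdf (grid_next E y) + 2 * \<delta>"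
    have nx: "y < grid_next E y" "grid_next E y \<le> 1"
      using grid_next[OF E(1), of y] grid_bounds[OF E(1)] y by auto
    have le: "cdf y - 3 * \<delta> \<le> ?b" using cdf_mono[of y "grid_next E y"] nx \<open>0 < \<delta>\<close> by simp
    have sub: "?L i y \<subseteq> {l :: nat. cdf y - 3 * \<delta> \<le> real l * \<delta> \<and> real l * \<delta> \<le> ?b}" by auto
    note cm = card_multiples[OF \<open>0 < \<delta>\<close> le]
    have "(?b - (cdf y - 3 * \<delta>)) / \<delta> + 1 = (cdf (grid_next E y) - cdf y) / \<delta> + 6"
      using \<open>0 < \<delta>\<close> by (simp add: field_simps)
    then show ?thesis
      using finite_subset[OF sub cm(1)] card_mono[OF cm(1) sub] cm(2) by linarith
  qed
  show "finite (refine_queries n \<delta> w E col)"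
    unfolding refine_queries_def using finE L by (intro finite_UN_I finite_imageI) auto
  show "refine_queries n \<delta> w E col \<subseteq> {1..n} \<times> {0..1}"
    unfolding refine_queries_def using \<open>0 < \<delta>\<close> by auto
  have "real (card (refine_queries n \<delta> w E col)) \<le> (\<Sum>i\<in>{1..n}. \<Sum>y\<in>?E. real (card (?L i y)))"
  proof -
    have "card (refine_queries n \<delta> w E col) \<le> (\<Sum>i\<in>{1..n}. card (\<Union>y\<in>?E. (\<lambda>l :: nat. (i, real l * \<delta>)) ` ?L i y))"
      unfolding refine_queries_def by (rule card_UN_le) simp
    also have "\<dots> \<le> (\<Sum>i\<in>{1..n}. \<Sum>y\<in>?E. card ((\<lambda>l :: nat. (i, real l * \<delta>)) ` ?L i y))"
      using finE by (intro sum_mono card_UN_le) simp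
    also have "\<dots> \<le> (\<Sum>i\<in>{1..n}. \<Sum>y\<in>?E. card (?L i y))"
      using L by (intro sum_mono card_image_le) auto
    finally have "real (card (refine_queries n \<delta> w E col)) \<le> real (\<Sum>i\<in>{1..n}. \<Sum>y\<in>?E. card (?L i y))"
      by (rule of_nat_mono)
    then show ?thesis by simp
  qed
  also have "\<dots> \<le> (\<Sum>i\<in>{1..n}. \<rho> / \<delta> + 6 * card E)"
  proof (rule sum_mono)
    fix i assume i: "i \<in> {1..n}"
    interpret valued_cake "fst w i" by (rule worlds_valued_cake[OF subsetD[OF S w] i])
    have "(\<Sum>y\<in>?E. real (card (?L i y))) \<le> (\<Sum>y\<in>?E. (cdf (grid_next E y) - cdf y) / \<delta> + 6)"
      using L[OF i] by (intro sum_mono) auto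
    also have "\<dots> = (\<Sum>y\<in>?E. cdf (grid_next E y) - cdf y) / \<delta> + 6 * card ?E"
      by (simp add: sum.distrib sum_divide_distrib)
    also have "(\<Sum>y\<in>?E. cdf (grid_next E y) - cdf y) = value_of w i {x \<in> {0..1}. col x = 0}"
      using grid_class_measure[OF E, of "\<lambda>j. j = 0"] by simp
    also have "\<dots> \<le> \<rho>" using st w i by (auto simp: splitting_state_def)
    finally have "(\<Sum>y\<in>?E. real (card (?L i y))) \<le> \<rho> / \<delta> + 6 * card ?E"
      using \<open>0 < \<delta>\<close> by (simp add: divide_right_mono)
    moreover have "card ?E \<le> card E" using finE by (intro card_mono) auto
    ultimately show "(\<Sum>y\<in>?E. real (card (?L i y))) \<le> \<rho> / \<delta> + 6 * card E"
      by simp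
  qed
  finally show "card (refine_queries n \<delta> w E col) \<le> n * (\<rho> / \<delta> + 6 * card E)" by simp
qed

text \<open>The answers are represented by \<open>w1\<close>. The leftover is split for the
  densities of \<open>w1\<close>, the cuts are rounded to known points, and the outcome is
  transferred to the worlds agreeing with \<open>w1\<close>. A piece suffers
  \<open>m * \<delta>\<close> from rounding at most \<open>m\<close> cuts and
  \<open>2 * \<delta> * (card E + m)\<close> from the transfer; both count twice in an imbalance,
  and the splitting itself adds \<open>\<delta>\<close>.\<close>

lemma refine_step:
  fixes n k :: nat and \<delta> \<rho> e m :: real
  assumes st: "splitting_state n k \<delta> \<rho> e S E col" and S: "S \<subseteq> worlds n" and w0: "w0 \<in> S" and "0 < \<delta>"
    and "1 \<le> k" and w1: "w1 \<in> S"
  defines "Q \<equiv> refine_queries n \<delta> w0 E col"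
    and "m \<equiv> real (8 * k * n)"
  obtains E' col' where "E' \<subseteq> E \<union> (\<lambda>(i, \<alpha>). snd w1 i \<alpha>) ` Q" "card E' \<le> card E + 8 * k * n"
    "splitting_state n k (\<delta> / 2) (\<rho> / 4 + \<delta> * (1 + m + 2 * (card E + m)))
       (e + \<delta> * (1 + 2 * m + 4 * (card E + m)))
       {w \<in> S. \<forall>(i, \<alpha>)\<in>Q. snd w i \<alpha> = snd w1 i \<alpha>} E' col'"
proof -
  let ?S = "{w \<in> S. \<forall>(i, \<alpha>)\<in>Q. snd w i \<alpha> = snd w1 i \<alpha>}"
  have E: "grid E" "step E col" "\<And>x. col x \<le> k"
    and osc: "\<And>w w' i y. w \<in> S \<Longrightarrow> w' \<in> S \<Longrightarrow> i \<in> {1..n} \<Longrightarrow> y \<in> E \<Longrightarrow> y < 1 \<Longrightarrow> col y = 0 \<Longrightarrow>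
       \<bar>cdf_of w i y - cdf_of w' i y\<bar> \<le> 2 * \<delta> \<and>
       \<bar>cdf_of w i (grid_next E y) - cdf_of w' i (grid_next E y)\<bar> \<le> 2 * \<delta>"
    and \<rho>: "\<And>w i. w \<in> S \<Longrightarrow> i \<in> {1..n} \<Longrightarrow> value_of w i {x \<in> {0..1}. col x = 0} \<le> \<rho>"
    and e: "\<And>w i j j'. w \<in> S \<Longrightarrow> i \<in> {1..n} \<Longrightarrow> j \<in> {1..k} \<Longrightarrow> j' \<in> {1..k} \<Longrightarrow>
       \<bar>value_of w i {x \<in> {0..1}. col x = j} - value_of w i {x \<in> {0..1}. col x = j'}\<bar> \<le> e"
    using st unfolding splitting_state_def by blast+
  have finE: "finite E" using E(1) by (simp add: grid_def)
  note rq = refine_queries[OF st S w0 \<open>0 < \<delta>\<close>, folded Q_def]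
  have Q_mem: "(i, real l * \<delta>) \<in> Q"
    if i: "i \<in> {1..n}" and y: "y \<in> E" "y < 1" "col y = 0" and l: "real l * \<delta> \<le> 1"
      "cdf_of w i y - \<delta> \<le> real l * \<delta>" "real l * \<delta> \<le> cdf_of w i (grid_next E y)" and w: "w \<in> S" for i y and l :: nat and w
  proof -
    have "cdf_of w0 i y - 3 * \<delta> \<le> real l * \<delta>" "real l * \<delta> \<le> cdf_of w0 i (grid_next E y) + 2 * \<delta>"
      using osc[OF w w0 i y] l by linarith+
    then have "l \<in> {l. cdf_of w0 i y - 3 * \<delta> \<le> real l * \<delta> \<and> real l * \<delta> \<le> min 1 (cdf_of w0 i (grid_next E y) + 2 * \<delta>)}"
      using l(1) by simp
    then show ?thesis unfolding Q_def refine_queries_def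
      by (intro UN_I[OF i] UN_I[of y] image_eqI[OF refl]) (use y in simp)
  qed
  have vc: "valued_cake (fst w i)" if "w \<in> S" "i \<in> {1..n}" for w i
    by (rule worlds_valued_cake[OF subsetD[OF S that(1)] that(2)])
  \<comment> \<open>All points known by now. The new grid \<open>E'\<close> keeps only the cuts in
    use, because the cost and the error of the next round grow with its cardinality.\<close>
  define G where "G = E \<union> (\<lambda>(i, \<alpha>). snd w1 i \<alpha>) ` Q"
  have G: "grid G"
  proof -
    have "(\<lambda>(i, \<alpha>). snd w1 i \<alpha>) ` Q \<subseteq> {0..1}"
    proof clarify
      fix i \<alpha> assume "(i, \<alpha>) \<in> Q"
      then show "snd w1 i \<alpha> \<in> {0..1}"
        using rq(2) worlds_cut(1)[OF subsetD[OF S w1], of i \<alpha>] by auto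
    qed
    then show ?thesis using E(1) rq(1) unfolding grid_def G_def by auto
  qed
  have EG: "E \<subseteq> G" by (simp add: G_def)
  have run: "grid_below E y \<in> E" "grid_below E y < 1" "col (grid_below E y) = 0" "grid_below E y \<le> y"
      "y < grid_next E (grid_below E y)"
      "grid_next E (grid_below E y) \<le> 1"
    if "0 \<le> y" "y < 1" "col y = 0" for y
    using grid_below[OF E(1) that(1)] grid_below_less_next[OF E(1) that(1,2)] step_grid_below[OF E(1,2), of y] that
      grid_next[OF E(1)] grid_bounds[OF E(1)] by auto
  have cell: "cdf_of w1 i (grid_next G y) - cdf_of w1 i y \<le> \<delta>"
    if i: "i \<in> {1..n}" and y: "y \<in> G" "y < 1" "col y = 0" for i y
  proof (rule cells_small[OF _ i G y(1,2) \<open>0 < \<delta>\<close>])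
    show "w1 \<in> worlds n" using w1 S by auto
    then interpret valued_cake "fst w1 i" using worlds_valued_cake i by simp
    have y0: "0 \<le> y" using grid_bounds[OF G y(1)] by simp
    note r = run[OF y0 y(2,3)]
    have nx: "grid_next G y \<le> grid_next E (grid_below E y)"
      using grid_next(3)[OF G y(2)] grid_next(1)[OF E(1) r(2)] EG r(5) by auto
    fix l :: nat assume l: "cdf y < real l * \<delta>" "real l * \<delta> < cdf (grid_next G y)"
    have "cdf (grid_below E y) \<le> cdf y" using r y by (intro cdf_mono) auto
    moreover have "cdf (grid_next G y) \<le> cdf (grid_next E (grid_below E y))" using nx r by (intro cdf_mono) auto
    ultimately have "(i, real l * \<delta>) \<in> Q"
      using l r cdf_bounds(2)[of "grid_next G y"] nx \<open>0 < \<delta>\<close> by (intro Q_mem[OF i r(1-3) _ _ _ w1]) auto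
    then show "snd w1 i (real l * \<delta>) \<in> G" unfolding G_def by force
  qed
  have agree: "snd w i \<alpha> = snd w1 i \<alpha>" if "w \<in> ?S" "(i, \<alpha>) \<in> Q" for w i \<alpha>
    using that by blast
  \<comment> \<open>Inside the old leftover the new answers halve the uncertainty from
    \<open>2 * \<delta>\<close> to \<open>\<delta>\<close>, at every point and not only at cut
    points.\<close>
  have osc': "\<bar>cdf_of w i y - cdf_of w' i y\<bar> \<le> \<delta>"
    if w: "w \<in> ?S" "w' \<in> ?S" and i: "i \<in> {1..n}" and y: "a \<in> E" "a < 1" "col a = 0" "a \<le> y" "y \<le> grid_next E a"
    for w w' i y a
  proof -
    have "cdf_of w i y - \<delta> \<le> cdf_of w' i y" if w: "w \<in> ?S" "w' \<in> ?S" for w w'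
    proof -
      have wn: "w \<in> worlds n" "w' \<in> worlds n" using w S by auto
      interpret c: valued_cake "fst w i" using worlds_valued_cake wn i by simp
      have nx1: "grid_next E a \<le> 1" "0 \<le> a" using grid_next(1)[OF E(1) y(2)] grid_bounds[OF E(1)] y by auto
      then have y01: "y \<in> {0..1}" using y by auto
      show ?thesis
      proof (rule agreeing_worlds_close[OF wn i y01 \<open>0 < \<delta>\<close>])
        fix l :: nat assume l: "real l * \<delta> \<in> {0..1}" "c.cdf y - \<delta> \<le> real l * \<delta>" "real l * \<delta> < c.cdf y"
        have "(i, real l * \<delta>) \<in> Q"
        proof (rule Q_mem[OF i y(1-3)])
          show "w \<in> S" "real l * \<delta> \<le> 1" using w l(1) by auto
          show "c.cdf a - \<delta> \<le> real l * \<delta>" using l(2) c.cdf_mono[OF y(4)] y01 by auto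
          show "real l * \<delta> \<le> c.cdf (grid_next E a)" using l(3) c.cdf_mono[OF y(5) nx1(1)] by simp
        qed
        then show "snd w i (real l * \<delta>) = snd w' i (real l * \<delta>)"
          using agree[OF w(1)] agree[OF w(2)] by simp
      qed
    qed
    from this[OF w] this[OF w(2,1)] show ?thesis by linarith
  qed
  let ?X = "{x \<in> {0..1}. col x = 0}"
  have X: "?X \<in> sets borel" "?X \<subseteq> {0..1}" using step_class_borel[OF E(2), of "\<lambda>j. j = 0"] by auto
  have v1: "valued_cake (fst w1 i)" if "i \<in> {1..n}" for i by (rule vc[OF w1 that])
  obtain Z0 and c0 :: "real \<Rightarrow> nat" where c0: "step Z0 c0" "\<And>x. c0 x \<le> k" "card Z0 \<le> 8 * k * n"
    and c0_eq: "\<And>i j j'. i \<in> {1..n} \<Longrightarrow> j \<in> {1..k} \<Longrightarrow> j' \<in> {1..k} \<Longrightarrow>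
      \<bar>value_of w1 i (?X \<inter> {x \<in> {0..1}. c0 x = j}) - value_of w1 i (?X \<inter> {x \<in> {0..1}. c0 x = j'})\<bar> \<le> \<delta>"
    and c0_left: "\<And>i. i \<in> {1..n} \<Longrightarrow> value_of w1 i (?X \<inter> {x \<in> {0..1}. c0 x = 0}) \<le> value_of w1 i ?X / 4 + \<delta>"
    by (rule approximate_splitting[of n "fst w1" ?X \<delta> k]) (use v1 X \<open>0 < \<delta>\<close> \<open>1 \<le> k\<close> in blast)+
  define c1 where "c1 x = c0 (grid_below G x)" for x
  obtain Z' where Z': "Z' \<subseteq> G" "card Z' \<le> card Z0" "step Z' c1"
    using step_round[OF G c0(1)] unfolding c1_def by metis
  define col' where "col' x = (if col x = 0 then c1 x else col x)" for x
  define E' where "E' = E \<union> Z'"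
  have E': "grid E'" using E(1) Z'(1,3) G unfolding grid_def E'_def step_def by auto
  have EE': "E \<subseteq> E'" "E' \<subseteq> G" using Z' EG by (auto simp: E'_def)
  have card_E': "card E' \<le> card E + 8 * k * n"
    unfolding E'_def using card_Un_le[of E Z'] Z'(2) c0(3) by linarith
  have step_pair: "step E' (\<lambda>x. (col x, c1 x))"
    unfolding E'_def by (rule step_combine[OF E(2) Z'(3)])
  have step': "step E' col'"
    using step_pair unfolding step_def col'_def by (metis Pair_inject)
  let ?g = "\<lambda>j. {x \<in> {0..1}. (\<lambda>(a, b). a = 0 \<and> b = j) (col x, c1 x)}"
  have g_borel: "?g j \<in> sets lebesgue" for j
    using step_class_borel[OF step_pair, of "\<lambda>(a, b). a = 0 \<and> b = j"] by auto
  have g_round: "\<bar>value_of w1 i (?g j) - value_of w1 i (?X \<inter> {x \<in> {0..1}. c0 x = j})\<bar> \<le> m * \<delta>"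
    if i: "i \<in> {1..n}" for i j
  proof -
    interpret valued_cake "fst w1 i" using v1 i .
    let ?B = "{x \<in> {0..1}. col x = 0 \<and> c0 x \<noteq> c0 (grid_below G x)}"
    have "step G col" by (rule step_grid[OF E(2) G]) (use EG in auto)
    then have stepG: "step G (\<lambda>x. col x = 0)" unfolding step_def by metis
    have "value_of w1 i ?B \<le> real (card Z0) * \<delta>"
      by (rule rounding_error[OF G c0(1) stepG]) (use cell[OF i] \<open>0 < \<delta>\<close> in auto)
    also have "\<dots> \<le> m * \<delta>" using c0(3) \<open>0 < \<delta>\<close> unfolding m_def by (intro mult_right_mono of_nat_mono) auto
    finally have B: "value_of w1 i ?B \<le> m * \<delta>" .
    have c0_sets: "?X \<inter> {x \<in> {0..1}. c0 x = j} \<in> sets lebesgue"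
      using X(1) step_class_borel[OF c0(1), of "\<lambda>a. a = j"] by auto
    have B_sets: "?B \<in> sets lebesgue"
    proof -
      have "step (E' \<union> Z0) (\<lambda>x. (\<lambda>(a, b) c. (a, b, c)) (col x, c1 x) (c0 x))"
        by (rule step_combine[OF step_pair c0(1)])
      from step_class_borel[OF this, of "\<lambda>(a, b, c). a = 0 \<and> c \<noteq> b"] show ?thesis by (simp add: c1_def)
    qed
    have "value_of w1 i (?g j) \<le> value_of w1 i ((?X \<inter> {x \<in> {0..1}. c0 x = j}) \<union> ?B)"
      using c0_sets B_sets by (intro finite_measure_mono) (auto simp: c1_def)
    also have "\<dots> \<le> value_of w1 i (?X \<inter> {x \<in> {0..1}. c0 x = j}) + value_of w1 i ?B"
      using c0_sets B_sets by (intro measure_Un_le) auto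
    finally have 1: "value_of w1 i (?g j) \<le> value_of w1 i (?X \<inter> {x \<in> {0..1}. c0 x = j}) + m * \<delta>" using B by simp
    have sub: "?X \<inter> {x \<in> {0..1}. c0 x = j} \<subseteq> ?g j \<union> ?B"
    proof
      fix x assume "x \<in> ?X \<inter> {x \<in> {0..1}. c0 x = j}"
      then show "x \<in> ?g j \<union> ?B" by (cases "c1 x = j") (simp_all add: c1_def)
    qed
    have "value_of w1 i (?X \<inter> {x \<in> {0..1}. c0 x = j}) \<le> value_of w1 i (?g j \<union> ?B)"
      by (rule finite_measure_mono[OF sub]) (use g_borel[of j] B_sets in \<open>simp only: sets_value_measure sets.Un\<close>)
    also have "\<dots> \<le> value_of w1 i (?g j) + value_of w1 i ?B"
      using g_borel B_sets by (intro measure_Un_le) auto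
    finally show ?thesis using 1 B by (simp add: abs_le_iff)
  qed
  have runE': "\<exists>a\<in>E. a < 1 \<and> col a = 0 \<and> a \<le> y \<and> grid_next E' y \<le> grid_next E a \<and> y \<le> grid_next E' y"
    if y: "y \<in> E'" "y < 1" "col y = 0" for y
  proof -
    have y0: "0 \<le> y" using grid_bounds[OF E' y(1)] by simp
    note r = run[OF y0 y(2,3)]
    have "grid_next E' y \<le> grid_next E (grid_below E y)"
      using grid_next(3)[OF E' y(2)] grid_next(1)[OF E(1) r(2)] EE' r(5) by auto
    then show ?thesis using r grid_next(2)[OF E' y(2)] by (intro bexI[of _ "grid_below E y"]) auto
  qed
  have osc_E': "\<bar>cdf_of w i y - cdf_of w' i y\<bar> \<le> \<delta> \<and>
       \<bar>cdf_of w i (grid_next E' y) - cdf_of w' i (grid_next E' y)\<bar> \<le> \<delta>"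
    if w: "w \<in> ?S" "w' \<in> ?S" and i: "i \<in> {1..n}" and y: "y \<in> E'" "y < 1" "col y = 0" for w w' i y
  proof -
    obtain a where a: "a \<in> E" "a < 1" "col a = 0" "a \<le> y" "grid_next E' y \<le> grid_next E a" "y \<le> grid_next E' y"
      using runE'[OF y] by blast
    then show ?thesis using osc'[OF w i a(1-3), of y] osc'[OF w i a(1-3), of "grid_next E' y"] by auto
  qed
  have w1S: "w1 \<in> ?S" using w1 by auto
  have compare: "\<bar>value_of w i (?g j) - value_of w1 i (?g j)\<bar> \<le> 2 * \<delta> * (card E + m)"
    if w: "w \<in> ?S" and i: "i \<in> {1..n}" for w i j
  proof -
    have "\<bar>value_of w i (?g j) - value_of w1 i (?g j)\<bar> \<le> 2 * \<delta> * real (card E')"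
    proof (rule class_measure_compare[OF _ v1[OF i] E' step_pair])
      show "valued_cake (fst w i)" by (rule vc) (use w i in auto)
    qed (use osc_E'[OF w w1S i] \<open>0 < \<delta>\<close> in auto)
    also have "\<dots> \<le> 2 * \<delta> * (card E + m)"
    proof -
      have "real (card E') \<le> real (card E + 8 * k * n)" using card_E' by (rule of_nat_mono)
      then show ?thesis using \<open>0 < \<delta>\<close> unfolding m_def by (intro mult_left_mono) simp_all
    qed
    finally show ?thesis .
  qed
  show ?thesis
  proof (rule that[of E' col'])
    show "E' \<subseteq> E \<union> (\<lambda>(i, \<alpha>). snd w1 i \<alpha>) ` Q" using EE' by (simp add: G_def)
    show "card E' \<le> card E + 8 * k * n" by (rule card_E')
    show "splitting_state n k (\<delta> / 2) (\<rho> / 4 + \<delta> * (1 + m + 2 * (card E + m)))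
       (e + \<delta> * (1 + 2 * m + 4 * (card E + m))) ?S E' col'"
      unfolding splitting_state_def
    proof (intro conjI ballI allI impI E' step')
      show "col' x \<le> k" for x using E(3)[of x] c0(2) by (simp add: col'_def c1_def)
      fix w i assume w: "w \<in> ?S" and i: "i \<in> {1..n}"
      interpret valued_cake "fst w i" by (rule vc) (use w i in auto)
      have "value_of w i {x \<in> {0..1}. col' x = 0} = value_of w i (?g 0)"
        by (rule arg_cong[of _ _ "value_of w i"]) (auto simp: col'_def)
      also have "\<dots> \<le> value_of w1 i (?g 0) + 2 * \<delta> * (card E + m)"
        by (rule abs_le_add[OF compare[OF w i]])
      also have "value_of w1 i (?g 0) \<le> value_of w1 i (?X \<inter> {x \<in> {0..1}. c0 x = 0}) + m * \<delta>"
        by (rule abs_le_add[OF g_round[OF i]])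
      also have "value_of w1 i (?X \<inter> {x \<in> {0..1}. c0 x = 0}) \<le> value_of w1 i ?X / 4 + \<delta>"
        by (rule c0_left[OF i])
      also have "value_of w1 i ?X \<le> \<rho>" by (rule \<rho>[OF w1 i])
      finally show "value_of w i {x \<in> {0..1}. col' x = 0} \<le> \<rho> / 4 + \<delta> * (1 + m + 2 * (card E + m))"
        by (simp add: algebra_simps)
      fix j j' assume j: "j \<in> {1..k}" "j' \<in> {1..k}"
      have split: "value_of w i {x \<in> {0..1}. col' x = j} = value_of w i {x \<in> {0..1}. col x = j} + value_of w i (?g j)"
        if "j \<in> {1..k}" for j
      proof -
        have "{x \<in> {0..1}. col' x = j} = {x \<in> {0..1}. col x = j} \<union> ?g j"
          using that by (auto simp: col'_def)
        moreover have "{x \<in> {0..1}. col x = j} \<inter> ?g j = {}" using that by auto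
        moreover have "{x \<in> {0..1}. col x = j} \<in> sets lebesgue" using step_class_borel[OF E(2)] by simp
        ultimately show ?thesis using g_borel[of j] finite_measure_Union by simp
      qed
      have "\<bar>value_of w1 i (?g j) - value_of w1 i (?g j')\<bar> \<le> \<delta> + 2 * (m * \<delta>)"
        using g_round[OF i, of j] g_round[OF i, of j'] c0_eq[OF i j] by linarith
      then have "\<bar>value_of w i (?g j) - value_of w i (?g j')\<bar> \<le> \<delta> + 2 * (m * \<delta>) + 2 * (2 * \<delta> * (card E + m))"
        using compare[OF w i, of j] compare[OF w i, of j'] by linarith
      moreover have "\<bar>value_of w i {x \<in> {0..1}. col x = j} - value_of w i {x \<in> {0..1}. col x = j'}\<bar> \<le> e"
        using e w i j by auto
      ultimately have "\<bar>value_of w i {x \<in> {0..1}. col' x = j} - value_of w i {x \<in> {0..1}. col' x = j'}\<bar>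
          \<le> e + (\<delta> + 2 * (m * \<delta>) + 2 * (2 * \<delta> * (card E + m)))"
        unfolding split[OF j(1)] split[OF j(2)] by linarith
      then show "\<bar>value_of w i {x \<in> {0..1}. col' x = j} - value_of w i {x \<in> {0..1}. col' x = j'}\<bar>
          \<le> e + \<delta> * (1 + 2 * m + 4 * (card E + m))"
        by (simp add: algebra_simps)
    next
      fix w w' i y assume w: "w \<in> ?S" "w' \<in> ?S" "i \<in> {1..n}" "y \<in> E'" "y < 1" "col' y = 0"
      then have "col y = 0" by (auto simp: col'_def split: if_splits)
      then show "\<bar>cdf_of w i y - cdf_of w' i y\<bar> \<le> 2 * (\<delta> / 2)"
        "\<bar>cdf_of w i (grid_next E' y) - cdf_of w' i (grid_next E' y)\<bar> \<le> 2 * (\<delta> / 2)"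
        using osc_E'[of w w' i y] w by auto
    qed
  qed
qed

lemma splitting_state_mono:
  assumes "splitting_state n k \<delta> \<rho> e S E col" "\<rho> \<le> \<rho>'" "e \<le> e'"
  shows "splitting_state n k \<delta> \<rho>' e' S E col"
proof -
  have "value_of w i {x \<in> {0..1}. col x = 0} \<le> \<rho>'" if "w \<in> S" "i \<in> {1..n}" for w i
    using assms(1,2) that unfolding splitting_state_def by (meson order.trans)
  moreover have "\<bar>value_of w i {x \<in> {0..1}. col x = j} - value_of w i {x \<in> {0..1}. col x = j'}\<bar> \<le> e'"
    if "w \<in> S" "i \<in> {1..n}" "j \<in> {1..k}" "j' \<in> {1..k}" for w i j j'
    using assms(1,3) that unfolding splitting_state_def by (meson order.trans)
  ultimately show ?thesis using assms(1) unfolding splitting_state_def by blast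
qed

lemma abs_add_close:
  "\<bar>a - b\<bar> \<le> e \<Longrightarrow> 0 \<le> x \<Longrightarrow> x \<le> r \<Longrightarrow> 0 \<le> y \<Longrightarrow> y \<le> r \<Longrightarrow> \<bar>(a + x) - (b + y)\<bar> \<le> e + r"
  for a b e x y r :: real
  by linarith

text \<open>The rest of colour 0 goes to part 1, which grows by at most \<open>\<rho>\<close>. All
  parts are then within \<open>e + \<rho>\<close> of each other and sum to 1, so each is that close
  to the average \<open>1 / k\<close>.\<close>

lemma splitting_state_final:
  assumes st: "splitting_state n k \<delta> \<rho> e S E col" and S: "S \<subseteq> worlds n" and w: "w \<in> S" and "1 \<le> k"
    and E: "E \<subseteq> {0, 1} \<union> D" and small: "e + \<rho> < \<epsilon>"
  defines "A \<equiv> \<lambda>j. {x \<in> {0..1}. max 1 (col x) = j}"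
  shows "cake_partition k A" "\<forall>j\<in>{1..k}. frontier (A j) \<subseteq> {0, 1} \<union> D" "measure_splitting \<epsilon> k n (fst w) A"
proof -
  have step: "step E col" and le: "\<And>x. col x \<le> k"
    and \<rho>: "\<And>i. i \<in> {1..n} \<Longrightarrow> value_of w i {x \<in> {0..1}. col x = 0} \<le> \<rho>"
    and e: "\<And>i j j'. i \<in> {1..n} \<Longrightarrow> j \<in> {1..k} \<Longrightarrow> j' \<in> {1..k} \<Longrightarrow>
       \<bar>value_of w i {x \<in> {0..1}. col x = j} - value_of w i {x \<in> {0..1}. col x = j'}\<bar> \<le> e"
    using st w unfolding splitting_state_def by blast+
  have step': "step E (\<lambda>x. max 1 (col x))" using step unfolding step_def by metis
  show part: "cake_partition k A"
    unfolding A_def using le \<open>1 \<le> k\<close> by (intro step_cake_partition[OF step']) auto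
  show "\<forall>j\<in>{1..k}. frontier (A j) \<subseteq> {0, 1} \<union> D"
  proof
    fix j
    show "frontier (A j) \<subseteq> {0, 1} \<union> D"
      using step_frontier[OF step', of "\<lambda>a. a = j"] E unfolding A_def by auto
  qed
  show "measure_splitting \<epsilon> k n (fst w) A"
    unfolding measure_splitting_def
  proof (intro ballI)
    fix i j assume i: "i \<in> {1..n}" and j: "j \<in> {1..k}"
    interpret valued_cake "fst w i" by (rule worlds_valued_cake[OF subsetD[OF S w] i])
    have A_sets: "A j \<in> sets lebesgue" for j
      using step_class_borel[OF step'] unfolding A_def by simp
    have c_sets: "{x \<in> {0..1}. col x = a} \<in> sets lebesgue" for a
      using step_class_borel[OF step] by simp
    have A1: "value_of w i (A j) = value_of w i {x \<in> {0..1}. col x = j} + (if j = 1 then value_of w i {x \<in> {0..1}. col x = 0} else 0)"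
      if "j \<in> {1..k}" for j
    proof (cases "j = 1")
      case True
      have "A j = {x \<in> {0..1}. col x = j} \<union> {x \<in> {0..1}. col x = 0}"
        unfolding A_def True by (auto simp: max_def)
      then show ?thesis using True c_sets by (simp only:) (subst finite_measure_Union, auto)
    next
      case False
      then have "A j = {x \<in> {0..1}. col x = j}" using that unfolding A_def by (auto simp: max_def)
      then show ?thesis using False by simp
    qed
    have near: "\<bar>value_of w i (A j) - value_of w i (A j')\<bar> \<le> e + \<rho>" if "j' \<in> {1..k}" for j'
    proof -
      have "0 \<le> value_of w i {x \<in> {0..1}. col x = 0}" by simp
      then have "0 \<le> \<rho>" using \<rho>[OF i] by (rule order.trans)
      then show ?thesis
        unfolding A1[OF j] A1[OF that] using \<rho>[OF i] by (intro abs_add_close e[OF i j that]) auto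
    qed
    have "(\<Sum>j'\<in>{1..k}. value_of w i (A j')) = value_of w i (\<Union>j'\<in>{1..k}. A j')"
      using A_sets by (intro finite_measure_finite_Union[symmetric]) (auto simp: disjoint_family_on_def A_def)
    also have "(\<Union>j'\<in>{1..k}. A j') = {0..1}" using part by (simp add: cake_partition_def)
    also have "value_of w i {0..1} = 1" using cdf_measure[of 1] by simp
    finally have "real k * value_of w i (A j) - 1 = (\<Sum>j'\<in>{1..k}. value_of w i (A j) - value_of w i (A j'))"
      by (simp add: sum_subtractf)
    also have "\<bar>\<dots>\<bar> \<le> (\<Sum>j'\<in>{1..k}. e + \<rho>)"
      using near by (intro order.trans[OF sum_abs sum_mono]) auto
    also have "\<dots> < k * \<epsilon>" using small \<open>1 \<le> k\<close> by simp
    finally have "\<bar>real k * value_of w i (A j) - 1\<bar> < k * \<epsilon>" .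
    moreover have "piece_value (fst w i) (A j) = value_of w i (A j)"
      by (rule measure_eq_piece_value[OF A_sets, symmetric]) (auto simp: A_def)
    ultimately show "piece_value (fst w i) (A j) \<in> {1 / k - \<epsilon> <..< 1 / k + \<epsilon>}"
      using \<open>1 \<le> k\<close> by (auto simp: field_simps abs_less_iff)
  qed
qed

section \<open>Parameters of the rounds and the total number of queries\<close>

locale splitting_parameters =
  fixes n k :: nat and \<epsilon> :: real
  assumes n: "1 \<le> n" and k: "1 \<le> k" and \<epsilon>: "0 < \<epsilon>" "\<epsilon> < 1"
begin

definition "M = real (8 * k * n)"
text \<open>Small enough that the final errors, at most
  \<open>48 * \<kappa> + \<epsilon> / 4\<close>, stay below \<epsilon>.\<close>

definition "\<kappa> = \<epsilon> / 100"
definition "\<delta> t = \<kappa> / M * (1 / 2 ^ t)" for t :: nat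
text \<open>The first term comes from quartering the whole cake \<open>t\<close> times; the second
  dominates the errors of round \<open>t\<close>, at most
  \<open>4 * \<kappa> * (t + 1) / 2 ^ t\<close>, that each later round quarters as well.\<close>

definition "\<rho> t = (1 / 2 ^ t) * (1 / 2 ^ t) + 16 * \<kappa> * (real t + 1) * (1 / 2 ^ t)" for t :: nat
text \<open>Closed form of the sum of \<open>8 * \<kappa> * (u + 1) / 2 ^ u\<close> over
  \<open>u < t\<close>; the full series is \<open>32 * \<kappa>\<close>.\<close>

definition "err t = 8 * \<kappa> * (4 - 2 * (real t + 2) * (1 / 2 ^ t))" for t :: nat
definition "cost t = nat \<lfloor>n * (\<rho> t / \<delta> t + 6 * (t * M + 2))\<rfloor>" for t :: nat

lemma M: "8 \<le> M"
proof -
  have "1 \<le> k * n" using n k by simp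
  then show ?thesis unfolding M_def by (simp only: of_nat_mult[symmetric] mult.assoc)
qed

lemma \<kappa>: "0 < \<kappa>" using \<epsilon> by (simp add: \<kappa>_def)

lemma \<delta>: "0 < \<delta> t" using M \<kappa> by (simp add: \<delta>_def)

lemma M_\<delta>: "M * \<delta> t = \<kappa> * (1 / 2 ^ t)" using M by (simp add: \<delta>_def)

lemma \<delta>_Suc: "\<delta> t / 2 = \<delta> (Suc t)" by (simp add: \<delta>_def)

text \<open>The number \<open>c\<close> stands for the size of the grid after \<open>t\<close>
  rounds: two ends of the cake and at most \<open>M\<close> new cuts per round.\<close>

lemma \<rho>_Suc:
  assumes "c \<le> t * M + 2"
  shows "\<rho> t / 4 + \<delta> t * (1 + M + 2 * (c + M)) \<le> \<rho> (Suc t)"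
proof -
  let ?p = "1 / 2 ^ t :: real"
  have "1 + M + 2 * (c + M) \<le> M * (4 * (real t + 1))"
  proof -
    define u where "u = real t * M"
    have eq: "M * (4 * (real t + 1)) = 4 * u + 4 * M"
      by (simp add: u_def algebra_simps)
    have "0 \<le> u" "c \<le> u + 2" using M assms by (simp_all add: u_def)
    then show ?thesis using M unfolding eq by simp
  qed
  then have "\<delta> t * (1 + M + 2 * (c + M)) \<le> \<delta> t * (M * (4 * (real t + 1)))"
    using \<delta>[of t] by (intro mult_left_mono) auto
  also have "\<dots> = \<kappa> * ?p * (4 * (real t + 1))"
    using M_\<delta>[of t] by (simp add: mult.assoc[symmetric] mult.commute)
  finally have 1: "\<delta> t * (1 + M + 2 * (c + M)) \<le> \<kappa> * ?p * (4 * (real t + 1))" .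
  have "\<rho> (Suc t) = (?p / 2) * (?p / 2) + 16 * \<kappa> * (real t + 2) * (?p / 2)"
    by (simp add: \<rho>_def add.commute)
  also have "\<dots> = \<rho> t / 4 + \<kappa> * ?p * (4 * (real t + 1)) + 8 * \<kappa> * ?p"
    unfolding \<rho>_def by (simp add: field_simps)
  finally have 2: "\<rho> (Suc t) = \<rho> t / 4 + \<kappa> * ?p * (4 * (real t + 1)) + 8 * \<kappa> * ?p" .
  have "0 \<le> 8 * \<kappa> * ?p" using \<kappa> by simp
  then show ?thesis unfolding 2 using 1 by linarith
qed

lemma err_Suc:
  assumes "c \<le> t * M + 2"
  shows "err t + \<delta> t * (1 + 2 * M + 4 * (c + M)) \<le> err (Suc t)"
proof -
  let ?p = "1 / 2 ^ t :: real"
  have "1 + 2 * M + 4 * (c + M) \<le> M * (8 * (real t + 1))"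
  proof -
    define u where "u = real t * M"
    have eq: "M * (8 * (real t + 1)) = 8 * u + 8 * M"
      by (simp add: u_def algebra_simps)
    have "0 \<le> u" "c \<le> u + 2" using M assms by (simp_all add: u_def)
    then show ?thesis using M unfolding eq by simp
  qed
  then have "\<delta> t * (1 + 2 * M + 4 * (c + M)) \<le> \<delta> t * (M * (8 * (real t + 1)))"
    using \<delta>[of t] by (intro mult_left_mono) auto
  also have "\<dots> = \<kappa> * ?p * (8 * (real t + 1))"
    using M_\<delta>[of t] by (simp add: mult.assoc[symmetric] mult.commute)
  finally have 1: "\<delta> t * (1 + 2 * M + 4 * (c + M)) \<le> \<kappa> * ?p * (8 * (real t + 1))" .
  have "err (Suc t) = 8 * \<kappa> * (4 - 2 * (real t + 3) * (?p / 2))"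
    by (simp add: err_def add.commute)
  also have "\<dots> = err t + \<kappa> * ?p * (8 * (real t + 1))"
    unfolding err_def by (simp add: field_simps)
  finally show ?thesis using 1 by simp
qed

lemma err_\<rho>_small:
  assumes "2 / \<epsilon> \<le> 2 ^ T"
  shows "err T + \<rho> T < \<epsilon>"
proof -
  define p :: real where "p = 1 / 2 ^ T"
  have p: "0 < p" "p \<le> \<epsilon> / 2" using assms \<epsilon> by (auto simp: p_def field_simps)
  have "real T + 1 \<le> 2 ^ T" using less_exp[of T] by (metis Suc_eq_plus1 Suc_leI of_nat_1 of_nat_add of_nat_le_iff of_nat_numeral of_nat_power)
  then have "(real T + 1) * p \<le> 1" by (simp add: p_def field_simps)
  then have "16 * \<kappa> * ((real T + 1) * p) \<le> 16 * \<kappa> * 1" using \<kappa> by (intro mult_left_mono) auto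
  moreover have "p * p \<le> \<epsilon> / 2 * (1 / 2)" using p \<epsilon> by (intro mult_mono) linarith+
  moreover have "err T \<le> 32 * \<kappa>" using \<kappa> unfolding err_def by (simp add: field_simps)
  ultimately have "err T + \<rho> T \<le> 48 * \<kappa> + \<epsilon> / 4" 
    unfolding \<rho>_def p_def[symmetric] by (simp add: algebra_simps)
  then show ?thesis using \<epsilon> by (simp add: \<kappa>_def)
qed

lemma achievable_rounds:
  assumes "splitting_state n k (\<delta> t) (\<rho> t) (err t) S E col" "S \<subseteq> worlds n" "E \<subseteq> {0, 1} \<union> D"
    "card E \<le> t * (8 * k * n) + 2" "2 / \<epsilon> \<le> 2 ^ (t + r)"
  shows "achievable n D (\<Sum>u=t..<t + r. cost u) S (\<lambda>w D A. cake_partition k A \<and>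
      (\<forall>j\<in>{1..k}. frontier (A j) \<subseteq> {0, 1} \<union> D) \<and> measure_splitting \<epsilon> k n (fst w) A)"
  using assms
proof (induction r arbitrary: t S E col D)
  case 0
  have small: "err t + \<rho> t < \<epsilon>" using err_\<rho>_small "0.prems"(5) by simp
  show ?case
  proof (rule achievable_output)
    fix w assume w: "w \<in> S"
    let ?A = "\<lambda>j. {x \<in> {0..1}. max 1 (col x) = j}"
    show "cake_partition k ?A \<and> (\<forall>j\<in>{1..k}. frontier (?A j) \<subseteq> {0, 1} \<union> D) \<and>
        measure_splitting \<epsilon> k n (fst w) ?A"
      by (intro conjI splitting_state_final[OF "0.prems"(1,2) w k "0.prems"(3) small])
  qed
next
  case (Suc r)
  note st = Suc.prems(1) and S = Suc.prems(2)
  have c: "real (card E) \<le> t * M + 2"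
    using of_nat_mono[OF Suc.prems(4), where 'a = real] by (simp add: M_def)
  show ?case
  proof (cases "S = {}")
    case True
    then show ?thesis by (auto intro: achievable_output)
  next
    case False
    \<comment> \<open>Any world still possible can steer the choice of the queries. It is fixed
      before the answers are known; these are represented by \<open>w1\<close> below.\<close>
    then obtain w0 where w0: "w0 \<in> S" by auto
    define Q where "Q = refine_queries n (\<delta> t) w0 E col"
    note rq = refine_queries[OF st S w0 \<delta>, folded Q_def]
    have "real (card Q) \<le> n * (\<rho> t / \<delta> t + 6 * (t * M + 2))"
      using c by (intro order.trans[OF rq(3)] mult_left_mono) auto
    then have cardQ: "card Q \<le> cost t" unfolding cost_def by (simp add: le_nat_floor)
    let ?F = "\<lambda>w D A. cake_partition k A \<and>
      (\<forall>j\<in>{1..k}. frontier (A j) \<subseteq> {0, 1} \<union> D) \<and> measure_splitting \<epsilon> k n (fst w) A"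
    have "achievable n D (card Q + (\<Sum>u=Suc t..<Suc t + r. cost u)) S ?F"
    proof (rule achievable_cuts[OF rq(1,2)])
      fix w1 assume w1: "w1 \<in> S"
      let ?S = "{w \<in> S. \<forall>(i, \<alpha>)\<in>Q. snd w i \<alpha> = snd w1 i \<alpha>}"
      obtain E' col' where E': "E' \<subseteq> E \<union> (\<lambda>(i, \<alpha>). snd w1 i \<alpha>) ` Q" "card E' \<le> card E + 8 * k * n"
        "splitting_state n k (\<delta> t / 2) (\<rho> t / 4 + \<delta> t * (1 + M + 2 * (card E + M)))
          (err t + \<delta> t * (1 + 2 * M + 4 * (card E + M))) ?S E' col'"
        by (rule refine_step[OF st S w0 \<delta> k w1, folded M_def Q_def]) blast
      show "achievable n (D \<union> (\<lambda>(i, \<alpha>). snd w1 i \<alpha>) ` Q) (\<Sum>u=Suc t..<Suc t + r. cost u) ?S ?F"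
      proof (rule Suc.IH)
        show "splitting_state n k (\<delta> (Suc t)) (\<rho> (Suc t)) (err (Suc t)) ?S E' col'"
          using splitting_state_mono[OF E'(3) \<rho>_Suc[OF c] err_Suc[OF c]] by (simp add: \<delta>_Suc)
        show "?S \<subseteq> worlds n" using S by auto
        show "E' \<subseteq> {0, 1} \<union> (D \<union> (\<lambda>(i, \<alpha>). snd w1 i \<alpha>) ` Q)" using E'(1) Suc.prems(3) by auto
        show "card E' \<le> Suc t * (8 * k * n) + 2" using E'(2) Suc.prems(4) by simp
        show "2 / \<epsilon> \<le> 2 ^ (Suc t + r)" using Suc.prems(5) by simp
      qed
    qed
    moreover have "card Q + (\<Sum>u=Suc t..<Suc t + r. cost u) \<le> (\<Sum>u=t..<t + Suc r. cost u)"
    proof -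
      have "sum cost {t..<t + Suc r} = cost t + sum cost {Suc t..<t + Suc r}"
        by (rule sum.atLeast_Suc_lessThan) simp
      moreover have "Suc t + r = t + Suc r" by simp
      ultimately show ?thesis using cardQ by presburger
    qed
    ultimately show ?thesis by (rule achievable_mono) simp
  qed
qed

lemma initial_state: "splitting_state n k (\<delta> 0) (\<rho> 0) (err 0) (worlds n) {0, 1} (\<lambda>_. 0)"
proof -
  have g: "grid {0, 1}" by (auto simp: grid_def)
  have nx: "grid_next {0, 1} 0 = 1" using grid_next[OF g, of 0] by auto
  have "value_of w i {x \<in> {0..1}. (0::nat) = 0} \<le> \<rho> 0" if "w \<in> worlds n" "i \<in> {1..n}" for w i
  proof -
    interpret valued_cake "fst w i" by (rule worlds_valued_cake[OF that])
    have "value_of w i {0..1} = 1" using cdf_measure[of 1] by simp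
    moreover have "{x \<in> {0..1}. (0::nat) = 0} = {0..1::real}" by auto
    ultimately show ?thesis using \<kappa> by (simp add: \<rho>_def)
  qed
  then show ?thesis
    unfolding splitting_state_def using g nx \<delta>[of 0]
    by (auto simp: step_def err_def valued_cake.cdf_0[OF worlds_valued_cake] valued_cake.cdf_1[OF worlds_valued_cake])
qed

lemma square_le_exp: "T ^ 2 \<le> 2 * 2 ^ T" for T :: nat
proof (induction T)
  case (Suc T)
  show ?case
  proof (cases "T \<le> 2")
    case True
    then have "T = 0 \<or> T = 1 \<or> T = 2" by auto
    then show ?thesis by (auto simp: power2_eq_square)
  next
    case False
    then have "3 * T \<le> T * T" by (intro mult_right_mono) auto
    moreover have "1 + 2 * T \<le> 3 * T" using False by simp
    ultimately have "1 + 2 * T \<le> T * T" by (rule order.trans[rotated])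
    then have "Suc T ^ 2 \<le> 2 * T ^ 2" by (simp add: power2_eq_square)
    then show ?thesis using Suc by simp
  qed
qed simp

text \<open>The ratio \<open>\<rho> t / \<delta> t\<close> contributes a geometric term, as leftover
  value falls faster than cell size, and a linear one from the accumulated errors; the extra
  multiples at the ends of intervals are linear in \<open>t\<close> too.\<close>

lemma cost_le: "real (cost t) \<le> n * M * (1 / \<kappa> * (1 / 2) ^ t + 24 * (real t + 1))"
proof -
  let ?p = "1 / 2 ^ t :: real"
  have nn: "0 \<le> n * (\<rho> t / \<delta> t + 6 * (t * M + 2))"
    using \<delta>[of t] \<kappa> M by (auto simp: \<rho>_def intro!: mult_nonneg_nonneg add_nonneg_nonneg divide_nonneg_nonneg)
  have "real (cost t) \<le> n * (\<rho> t / \<delta> t + 6 * (t * M + 2))"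
    unfolding cost_def using nn by (simp add: of_nat_nat)
  also have "\<rho> t / \<delta> t = M * (1 / \<kappa> * ?p + 16 * (real t + 1))"
  proof -
    have "\<rho> t = \<delta> t * (M * (1 / \<kappa> * ?p + 16 * (real t + 1)))"
      using M \<kappa> unfolding \<rho>_def \<delta>_def by (simp add: field_simps)
    then show ?thesis using \<delta>[of t] by (simp add: field_simps)
  qed
  also have "6 * (t * M + 2) \<le> M * (8 * (real t + 1))"
  proof -
    define u where "u = real t * M"
    have eq: "M * (8 * (real t + 1)) = 8 * u + 8 * M" by (simp add: u_def algebra_simps)
    have "0 \<le> u" using M by (simp add: u_def)
    then show ?thesis using M unfolding eq u_def[symmetric] by simp
  qed
  finally have "real (cost t) \<le> n * (M * (1 / \<kappa> * ?p + 16 * (real t + 1)) + M * (8 * (real t + 1)))"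
    by (simp add: mult_left_mono)
  then show ?thesis by (simp add: algebra_simps power_one_over)
qed

text \<open>The geometric parts sum to at most \<open>2 / \<kappa>\<close>. The linear parts give
  \<open>T ^ 2\<close>, at most \<open>2 * 2 ^ T \<le> 8 / \<epsilon>\<close>, so no logarithm
  survives. With \<open>\<kappa> = \<epsilon> / 100\<close> the factor is
  \<open>8 * (200 + 192) = 3136\<close>.\<close>

lemma total_cost:
  assumes "2 ^ T \<le> 4 / \<epsilon>"
  shows "real (\<Sum>u<T. cost u) \<le> 3200 * (real k * (real n)\<^sup>2 / \<epsilon>)"
proof -
  have "real (\<Sum>u<T. cost u) \<le> (\<Sum>u<T. n * M * (1 / \<kappa> * (1 / 2) ^ u + 24 * (real u + 1)))"
    unfolding of_nat_sum by (intro sum_mono cost_le)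
  also have "\<dots> = n * M * (1 / \<kappa> * (\<Sum>u<T. (1 / 2) ^ u) + 24 * (\<Sum>u<T. real u + 1))"
    by (simp add: sum.distrib sum_distrib_left distrib_left)
  also have "\<dots> \<le> n * M * (1 / \<kappa> * 2 + 24 * (8 / \<epsilon>))"
  proof (intro mult_left_mono add_mono)
    show "(\<Sum>u<T. (1 / 2) ^ u) \<le> (2::real)" by (simp add: geometric_sum)
    have "(\<Sum>u<T. real u + 1) \<le> (\<Sum>u<T. real T)" by (intro sum_mono) auto
    also have "\<dots> = real (T ^ 2)" by (simp add: power2_eq_square)
    also have "\<dots> \<le> real (2 * 2 ^ T)" by (intro of_nat_mono square_le_exp)
    also have "\<dots> \<le> 8 / \<epsilon>" using assms by simp
    finally show "(\<Sum>u<T. real u + 1) \<le> 8 / \<epsilon>" .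
  qed (use M \<kappa> in auto)
  also have "\<dots> = 3136 * (real k * (real n)\<^sup>2 / \<epsilon>)"
    using \<epsilon> by (simp add: M_def \<kappa>_def power2_eq_square field_simps)
  also have "\<dots> \<le> 3200 * (real k * (real n)\<^sup>2 / \<epsilon>)"
    using \<epsilon> by (intro mult_right_mono) auto
  finally show ?thesis .
qed

lemma measure_splitting_computable:
  "rw_computable n k (3200 * (real k * (real n)\<^sup>2 / \<epsilon>)) (\<lambda>v A. measure_splitting \<epsilon> k n v A)"
proof -
  have ex: "\<exists>T :: nat. 2 / \<epsilon> \<le> 2 ^ T"
    using real_arch_pow[of 2 "2 / \<epsilon>"] by (meson less_imp_le one_less_numeral_iff semiring_norm(76))
  define T where "T = (LEAST T :: nat. 2 / \<epsilon> \<le> 2 ^ T)"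
  have T: "2 / \<epsilon> \<le> 2 ^ T" unfolding T_def using ex by (rule LeastI_ex)
  moreover have "\<not> 2 / \<epsilon> \<le> 2 ^ 0" using \<epsilon> by (simp add: field_simps)
  ultimately obtain T' where T': "T = Suc T'" by (cases T) auto
  then have "\<not> 2 / \<epsilon> \<le> 2 ^ T'" using not_less_Least[of T' "\<lambda>T. 2 / \<epsilon> \<le> 2 ^ T"] unfolding T_def by simp
  then have T_le: "2 ^ T \<le> 4 / \<epsilon>" by (simp add: T')
  have "achievable n {} (\<Sum>u=0..<0 + T. cost u) (worlds n) (\<lambda>w D A. cake_partition k A \<and>
      (\<forall>j\<in>{1..k}. frontier (A j) \<subseteq> {0, 1} \<union> D) \<and> measure_splitting \<epsilon> k n (fst w) A)"
    using T by (intro achievable_rounds[OF initial_state]) auto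
  then show ?thesis
    using total_cost[OF T_le] by (intro rw_computableI) (auto simp: lessThan_atLeast0)
qed

end

lemma measure_splitting_trivial:
  assumes "1 \<le> n" "1 \<le> k" "1 \<le> \<epsilon>" "0 \<le> q"
  shows "rw_computable n k q (\<lambda>v A. measure_splitting \<epsilon> k n v A)"
proof (rule rw_computableI)
  let ?A = "\<lambda>j. {x \<in> {0..1::real}. (1::nat) = j}"
  have st: "step {} (\<lambda>_. 1::nat)" by (simp add: step_def)
  have part: "cake_partition k ?A" using assms by (intro step_cake_partition[OF st]) auto
  have fr: "\<forall>j\<in>{1..k}. frontier (?A j) \<subseteq> {0, 1} \<union> {}"
  proof
    fix j
    show "frontier (?A j) \<subseteq> {0, 1} \<union> {}" using step_frontier[OF st, of "\<lambda>a. a = j"] by simp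
  qed
  have "measure_splitting \<epsilon> k n (fst w) ?A" if w: "w \<in> worlds n" for w
    unfolding measure_splitting_def
  proof (intro ballI)
    fix i j assume i: "i \<in> {1..n}" and j: "j \<in> {1..k}"
    interpret valued_cake "fst w i" by (rule worlds_valued_cake[OF w i])
    have k: "0 < 1 / real k" "1 / real k \<le> 1" using assms(2) by auto
    show "piece_value (fst w i) (?A j) \<in> {1 / k - \<epsilon> <..< 1 / k + \<epsilon>}"
    proof (cases "j = 1")
      case True
      then have "piece_value (fst w i) (?A j) = 1" using cdf_1 by (simp only: cdf_def simp_thms Collect_mem_eq)
      then show ?thesis using k assms(3) unfolding greaterThanLessThan_iff by linarith
    next
      case False
      then have "piece_value (fst w i) (?A j) = 0" by (simp add: piece_value_def set_lebesgue_integral_def)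
      moreover have "1 / real k < 1" using False j by auto
      ultimately show ?thesis using k assms(3) unfolding greaterThanLessThan_iff by linarith
    qed
  qed
  then show "achievable n {} 0 (worlds n) (\<lambda>w D A. cake_partition k A \<and>
      (\<forall>j\<in>{1..k}. frontier (A j) \<subseteq> {0, 1} \<union> D) \<and> measure_splitting \<epsilon> k n (fst w) A)"
    using part fr by (intro achievable_output[where A = ?A]) auto
qed (use assms in simp)

lemma rw_computable_measure_splitting:
  assumes "1 \<le> n" "1 \<le> k" "0 < \<epsilon>"
  shows "rw_computable n k (3200 * (real k * (real n)\<^sup>2 / \<epsilon>)) (\<lambda>v A. measure_splitting \<epsilon> k n v A)"
proof (cases "\<epsilon> < 1")
  case True
  then interpret splitting_parameters n k \<epsilon> using assms by unfold_locales
  show ?thesis by (rule measure_splitting_computable)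
next
  case False
  then show ?thesis using assms by (intro measure_splitting_trivial) auto
qed

lemma rw_computable_mono:
  assumes "rw_computable n m q F" "\<And>v A. F v A \<Longrightarrow> F' v A"
  shows "rw_computable n m q F'"
  using assms unfolding rw_computable_def Let_def by (metis (no_types, lifting))

lemma rw_computable_perfect:
  assumes "1 \<le> n" "0 < \<epsilon>"
  shows "rw_computable n n (3200 * (real n ^ 3 / \<epsilon>)) (\<lambda>v A. perfect \<epsilon> n v A)"
proof -
  have "rw_computable n n (3200 * (real n * (real n)\<^sup>2 / \<epsilon>)) (\<lambda>v A. perfect \<epsilon> n v A)"
  proof (rule rw_computable_mono[OF rw_computable_measure_splitting])
    fix v A assume m: "measure_splitting \<epsilon> n n v A"
    show "perfect \<epsilon> n v A"
      unfolding perfect_def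
    proof (intro ballI)
      fix i j assume "i \<in> {1..n}" "j \<in> {1..n}"
      then have "piece_value (v i) (A j) \<in> {1 / n - \<epsilon> <..< 1 / n + \<epsilon>}"
        using m unfolding measure_splitting_def by blast
      then show "\<bar>piece_value (v i) (A j) - 1 / n\<bar> \<le> \<epsilon>" unfolding greaterThanLessThan_iff by linarith
    qed
  qed (use assms in auto)
  then show ?thesis by (simp add: power3_eq_cube power2_eq_square mult.assoc)
qed

section \<open>The theorems of Poincare--Miranda and Hall\<close>

lemma tendsto_pointwise_iff:
  fixes X :: "'c \<Rightarrow> nat \<Rightarrow> real"
  shows "(X \<longlongrightarrow> u) F \<longleftrightarrow> (\<forall>i. ((\<lambda>p. X p i) \<longlongrightarrow> u i) F)"
  using limitin_componentwise[of "\<lambda>_. euclidean" UNIV X u F]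
  by (simp add: euclidean_product_topology limitin_canonical_iff)

lemma compact_cube: "compact (UNIV \<rightarrow> {0..1} :: (nat \<Rightarrow> real) set)"
proof -
  have "compactin (product_topology (\<lambda>_. euclidean) UNIV) (PiE UNIV (\<lambda>_. {0..1::real}) :: (nat \<Rightarrow> real) set)"
    by (subst compactin_PiE) auto
  then show ?thesis by (simp add: euclidean_product_topology PiE_UNIV_domain)
qed

text \<open>Vertices of a grid of mesh \<open>1 / p\<close> are labelled in each direction by the
  sign of \<open>g\<close>, with the boundary conditions justifying the labels forced on the faces.
  Kuhn's lemma yields a small cube on which no component keeps a strict sign, and compactness a
  limit of such cubes as the mesh shrinks.\<close>

theorem poincare_miranda:
  fixes g :: "(nat \<Rightarrow> real) \<Rightarrow> nat \<Rightarrow> real" and m :: nat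
  assumes cont: "\<And>i. i < m \<Longrightarrow> continuous_on (UNIV \<rightarrow> {0..1}) (\<lambda>u. g u i)"
    and lo: "\<And>u i. u \<in> UNIV \<rightarrow> {0..1} \<Longrightarrow> i < m \<Longrightarrow> u i = 0 \<Longrightarrow> 0 \<le> g u i"
    and hi: "\<And>u i. u \<in> UNIV \<rightarrow> {0..1} \<Longrightarrow> i < m \<Longrightarrow> u i = 1 \<Longrightarrow> g u i \<le> 0"
  obtains u where "u \<in> UNIV \<rightarrow> {0..1}" "\<And>i. i < m \<Longrightarrow> g u i = 0"
proof -
  define pt where "pt p x = (\<lambda>i. if i < m then real (x i) / real p else 0)" for p :: nat and x :: "nat \<Rightarrow> nat"
  have pt: "pt p x \<in> UNIV \<rightarrow> {0..1}" if "\<And>i. i < m \<Longrightarrow> x i \<le> p" for p x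
    using that by (auto simp: pt_def divide_le_eq_1)
  define label where "label p x i = (if x i = 0 then 0 else if x i = p then 1 else if 0 \<le> g (pt p x) i then 0 else 1 :: nat)"
    for p x i
  have label0: "0 \<le> g (pt p x) i" if "label p x i = 0" "i < m" "\<And>i. i < m \<Longrightarrow> x i \<le> p" for p x i
    using that pt[OF that(3)] lo[of "pt p x" i] by (auto simp: label_def pt_def split: if_splits)
  have label1: "g (pt p x) i \<le> 0" if "label p x i \<noteq> 0" "i < m" "\<And>i. i < m \<Longrightarrow> x i \<le> p" "0 < p" for p x i
    using that pt[OF that(3)] hi[of "pt p x" i] by (auto simp: label_def pt_def split: if_splits)
  have "\<exists>q. (\<forall>i<m. q i < p) \<and> (\<forall>i<m. \<exists>r s. (\<forall>j<m. q j \<le> r j \<and> r j \<le> q j + 1) \<and>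
      (\<forall>j<m. q j \<le> s j \<and> s j \<le> q j + 1) \<and> 0 \<le> g (pt p r) i \<and> g (pt p s) i \<le> 0)" if p: "0 < p" for p
  proof -
    obtain q where q: "\<forall>i<m. q i < p"
      and rs: "\<forall>i<m. \<exists>r s. (\<forall>j<m. q j \<le> r j \<and> r j \<le> q j + 1) \<and> (\<forall>j<m. q j \<le> s j \<and> s j \<le> q j + 1) \<and>
        label p r i \<noteq> label p s i"
    proof (rule kuhn_lemma[of p m "label p"])
      show "\<forall>x. (\<forall>i<m. x i \<le> p) \<longrightarrow> (\<forall>i<m. label p x i = 0 \<or> label p x i = 1)"
        by (simp add: label_def)
      show "\<forall>x. (\<forall>i<m. x i \<le> p) \<longrightarrow> (\<forall>i<m. x i = 0 \<longrightarrow> label p x i = 0)"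
        by (simp add: label_def)
      show "\<forall>x. (\<forall>i<m. x i \<le> p) \<longrightarrow> (\<forall>i<m. x i = p \<longrightarrow> label p x i = 1)"
        using p by (simp add: label_def)
    qed (use p in auto)
    have "\<exists>r s. (\<forall>j<m. q j \<le> r j \<and> r j \<le> q j + 1) \<and> (\<forall>j<m. q j \<le> s j \<and> s j \<le> q j + 1) \<and>
      0 \<le> g (pt p r) i \<and> g (pt p s) i \<le> 0" if i: "i < m" for i
    proof -
      obtain r s where *: "\<forall>j<m. q j \<le> r j \<and> r j \<le> q j + 1" "\<forall>j<m. q j \<le> s j \<and> s j \<le> q j + 1"
        "label p r i \<noteq> label p s i" using rs i by blast
      have r: "r j \<le> p" if "j < m" for j
        using *(1)[rule_format, OF that] q[rule_format, OF that] by linarith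
      have s: "s j \<le> p" if "j < m" for j
        using *(2)[rule_format, OF that] q[rule_format, OF that] by linarith
      show ?thesis
      proof (cases "label p r i = 0")
        case True
        then have "label p s i \<noteq> 0" using *(3) by simp
        have "0 \<le> g (pt p r) i" by (rule label0[OF True i r])
        moreover have "g (pt p s) i \<le> 0" by (rule label1[OF \<open>label p s i \<noteq> 0\<close> i s p])
        ultimately show ?thesis by (intro exI[of _ r] exI[of _ s] conjI *(1,2))
      next
        case False
        then have "label p s i = 0" using *(3) by (auto simp: label_def split: if_splits)
        then have "0 \<le> g (pt p s) i" by (rule label0[OF _ i s])
        moreover have "g (pt p r) i \<le> 0" by (rule label1[OF False i r p])
        ultimately show ?thesis by (intro exI[of _ s] exI[of _ r] conjI *(1,2))
      qed
    qed
    then show ?thesis using q by blast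
  qed
  then have "\<exists>q. (\<forall>i<m. q i < Suc p) \<and> (\<forall>i<m. \<exists>r s. (\<forall>j<m. q j \<le> r j \<and> r j \<le> q j + 1) \<and>
      (\<forall>j<m. q j \<le> s j \<and> s j \<le> q j + 1) \<and> 0 \<le> g (pt (Suc p) r) i \<and> g (pt (Suc p) s) i \<le> 0)" for p
    by blast
  then obtain q where q: "\<And>p i. i < m \<Longrightarrow> q p i < Suc p"
    and rs: "\<And>p i. i < m \<Longrightarrow> \<exists>r s. (\<forall>j<m. q p j \<le> r j \<and> r j \<le> q p j + 1) \<and>
      (\<forall>j<m. q p j \<le> s j \<and> s j \<le> q p j + 1) \<and> 0 \<le> g (pt (Suc p) r) i \<and> g (pt (Suc p) s) i \<le> 0"
    by metis
  have "\<forall>p. pt (Suc p) (q p) \<in> UNIV \<rightarrow> {0..1}"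
    using q by (intro allI pt) (meson less_imp_le)
  then obtain u \<phi> where u: "u \<in> UNIV \<rightarrow> {0..1}" and \<phi>: "strict_mono (\<phi> :: nat \<Rightarrow> nat)"
    and lim: "((\<lambda>p. pt (Suc p) (q p)) \<circ> \<phi>) \<longlonglongrightarrow> u"
    using seq_compactE[OF compact_imp_seq_compact[OF compact_cube]] by metis
  \<comment> \<open>Vertices of one small cube differ by at most a mesh width in each coordinate, so
    every choice of vertices has the same limit.\<close>
  have lim_near: "(\<lambda>p. pt (Suc (\<phi> p)) (r p)) \<longlonglongrightarrow> u"
    if r: "\<And>p j. j < m \<Longrightarrow> q (\<phi> p) j \<le> r p j \<and> r p j \<le> q (\<phi> p) j + 1" for r
    unfolding tendsto_pointwise_iff
  proof
    fix j
    have base: "(\<lambda>p. pt (Suc (\<phi> p)) (q (\<phi> p)) j) \<longlonglongrightarrow> u j"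
      using lim unfolding tendsto_pointwise_iff by (simp add: comp_def)
    have "(\<lambda>p. 1 / real (Suc (\<phi> p))) \<longlonglongrightarrow> 0"
      using LIMSEQ_subseq_LIMSEQ[OF LIMSEQ_inverse_real_of_nat \<phi>] by (simp add: comp_def inverse_eq_divide)
    then have "(\<lambda>p. pt (Suc (\<phi> p)) (r p) j - pt (Suc (\<phi> p)) (q (\<phi> p)) j) \<longlonglongrightarrow> 0"
    proof (rule Lim_null_comparison[rotated], intro always_eventually allI)
      fix p
      show "norm (pt (Suc (\<phi> p)) (r p) j - pt (Suc (\<phi> p)) (q (\<phi> p)) j) \<le> 1 / real (Suc (\<phi> p))"
      proof (cases "j < m")
        case True
        have "pt (Suc (\<phi> p)) (r p) j - pt (Suc (\<phi> p)) (q (\<phi> p)) j = (real (r p j) - real (q (\<phi> p) j)) / real (Suc (\<phi> p))"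
          using True by (simp add: pt_def diff_divide_distrib)
        moreover have "0 \<le> real (r p j) - real (q (\<phi> p) j)" "real (r p j) - real (q (\<phi> p) j) \<le> 1"
          using r[OF True, of p] by linarith+
        ultimately show ?thesis by (simp add: divide_right_mono)
      qed (simp add: pt_def)
    qed
    from tendsto_add[OF base this] show "(\<lambda>p. pt (Suc (\<phi> p)) (r p) j) \<longlonglongrightarrow> u j" by simp
  qed
  show ?thesis
  proof (rule that[OF u])
    fix i assume i: "i < m"
    have "\<forall>p. \<exists>r. (\<forall>j<m. q (\<phi> p) j \<le> r j \<and> r j \<le> q (\<phi> p) j + 1) \<and> 0 \<le> g (pt (Suc (\<phi> p)) r) i"
      and "\<forall>p. \<exists>s. (\<forall>j<m. q (\<phi> p) j \<le> s j \<and> s j \<le> q (\<phi> p) j + 1) \<and> g (pt (Suc (\<phi> p)) s) i \<le> 0"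
      using rs[OF i] by blast+
    then obtain r s where r: "\<And>p j. j < m \<Longrightarrow> q (\<phi> p) j \<le> r p j \<and> r p j \<le> q (\<phi> p) j + 1" "\<And>p. 0 \<le> g (pt (Suc (\<phi> p)) (r p)) i"
      and s: "\<And>p j. j < m \<Longrightarrow> q (\<phi> p) j \<le> s p j \<and> s p j \<le> q (\<phi> p) j + 1" "\<And>p. g (pt (Suc (\<phi> p)) (s p)) i \<le> 0"
      unfolding choice_iff by blast
    have conv: "(\<lambda>p. g (pt (Suc (\<phi> p)) (r p)) i) \<longlonglongrightarrow> g u i"
      if r: "\<And>p j. j < m \<Longrightarrow> q (\<phi> p) j \<le> r p j \<and> r p j \<le> q (\<phi> p) j + 1" for r
    proof (rule continuous_on_tendsto_compose[OF cont[OF i] lim_near[OF r] u])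
      show "\<forall>\<^sub>F p in sequentially. pt (Suc (\<phi> p)) (r p) \<in> UNIV \<rightarrow> {0..1}"
      proof (intro always_eventually allI pt)
        fix p j assume "j < m"
        then show "r p j \<le> Suc (\<phi> p)" using r[of j p] q[of j "\<phi> p"] by linarith
      qed
    qed
    have "0 \<le> g u i" by (rule LIMSEQ_le_const[OF conv[OF r(1)]]) (use r(2) in auto)
    moreover have "g u i \<le> 0" by (rule LIMSEQ_le_const2[OF conv[OF s(1)]]) (use s(2) in auto)
    ultimately show "g u i = 0" by simp
  qed
qed

text \<open>The argument of Halmos and Vaughan. A proper nonempty subset with exactly as many
  candidates as members is matched first, the rest then outside those candidates; if there is no
  such subset, there is slack enough to match one element arbitrarily.\<close>

theorem hall_marriage:
  fixes A :: "'i \<Rightarrow> 'j set"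
  assumes "finite I" "\<And>i. i \<in> I \<Longrightarrow> finite (A i)" "\<And>J. J \<subseteq> I \<Longrightarrow> card J \<le> card (\<Union>i\<in>J. A i)"
  shows "\<exists>f. inj_on f I \<and> (\<forall>i\<in>I. f i \<in> A i)"
  using assms
proof (induction "card I" arbitrary: I A rule: less_induct)
  case less
  note fin = less.prems(1,2) and hall = less.prems(3)
  have finU: "finite (\<Union>i\<in>J. A i)" if "J \<subseteq> I" for J
    using that fin finite_subset by (intro finite_UN_I) auto
  show ?case
  proof (cases "\<exists>J. J \<subset> I \<and> J \<noteq> {} \<and> card (\<Union>i\<in>J. A i) = card J")
    case True
    then obtain J where J: "J \<subset> I" "J \<noteq> {}" "card (\<Union>i\<in>J. A i) = card J" by auto
    have finJ: "finite J" using J fin(1) finite_subset by auto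
    have "card J < card I" using J fin(1) by (simp add: psubset_card_mono)
    then obtain f where f: "inj_on f J" "\<forall>i\<in>J. f i \<in> A i"
      using less.hyps[of J A] J finJ fin hall by (metis order.trans psubset_imp_subset subset_iff)
    let ?A = "\<lambda>i. A i - (\<Union>i\<in>J. A i)"
    have "card (I - J) < card I" using J finJ fin(1) by (intro psubset_card_mono) auto
    moreover have "card K \<le> card (\<Union>i\<in>K. ?A i)" if K: "K \<subseteq> I - J" for K
    proof -
      have finK: "finite K" using K fin(1) finite_subset by blast
      have "card K + card J = card (K \<union> J)" using K finJ finK by (subst card_Un_disjoint) auto
      also have "\<dots> \<le> card (\<Union>i\<in>K \<union> J. A i)" using K J by (intro hall) auto
      also have "(\<Union>i\<in>K \<union> J. A i) = (\<Union>i\<in>K. ?A i) \<union> (\<Union>i\<in>J. A i)" by auto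
      also have "card \<dots> \<le> card (\<Union>i\<in>K. ?A i) + card (\<Union>i\<in>J. A i)" by (rule card_Un_le)
      finally show ?thesis using J(3) by simp
    qed
    ultimately obtain h where h: "inj_on h (I - J)" "\<forall>i\<in>I - J. h i \<in> ?A i"
      using less.hyps[of "I - J" ?A] fin by auto
    let ?f = "\<lambda>i. if i \<in> J then f i else h i"
    have "?f i \<noteq> ?f j" if ij: "i \<in> I" "j \<in> I" "i \<noteq> j" for i j
    proof (cases "i \<in> J"; cases "j \<in> J")
      assume "i \<in> J" "j \<in> J"
      then show ?thesis using f(1) ij by (auto simp: inj_on_def)
    next
      assume *: "i \<in> J" "j \<notin> J"
      then have "h j \<notin> (\<Union>i\<in>J. A i)" "f i \<in> (\<Union>i\<in>J. A i)" using h(2) f(2) ij by blast+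
      then show ?thesis using * by auto
    next
      assume *: "i \<notin> J" "j \<in> J"
      then have "h i \<notin> (\<Union>i\<in>J. A i)" "f j \<in> (\<Union>i\<in>J. A i)" using h(2) f(2) ij by blast+
      then show ?thesis using * by auto
    next
      assume "i \<notin> J" "j \<notin> J"
      then show ?thesis using h(1) ij by (auto simp: inj_on_def)
    qed
    then have "inj_on ?f I" unfolding inj_on_def by blast
    moreover have "\<forall>i\<in>I. ?f i \<in> A i" using f(2) h(2) by auto
    ultimately show ?thesis by blast
  next
    case False
    show ?thesis
    proof (cases "I = {}")
      case nonempty: False
      then obtain i where i: "i \<in> I" by auto
      have "card {i} \<le> card (\<Union>i\<in>{i}. A i)" using i by (intro hall) auto
      then obtain x where x: "x \<in> A i" by (cases "A i = {}") auto
      let ?A = "\<lambda>j. A j - {x}"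
      have "card (I - {i}) < card I" using i fin(1) by (intro psubset_card_mono) auto
      moreover have "card K \<le> card (\<Union>i\<in>K. ?A i)" if K: "K \<subseteq> I - {i}" for K
      proof (cases "K = {}")
        case ne: False
        have "K \<subset> I" using K i by auto
        then have "card K < card (\<Union>i\<in>K. A i)"
          using False ne hall[of K] by (metis le_neq_implies_less psubset_imp_subset)
        moreover have "card (\<Union>i\<in>K. A i) - 1 \<le> card ((\<Union>i\<in>K. A i) - {x})"
          using finU[of K] K by (simp add: card_Diff_singleton_if subset_iff)
        moreover have "(\<Union>i\<in>K. ?A i) = (\<Union>i\<in>K. A i) - {x}" by auto
        ultimately show ?thesis by simp
      qed simp
      ultimately obtain h where h: "inj_on h (I - {i})" "\<forall>j\<in>I - {i}. h j \<in> ?A j"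
        using less.hyps[of "I - {i}" ?A] fin by auto
      have "inj_on (h(i := x)) I"
      proof (rule inj_onI)
        fix a b assume "a \<in> I" "b \<in> I" "(h(i := x)) a = (h(i := x)) b"
        then show "a = b" using h by (cases "a = i"; cases "b = i") (auto simp: inj_on_def)
      qed
      moreover have "\<forall>j\<in>I. (h(i := x)) j \<in> A j" using h x by auto
      ultimately show ?thesis by blast
    qed simp
  qed
qed

section \<open>Existence of approximately envy-free cuts\<close>

primrec stick_breaking :: "(nat \<Rightarrow> real) \<Rightarrow> nat \<Rightarrow> real" where
  "stick_breaking u 0 = 0"
| "stick_breaking u (Suc j) = stick_breaking u j + u j * (1 - stick_breaking u j)"

lemma stick_breaking_bounds:
  assumes "u \<in> UNIV \<rightarrow> {0..1}"
  shows "0 \<le> stick_breaking u j \<and> stick_breaking u j \<le> 1"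
proof (induction j)
  case (Suc j)
  have u: "0 \<le> u j" "u j \<le> 1" using assms by auto
  have "u j * (1 - stick_breaking u j) \<le> 1 * (1 - stick_breaking u j)"
    using u Suc by (intro mult_right_mono) auto
  moreover have "0 \<le> u j * (1 - stick_breaking u j)" using u Suc by simp
  ultimately show ?case using Suc by simp
qed simp

lemma stick_breaking_Suc_ge:
  assumes "u \<in> UNIV \<rightarrow> {0..1}"
  shows "stick_breaking u j \<le> stick_breaking u (Suc j)"
  using stick_breaking_bounds[OF assms, of j] assms by (auto simp: Pi_iff)

lemma stick_breaking_full: "stick_breaking u j = 1 \<Longrightarrow> j \<le> l \<Longrightarrow> stick_breaking u l = 1"
  by (induction l) (auto simp: le_Suc_eq)

lemma continuous_stick_breaking: "continuous_on K (\<lambda>u. stick_breaking u j)"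
  by (induction j) (auto intro!: continuous_intros continuous_on_subset[OF continuous_on_product_coordinates])

text \<open>Stick-breaking coordinates put the boundary condition of the Poincare--Miranda theorem on each
  face: on \<open>u j = 0\<close> piece \<open>j\<close> is empty and on \<open>u j = 1\<close> all later pieces are. Player \<open>i\<close> spreads a
  unit weight over the pieces that are within \<open>\<tau>\<close> of her favourite; a zero of the differences of
  total weights makes the weight matrix doubly stochastic.\<close>

lemma approximate_envy_free_exists:
  assumes v: "\<And>i. i \<in> {1..n} \<Longrightarrow> valued_cake (v i)" and "1 \<le> n" and "0 < \<tau>0"
  obtains y \<sigma> where "y 0 = 0" "y n = 1" "\<And>j. j < n \<Longrightarrow> y j \<le> y (Suc j)" "bij_betw \<sigma> {1..n} {..<n}"
    "\<And>i j. i \<in> {1..n} \<Longrightarrow> j < n \<Longrightarrow> valued_cake.cdf (v i) (y (Suc j)) - valued_cake.cdf (v i) (y j)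
       \<le> valued_cake.cdf (v i) (y (Suc (\<sigma> i))) - valued_cake.cdf (v i) (y (\<sigma> i)) + \<tau>0"
proof -
  let ?K = "UNIV \<rightarrow> {0..1} :: (nat \<Rightarrow> real) set"
  have ne: "{..<n} \<noteq> {}" using \<open>1 \<le> n\<close> by (simp add: lessThan_empty_iff)
  \<comment> \<open>The bound \<open>1 / n\<close> makes empty pieces unacceptable: were one within
    less than \<open>\<tau>\<close> of the favourite, all pieces would be worth less than
    \<open>1 / n\<close>, yet they sum to 1.\<close>
  define \<tau> where "\<tau> = min \<tau>0 (1 / n)"
  have \<tau>: "0 < \<tau>" "\<tau> \<le> \<tau>0" "\<tau> \<le> 1 / n" using \<open>0 < \<tau>0\<close> \<open>1 \<le> n\<close> by (auto simp: \<tau>_def)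
  define Y where "Y u j = (if j < n then stick_breaking u j else 1)" for u j
  have Y01: "0 \<le> Y u j" "Y u j \<le> 1" if "u \<in> ?K" for u j
    using stick_breaking_bounds[OF that, of j] by (auto simp: Y_def)
  have YSuc: "Y u j \<le> Y u (Suc j)" if "u \<in> ?K" for u j
    using stick_breaking_Suc_ge[OF that, of j] stick_breaking_bounds[OF that, of j] by (auto simp: Y_def)
  have Y0: "Y u 0 = 0" "Y u n = 1" for u using \<open>1 \<le> n\<close> by (auto simp: Y_def)
  define F where "F i u j = valued_cake.cdf (v i) (Y u (Suc j)) - valued_cake.cdf (v i) (Y u j)" for i u j
  have F_sum: "(\<Sum>j<n. F i u j) = 1" if "i \<in> {1..n}" for i u
    using sum_lessThan_telescope[of "\<lambda>j. valued_cake.cdf (v i) (Y u j)" n] Y0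
      valued_cake.cdf_0[OF v[OF that]] valued_cake.cdf_1[OF v[OF that]] by (simp add: F_def)
  have contF: "continuous_on ?K (\<lambda>u. F i u j)" if i: "i \<in> {1..n}" for i j
  proof -
    have cY: "continuous_on ?K (\<lambda>u. Y u j)" for j
      unfolding Y_def by (cases "j < n") (auto intro: continuous_stick_breaking)
    have "continuous_on ?K (\<lambda>u. valued_cake.cdf (v i) (Y u j))" for j
      by (rule continuous_on_compose2[OF valued_cake.continuous_cdf[OF v[OF i]] cY]) (use Y01 in auto)
    then show ?thesis unfolding F_def by (intro continuous_intros)
  qed
  \<comment> \<open>A continuous weight that is positive exactly if piece \<open>j\<close> falls
    short of every other piece by less than \<open>\<tau>\<close>.\<close>
  define h where "h i u j = (\<Prod>l<n. max 0 (F i u j - F i u l + \<tau>))" for i u j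
  have h0: "0 \<le> h i u j" for i u j unfolding h_def by (intro prod_nonneg) auto
  have h_pos: "F i u l - \<tau> < F i u j" if "h i u j \<noteq> 0" "l < n" for i u j l
  proof (rule ccontr)
    assume "\<not> ?thesis"
    then have "h i u j = 0" unfolding h_def using that(2) by (intro prod_zero) (auto intro!: bexI[of _ l])
    then show False using that by simp
  qed
  have conth: "continuous_on ?K (\<lambda>u. h i u j)" if "i \<in> {1..n}" for i j
    unfolding h_def by (intro continuous_intros contF that)
  define H where "H i u = (\<Sum>j<n. h i u j)" for i u
  have H_pos: "0 < H i u" for i u
  proof -
    obtain j where j: "j < n" "\<And>l. l < n \<Longrightarrow> F i u l \<le> F i u j"
    proof -
      have "Max (F i u ` {..<n}) \<in> F i u ` {..<n}" using ne by (intro Max_in) auto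
      then obtain j where "j < n" "F i u j = Max (F i u ` {..<n})" by auto
      then show ?thesis using that[of j] by simp
    qed
    have "0 < h i u j" unfolding h_def
    proof (intro prod_pos)
      fix l assume "l \<in> {..<n}"
      then show "0 < max 0 (F i u j - F i u l + \<tau>)" using j(2)[of l] \<tau>(1) by auto
    qed
    also have "h i u j \<le> H i u" unfolding H_def using j(1) h0 by (intro member_le_sum) auto
    finally show ?thesis .
  qed
  define p where "p i u j = h i u j / H i u" for i u j
  have p0: "0 \<le> p i u j" for i u j using h0 H_pos[of i u] by (simp add: p_def)
  have p_sum: "(\<Sum>j<n. p i u j) = 1" for i u
    using H_pos[of i u] by (simp add: p_def H_def flip: sum_divide_distrib)
  have contp: "continuous_on ?K (\<lambda>u. p i u j)" if "i \<in> {1..n}" for i j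
    unfolding p_def H_def using H_pos[of i] that
    by (intro continuous_intros conth) (auto simp: H_def less_imp_neq[THEN not_sym])
  have p_empty: "p i u j = 0" if i: "i \<in> {1..n}" and "Y u (Suc j) = Y u j" for i u j
  proof (rule ccontr)
    assume "p i u j \<noteq> 0"
    then have "h i u j \<noteq> 0" by (auto simp: p_def)
    moreover have "F i u j = 0" using that by (simp add: F_def)
    ultimately have "F i u l < 1 / n" if "l < n" for l
      using h_pos[of i u j l] that \<tau>(3) by simp
    then have "(\<Sum>j<n. F i u j) < (\<Sum>j<n. 1 / n)" using ne by (intro sum_strict_mono) auto
    then show False using F_sum[OF i] \<open>1 \<le> n\<close> by simp
  qed
  define P where "P u j = (\<Sum>i\<in>{1..n}. p i u j)" for u j
  have P0: "0 \<le> P u j" for u j unfolding P_def using p0 by (intro sum_nonneg)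
  have P_empty: "P u j = 0" if "Y u (Suc j) = Y u j" for u j
    unfolding P_def using p_empty that by simp
  have P_sum: "(\<Sum>j<n. P u j) = n" for u
    unfolding P_def by (subst sum.swap) (simp add: p_sum)
  \<comment> \<open>Up to a positive factor, the mean total weight of the later pieces minus that of
    piece \<open>j\<close>. If all these vanish, the totals are equal, as seen from the last piece
    backwards.\<close>
  define g where "g u j = (\<Sum>l\<in>{Suc j..<n}. P u l) - real (n - Suc j) * P u j" for u j
  obtain u where u: "u \<in> ?K" and gu: "\<And>j. j < n - 1 \<Longrightarrow> g u j = 0"
  proof (rule poincare_miranda[of "n - 1" g])
    show "continuous_on ?K (\<lambda>u. g u j)" for j
      unfolding g_def P_def by (intro continuous_intros contp)
    fix u j assume u: "u \<in> ?K" and j: "j < n - 1"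
    show "0 \<le> g u j" if "u j = 0"
    proof -
      have "Suc j < n" using j by simp
      then have "Y u (Suc j) = Y u j" using that by (simp add: Y_def)
      then have "P u j = 0" by (rule P_empty)
      then show ?thesis unfolding g_def using P0 by (simp add: sum_nonneg)
    qed
    show "g u j \<le> 0" if "u j = 1"
    proof -
      have "stick_breaking u (Suc j) = 1" using that by simp
      then have "Y u l = 1" if "Suc j \<le> l" for l
        using stick_breaking_full[OF _ that] by (simp add: Y_def)
      then have "P u l = 0" if "Suc j \<le> l" for l using that by (intro P_empty) simp
      then have "(\<Sum>l\<in>{Suc j..<n}. P u l) = 0" by (intro sum.neutral) auto
      then show ?thesis unfolding g_def using P0[of u j] by simp
    qed
  qed blast
  have P_eq: "P u j = P u (n - 1)" if "j < n" for j
    using that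
  proof (induction "n - 1 - j" arbitrary: j rule: less_induct)
    case less
    show ?case
    proof (cases "j = n - 1")
      case False
      then have j: "j < n - 1" using less.prems by simp
      have "P u l = P u (n - 1)" if "l \<in> {Suc j..<n}" for l
        using that less.prems by (intro less.hyps) auto
      then have "(\<Sum>l\<in>{Suc j..<n}. P u l) = real (n - Suc j) * P u (n - 1)" by simp
      then have "real (n - Suc j) * P u (n - 1) = real (n - Suc j) * P u j"
        using gu[OF j] by (simp add: g_def)
      moreover have "real (n - Suc j) \<noteq> 0" using j by simp
      ultimately show ?thesis by (metis mult_left_cancel)
    qed simp
  qed
  have P1: "P u j = 1" if "j < n" for j
  proof -
    have "(\<Sum>j<n. P u j) = (\<Sum>j<n. P u (n - 1))" by (intro sum.cong refl P_eq) simp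
    then have "(\<Sum>j<n. P u j) = n * P u (n - 1)" by simp
    then have "P u (n - 1) = 1" using P_sum[of u] \<open>1 \<le> n\<close> by simp
    then show ?thesis using P_eq[OF that] by simp
  qed
  define A where "A i = {j. j < n \<and> p i u j \<noteq> 0}" for i
  have "\<exists>\<sigma>. inj_on \<sigma> {1..n} \<and> (\<forall>i\<in>{1..n}. \<sigma> i \<in> A i)"
  proof (rule hall_marriage)
    fix J assume J: "J \<subseteq> {1..n}"
    then have finJ: "finite J" using finite_subset by blast
    have UA: "(\<Union>i\<in>J. A i) \<subseteq> {..<n}" by (auto simp: A_def)
    then have finU: "finite (\<Union>i\<in>J. A i)" using finite_subset by blast
    \<comment> \<open>Double counting: the players of \<open>J\<close> spend all their weight on
      pieces acceptable to them, and each piece receives total weight 1 from all players.\<close>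
    have "real (card J) = (\<Sum>i\<in>J. \<Sum>j<n. p i u j)" by (simp add: p_sum)
    also have "\<dots> = (\<Sum>i\<in>J. \<Sum>j\<in>(\<Union>i\<in>J. A i). p i u j)"
      using UA by (intro sum.cong refl sum.mono_neutral_right) (auto simp: A_def)
    also have "\<dots> = (\<Sum>j\<in>(\<Union>i\<in>J. A i). \<Sum>i\<in>J. p i u j)" by (rule sum.swap)
    also have "\<dots> \<le> (\<Sum>j\<in>(\<Union>i\<in>J. A i). P u j)"
      unfolding P_def using J p0 by (intro sum_mono sum_mono2) auto
    also have "\<dots> = real (card (\<Union>i\<in>J. A i))" using P1 UA by (simp add: subset_iff)
    finally show "card J \<le> card (\<Union>i\<in>J. A i)" by simp
  qed (auto simp: A_def)
  then obtain \<sigma> where \<sigma>: "inj_on \<sigma> {1..n}" "\<And>i. i \<in> {1..n} \<Longrightarrow> \<sigma> i \<in> A i" by blast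
  have "\<sigma> ` {1..n} \<subseteq> {..<n}" using \<sigma>(2) by (auto simp: A_def)
  moreover have "card (\<sigma> ` {1..n}) = card {..<n}" using \<sigma>(1) by (simp add: card_image)
  ultimately have "\<sigma> ` {1..n} = {..<n}" by (intro card_subset_eq) auto
  then have bij: "bij_betw \<sigma> {1..n} {..<n}" using \<sigma>(1) by (simp add: bij_betw_def)
  show ?thesis
  proof (rule that[of "Y u" \<sigma>])
    fix i j assume i: "i \<in> {1..n}" and j: "j < n"
    have "h i u (\<sigma> i) \<noteq> 0" using \<sigma>(2)[OF i] by (auto simp: A_def p_def)
    from h_pos[OF this j] show "valued_cake.cdf (v i) (Y u (Suc j)) - valued_cake.cdf (v i) (Y u j)
       \<le> valued_cake.cdf (v i) (Y u (Suc (\<sigma> i))) - valued_cake.cdf (v i) (Y u (\<sigma> i)) + \<tau>0"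
      using \<tau>(2) by (simp add: F_def)
  qed (use Y0 YSuc[OF u] bij in auto)
qed

section \<open>Connected allocations\<close>

text \<open>Counting interior cuts copes with coinciding ones, whose empty intervals are just
  skipped. Leaving out \<open>z n\<close> keeps the point 1 in the last interval.\<close>

definition interval_index :: "(nat \<Rightarrow> real) \<Rightarrow> nat \<Rightarrow> real \<Rightarrow> nat" where
  "interval_index z n x = card {j \<in> {1..<n}. z j \<le> x}"

locale cut_sequence =
  fixes z :: "nat \<Rightarrow> real" and n :: nat
  assumes n: "1 \<le> n" and z0: "z 0 = 0" and zn: "z n = 1"
    and z_Suc: "\<And>j. j < n \<Longrightarrow> z j \<le> z (Suc j)"
begin

lemma z_mono: "i \<le> j \<Longrightarrow> j \<le> n \<Longrightarrow> z i \<le> z j"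
  by (induction j) (auto simp: le_Suc_eq intro: order.trans[OF _ z_Suc])

lemma z_bounds: "j \<le> n \<Longrightarrow> 0 \<le> z j \<and> z j \<le> 1"
  using z_mono[of 0 j] z_mono[of j n] z0 zn by simp

lemma interval_index_less: "interval_index z n x < n"
proof -
  have "card {j \<in> {1..<n}. z j \<le> x} \<le> card {1..<n}" by (rule card_mono) auto
  then show ?thesis using n by (simp add: interval_index_def)
qed

lemma le_interval_index_iff:
  assumes "j \<in> {1..<n}"
  shows "z j \<le> x \<longleftrightarrow> j \<le> interval_index z n x"
proof
  assume "z j \<le> x"
  have "{1..j} \<subseteq> {j \<in> {1..<n}. z j \<le> x}"
  proof
    fix i assume "i \<in> {1..j}"
    then show "i \<in> {j \<in> {1..<n}. z j \<le> x}"
      using z_mono[of i j] \<open>z j \<le> x\<close> assms by auto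
  qed
  then have "card {1..j} \<le> interval_index z n x"
    unfolding interval_index_def by (intro card_mono) auto
  then show "j \<le> interval_index z n x" by simp
next
  assume j: "j \<le> interval_index z n x"
  show "z j \<le> x"
  proof (rule ccontr)
    assume "\<not> z j \<le> x"
    have "{i \<in> {1..<n}. z i \<le> x} \<subseteq> {1..<j}"
    proof
      fix i assume i: "i \<in> {i \<in> {1..<n}. z i \<le> x}"
      have "\<not> j \<le> i" using z_mono[of j i] i \<open>\<not> z j \<le> x\<close> by auto
      then show "i \<in> {1..<j}" using i by auto
    qed
    then have "interval_index z n x \<le> card {1..<j}"
      unfolding interval_index_def by (intro card_mono) auto
    also have "card {1..<j} < j" using assms by simp
    finally show False using j by simp
  qed
qed

lemma step_interval_index: "step (z ` {1..<n}) (interval_index z n)"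
  unfolding step_def
proof (intro conjI allI impI)
  fix x y :: real assume xy: "x \<le> y" "z ` {1..<n} \<inter> {x<..y} = {}"
  have "z j \<le> x \<longleftrightarrow> z j \<le> y" if "j \<in> {1..<n}" for j using xy that by force
  then show "interval_index z n x = interval_index z n y"
    unfolding interval_index_def by (metis (no_types, lifting))
qed simp

lemma interval_index_mono: "x \<le> y \<Longrightarrow> interval_index z n x \<le> interval_index z n y"
  unfolding interval_index_def by (intro card_mono) auto

lemma is_interval_class: "is_interval {x \<in> {0..1}. interval_index z n x = j}"
  unfolding is_interval_1
proof (intro ballI allI impI)
  fix a b x assume "a \<in> {x \<in> {0..1}. interval_index z n x = j}" "b \<in> {x \<in> {0..1}. interval_index z n x = j}"
    and "a \<le> x \<and> x \<le> b"
  then show "x \<in> {x \<in> {0..1}. interval_index z n x = j}"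
    using interval_index_mono[of a x] interval_index_mono[of x b] by simp
qed

lemma class_value:
  assumes "valued_cake d" "j < n"
  shows "piece_value d {x \<in> {0..1}. interval_index z n x = j} = valued_cake.cdf d (z (Suc j)) - valued_cake.cdf d (z j)"
proof -
  interpret valued_cake d by fact
  let ?S = "{x \<in> {0..1}. interval_index z n x = j}"
  have S: "?S \<in> sets borel" using step_class_borel[OF step_interval_index] by simp
  have b: "0 \<le> z j" "z j \<le> z (Suc j)" "z (Suc j) \<le> 1"
    using z_bounds[of j] z_bounds[of "Suc j"] z_Suc assms(2) by auto
  have "{z j<..<z (Suc j)} \<subseteq> ?S"
  proof
    fix x assume x: "x \<in> {z j<..<z (Suc j)}"
    have "j \<le> interval_index z n x"
      using le_interval_index_iff[of j x] x assms(2) by (cases "j = 0") auto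
    moreover have "\<not> Suc j \<le> interval_index z n x"
      using le_interval_index_iff[of "Suc j" x] interval_index_less[of x] x by (cases "Suc j < n") auto
    ultimately show "x \<in> ?S" using x b by auto
  qed
  moreover have "?S \<subseteq> {z j..z (Suc j)}"
  proof
    fix x assume x: "x \<in> ?S"
    have "z j \<le> x" using le_interval_index_iff[of j x] x assms(2) z0 by (cases "j = 0") auto
    moreover have "x \<le> z (Suc j)"
    proof (cases "Suc j < n")
      case True
      then show ?thesis using le_interval_index_iff[of "Suc j" x] x by simp
    next
      case False
      then have "Suc j = n" using assms(2) by simp
      then show ?thesis using x zn by simp
    qed
    ultimately show "x \<in> {z j..z (Suc j)}" by simp
  qed
  ultimately have "cake_value d ?S = cdf (z (Suc j)) - cdf (z j)"
    by (intro measure_interval b S)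
  moreover have "cake_value d ?S = piece_value d ?S"
    using S by (intro measure_eq_piece_value) auto
  ultimately show ?thesis by simp
qed

definition allocation :: "(nat \<Rightarrow> nat) \<Rightarrow> nat \<Rightarrow> real set" where
  "allocation \<sigma> i = {x \<in> {0..1}. interval_index z n x = \<sigma> i}"

lemma allocation:
  assumes \<sigma>: "bij_betw \<sigma> {1..n} {..<n}"
  shows "cake_partition n (allocation \<sigma>)" "connected_pieces n (allocation \<sigma>)"
    "\<forall>i\<in>{1..n}. frontier (allocation \<sigma> i) \<subseteq> {0, 1} \<union> z ` {1..<n}"
    "\<And>i d. valued_cake d \<Longrightarrow> i \<in> {1..n} \<Longrightarrow>
      piece_value d (allocation \<sigma> i) = valued_cake.cdf d (z (Suc (\<sigma> i))) - valued_cake.cdf d (z (\<sigma> i))"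
proof -
  have \<sigma>_less: "\<sigma> i < n" if "i \<in> {1..n}" for i using \<sigma> that by (auto simp: bij_betw_def)
  show "connected_pieces n (allocation \<sigma>)"
    unfolding connected_pieces_def allocation_def using is_interval_class by blast
  show "\<forall>i\<in>{1..n}. frontier (allocation \<sigma> i) \<subseteq> {0, 1} \<union> z ` {1..<n}"
  proof
    fix i
    show "frontier (allocation \<sigma> i) \<subseteq> {0, 1} \<union> z ` {1..<n}"
      using step_frontier[OF step_interval_index, of "\<lambda>a. a = \<sigma> i"] by (simp add: allocation_def)
  qed
  show "piece_value d (allocation \<sigma> i) = valued_cake.cdf d (z (Suc (\<sigma> i))) - valued_cake.cdf d (z (\<sigma> i))"
    if "valued_cake d" "i \<in> {1..n}" for i d
    unfolding allocation_def by (rule class_value[OF that(1) \<sigma>_less[OF that(2)]])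
  show "cake_partition n (allocation \<sigma>)"
    unfolding cake_partition_def
  proof (intro conjI ballI)
    show "is_piece (allocation \<sigma> i)" for i
      unfolding allocation_def using step_is_piece[OF step_interval_index, of "\<lambda>a. a = \<sigma> i"] by simp
    show "disjoint_family_on (allocation \<sigma>) {1..n}"
      unfolding disjoint_family_on_def
    proof (intro ballI impI equals0I)
      fix i j x assume "i \<in> {1..n}" "j \<in> {1..n}" "i \<noteq> j" "x \<in> allocation \<sigma> i \<inter> allocation \<sigma> j"
      then show False using inj_onD[OF bij_betw_imp_inj_on[OF \<sigma>], of i j] by (simp add: allocation_def)
    qed
    show "(\<Union>j\<in>{1..n}. allocation \<sigma> j) = {0..1}"
    proof (intro set_eqI iffI)
      fix x :: real assume x: "x \<in> {0..1}"
      have "interval_index z n x \<in> \<sigma> ` {1..n}"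
        using interval_index_less \<sigma> by (simp add: bij_betw_def)
      then show "x \<in> (\<Union>j\<in>{1..n}. allocation \<sigma> j)" using x by (auto simp: allocation_def)
    qed (auto simp: allocation_def)
  qed
qed

end

section \<open>Approximate envy-freeness\<close>

lemma grid_above_cell:
  assumes d: "valued_cake d" and G: "grid G" and x: "x \<in> {0..1}" and "0 \<le> \<delta>"
    and cell: "\<And>e. e \<in> G \<Longrightarrow> e < 1 \<Longrightarrow> valued_cake.cdf d (grid_next G e) - valued_cake.cdf d e \<le> \<delta>"
  shows "valued_cake.cdf d (grid_above G x) - \<delta> \<le> valued_cake.cdf d x"
proof (cases "x \<in> G")
  case True
  then have "grid_above G x = x" using grid_above[OF G, of x] x by (intro antisym) auto
  then show ?thesis using \<open>0 \<le> \<delta>\<close> by simp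
next
  case False
  interpret valued_cake d by fact
  have "x \<noteq> 1" using False G by (auto simp: grid_def)
  then have x1: "x < 1" "0 \<le> x" using x by auto
  note b = grid_below[OF G x1(2)] and lt = grid_below_less_next[OF G x1(2,1)]
  let ?e = "grid_below G x"
  have nx: "grid_next G ?e \<in> G" using grid_next[OF G lt(1)] by simp
  have "grid_above G x \<le> grid_next G ?e" using grid_above(3)[OF G _ nx] lt(2) x by auto
  then have "cdf (grid_above G x) \<le> cdf (grid_next G ?e)"
    using grid_bounds[OF G nx] by (intro cdf_mono) auto
  moreover have "cdf ?e \<le> cdf x" using b x by (intro cdf_mono) auto
  ultimately show ?thesis using cell[OF b(1) lt(1)] by simp
qed

lemma envy_free_trivial:
  assumes "1 \<le> n" "1 \<le> \<epsilon>" "0 \<le> q"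
  shows "rw_computable n n q (\<lambda>v A. envy_free \<epsilon> n v A \<and> connected_pieces n A)"
proof (rule rw_computableI)
  let ?z = "\<lambda>j. if j = 0 then 0 else 1 :: real" and ?\<sigma> = "\<lambda>i :: nat. i - 1"
  interpret cut_sequence ?z n by unfold_locales (use assms in auto)
  have \<sigma>: "bij_betw ?\<sigma> {1..n} {..<n}"
    by (rule bij_betw_byWitness[of _ Suc]) auto
  note A = allocation[OF \<sigma>]
  have "envy_free \<epsilon> n (fst w) (allocation ?\<sigma>)" if w: "w \<in> worlds n" for w
    unfolding envy_free_def
  proof (intro ballI)
    fix i j assume i: "i \<in> {1..n}" and j: "j \<in> {1..n}"
    have d: "valued_cake (fst w i)" by (rule worlds_valued_cake[OF w i])
    interpret d: valued_cake "fst w i" by (rule d)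
    show "piece_value (fst w i) (allocation ?\<sigma> j) - \<epsilon> \<le> piece_value (fst w i) (allocation ?\<sigma> i)"
      using A(4)[OF d i] A(4)[OF d j] assms(2) by auto
  qed
  moreover have "\<forall>i\<in>{1..n}. frontier (allocation ?\<sigma> i) \<subseteq> {0, 1} \<union> {}" using A(3) by fastforce
  ultimately show "achievable n {} 0 (worlds n) (\<lambda>w D A. cake_partition n A \<and>
      (\<forall>j\<in>{1..n}. frontier (A j) \<subseteq> {0, 1} \<union> D) \<and> envy_free \<epsilon> n (fst w) A \<and> connected_pieces n A)"
    using A(1,2) by (intro achievable_output[where A = "allocation ?\<sigma>"]) auto
qed (use assms in simp)

lemma rw_computable_envy_free:
  assumes "1 \<le> n" "0 < \<epsilon>"
  shows "rw_computable n n (9 * (real n / \<epsilon>)) (\<lambda>v A. envy_free \<epsilon> n v A \<and> connected_pieces n A)"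
proof (cases "\<epsilon> < 1")
  case False
  then show ?thesis using assms by (intro envy_free_trivial) auto
next
  case True
  \<comment> \<open>Moving a cut to the right and changing the world cost at most
    \<open>\<delta>\<close> each, so a piece is off by at most \<open>3 * \<delta>\<close> and a
    comparison of two pieces by \<open>6 * \<delta>\<close>. The existence lemma allows one more,
    and \<open>7 * \<delta> < \<epsilon>\<close>.\<close>
  define \<delta> where "\<delta> = \<epsilon> / 8"
  have \<delta>: "0 < \<delta>" using assms by (simp add: \<delta>_def)
  let ?L = "{l :: nat. 0 \<le> real l * \<delta> \<and> real l * \<delta> \<le> 1}"
  define Q where "Q = {1..n} \<times> (\<lambda>l. real l * \<delta>) ` ?L"
  note cm = card_multiples[OF \<delta>, of 0 1]
  have finQ: "finite Q" "Q \<subseteq> {1..n} \<times> {0..1}"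
    unfolding Q_def using cm(1) \<delta> by auto
  have "card Q \<le> n * card ?L"
    unfolding Q_def card_cartesian_product using card_image_le[OF cm(1), of "\<lambda>l. real l * \<delta>"] by simp
  then have "real (card Q) \<le> real n * real (card ?L)" by (metis of_nat_le_iff of_nat_mult)
  also have "\<dots> \<le> real n * (9 / \<epsilon>)"
  proof (intro mult_left_mono)
    have "real (card ?L) \<le> 1 / \<delta> + 1" using cm(2) by simp
    also have "\<dots> \<le> 9 / \<epsilon>" using True assms by (simp add: \<delta>_def field_simps)
    finally show "real (card ?L) \<le> 9 / \<epsilon>" .
  qed simp
  finally have cardQ: "real (card Q) \<le> 9 * (real n / \<epsilon>)" by (simp add: mult.commute)
  let ?F = "\<lambda>w D A. cake_partition n A \<and> (\<forall>j\<in>{1..n}. frontier (A j) \<subseteq> {0, 1} \<union> D) \<and>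
      envy_free \<epsilon> n (fst w) A \<and> connected_pieces n A"
  have "achievable n {} (card Q + 0) (worlds n) ?F"
  proof (rule achievable_cuts[OF finQ])
    fix w1 assume w1: "w1 \<in> worlds n"
    let ?D = "{} \<union> (\<lambda>(i, \<alpha>). snd w1 i \<alpha>) ` Q"
    let ?S = "{w \<in> worlds n. \<forall>(i, \<alpha>)\<in>Q. snd w i \<alpha> = snd w1 i \<alpha>}"
    have agree: "snd w i \<alpha> = snd w1 i \<alpha>" if "w \<in> ?S" "(i, \<alpha>) \<in> Q" for w i \<alpha>
      using that by blast
    have Q_mem: "(i, real l * \<delta>) \<in> Q" if "i \<in> {1..n}" "real l * \<delta> \<le> 1" for i l
      using that \<delta> unfolding Q_def by auto
    define G where "G = {0, 1} \<union> ?D"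
    have "(\<lambda>(i, \<alpha>). snd w1 i \<alpha>) ` Q \<subseteq> {0..1}"
    proof clarify
      fix i \<alpha> assume "(i, \<alpha>) \<in> Q"
      then show "snd w1 i \<alpha> \<in> {0..1}" using finQ(2) worlds_cut(1)[OF w1, of i \<alpha>] by auto
    qed
    then have G: "grid G" unfolding G_def grid_def using finQ(1) by auto
    have osc: "cdf_of w i x - \<delta> \<le> cdf_of w' i x"
      if w: "w \<in> ?S" "w' \<in> ?S" and i: "i \<in> {1..n}" and x: "x \<in> {0..1}" for w w' i x
    proof -
      have wn: "w \<in> worlds n" "w' \<in> worlds n" using w by auto
      show ?thesis
      proof (rule agreeing_worlds_close[OF wn i x \<delta>])
        fix l :: nat assume "real l * \<delta> \<in> {0..1}"
        then show "snd w i (real l * \<delta>) = snd w' i (real l * \<delta>)"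
          using agree[OF w(1)] agree[OF w(2)] Q_mem[OF i] by simp
      qed
    qed
    have cell: "cdf_of w1 i (grid_next G e) - cdf_of w1 i e \<le> \<delta>"
      if i: "i \<in> {1..n}" and e: "e \<in> G" "e < 1" for i e
    proof (rule cells_small[OF w1 i G e \<delta>])
      fix l :: nat assume "real l * \<delta> < cdf_of w1 i (grid_next G e)"
      moreover have "grid_next G e \<le> 1" using grid_bounds[OF G] grid_next[OF G e(2)] by blast
      ultimately have "real l * \<delta> \<le> 1"
        using valued_cake.cdf_bounds(2)[OF worlds_valued_cake[OF w1 i], of "grid_next G e"] by simp
      from Q_mem[OF i this] show "snd w1 i (real l * \<delta>) \<in> G" unfolding G_def by force
    qed
    obtain y \<sigma> where y: "y 0 = 0" "y n = 1" "\<And>j. j < n \<Longrightarrow> y j \<le> y (Suc j)" and \<sigma>: "bij_betw \<sigma> {1..n} {..<n}"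
      and ef: "\<And>i j. i \<in> {1..n} \<Longrightarrow> j < n \<Longrightarrow> cdf_of w1 i (y (Suc j)) - cdf_of w1 i (y j)
       \<le> cdf_of w1 i (y (Suc (\<sigma> i))) - cdf_of w1 i (y (\<sigma> i)) + \<delta>"
      by (rule approximate_envy_free_exists[of n "fst w1" \<delta>]) (use worlds_valued_cake[OF w1] assms(1) \<delta> in blast)+
    interpret Y: cut_sequence y n by unfold_locales (use assms(1) y in auto)
    define z where "z j = grid_above G (y j)" for j
    have zG: "z j \<in> G" "y j \<le> z j" if "j \<le> n" for j
      using grid_above[OF G, of "y j"] Y.z_bounds[OF that] by (auto simp: z_def)
    interpret Z: cut_sequence z n
    proof
      have G01: "0 \<in> G" "1 \<in> G" using G by (auto simp: grid_def)
      show "z 0 = 0" using zG[of 0] grid_above(3)[OF G, of "y 0" 0] G01 y(1) by (simp add: z_def)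
      show "z n = 1" using zG[of n] grid_above(3)[OF G, of "y n" 1] G01 y(2) by (simp add: z_def)
      show "z j \<le> z (Suc j)" if "j < n" for j
        using grid_above(3)[OF G, of "y j" "z (Suc j)"] zG[of "Suc j"] y(3)[OF that] Y.z_bounds[of j] that
        by (auto simp: z_def)
    qed (rule assms(1))
    have near: "cdf_of w i (z j) \<le> cdf_of w1 i (y j) + 2 * \<delta>" "cdf_of w1 i (y j) - \<delta> \<le> cdf_of w i (z j)"
      if w: "w \<in> ?S" and i: "i \<in> {1..n}" and j: "j \<le> n" for w i j
    proof -
      have w1S: "w1 \<in> ?S" using w1 by auto
      have y01: "y j \<in> {0..1}" using Y.z_bounds[OF j] by simp
      have z01: "z j \<in> {0..1}" using Z.z_bounds[OF j] by simp
      have c: "valued_cake (fst w1 i)" by (rule worlds_valued_cake[OF w1 i])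
      have "cdf_of w1 i (z j) - \<delta> \<le> cdf_of w1 i (y j)"
        unfolding z_def by (rule grid_above_cell[OF c G y01]) (use \<delta> cell[OF i] in auto)
      then show "cdf_of w i (z j) \<le> cdf_of w1 i (y j) + 2 * \<delta>"
        using osc[OF w w1S i z01] by simp
      have "cdf_of w1 i (y j) \<le> cdf_of w1 i (z j)"
        using valued_cake.cdf_mono[OF c zG(2)[OF j]] z01 by simp
      then show "cdf_of w1 i (y j) - \<delta> \<le> cdf_of w i (z j)"
        using osc[OF w1S w i z01] by simp
    qed
    note A = Z.allocation[OF \<sigma>]
    have ef': "envy_free \<epsilon> n (fst w) (Z.allocation \<sigma>)" if w: "w \<in> ?S" for w
      unfolding envy_free_def
    proof (intro ballI)
      fix i j assume i: "i \<in> {1..n}" and j: "j \<in> {1..n}"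
      have d: "valued_cake (fst w i)" by (rule worlds_valued_cake[OF _ i]) (use w in simp)
      have s: "\<sigma> i < n" "\<sigma> j < n" using \<sigma> i j by (auto simp: bij_betw_def)
      have "cdf_of w i (z (Suc (\<sigma> j))) - cdf_of w i (z (\<sigma> j)) \<le> cdf_of w1 i (y (Suc (\<sigma> j))) - cdf_of w1 i (y (\<sigma> j)) + 3 * \<delta>"
        using near(1)[OF w i, of "Suc (\<sigma> j)"] near(2)[OF w i, of "\<sigma> j"] s by simp
      moreover have "cdf_of w1 i (y (Suc (\<sigma> i))) - cdf_of w1 i (y (\<sigma> i)) \<le> cdf_of w i (z (Suc (\<sigma> i))) - cdf_of w i (z (\<sigma> i)) + 3 * \<delta>"
        using near(2)[OF w i, of "Suc (\<sigma> i)"] near(1)[OF w i, of "\<sigma> i"] s by simp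
      ultimately show "piece_value (fst w i) (Z.allocation \<sigma> j) - \<epsilon> \<le> piece_value (fst w i) (Z.allocation \<sigma> i)"
        unfolding A(4)[OF d i] A(4)[OF d j] using ef[OF i s(2)] assms(2) by (simp add: \<delta>_def)
    qed
    have fr: "\<forall>j\<in>{1..n}. frontier (Z.allocation \<sigma> j) \<subseteq> {0, 1} \<union> ?D"
    proof
      fix j assume "j \<in> {1..n}"
      then have "frontier (Z.allocation \<sigma> j) \<subseteq> {0, 1} \<union> z ` {1..<n}" using A(3) by blast
      moreover have "z ` {1..<n} \<subseteq> {0, 1} \<union> ?D"
        unfolding G_def[symmetric] using zG(1) by auto
      ultimately show "frontier (Z.allocation \<sigma> j) \<subseteq> {0, 1} \<union> ?D" by blast
    qed
    show "achievable n ?D 0 ?S ?F"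
      by (rule achievable_output[where A = "Z.allocation \<sigma>"]) (intro conjI A(1,2) fr ef')
  qed
  then show ?thesis using cardQ by (intro rw_computableI) auto
qed

section \<open>Evaluation queries at known points\<close>

lemma cdf_of_eq:
  assumes "w \<in> worlds n" "i \<in> {1..n}"
  shows "cdf_of w i y = piece_value (fst w i) {0..y}"
  by (rule valued_cake.cdf_def[OF worlds_valued_cake[OF assms]])

text \<open>At the ends of the cake, which need not be cut points, the values 0 and 1 are the same
  in all worlds, and no query is asked.\<close>

lemma achievable_eval:
  assumes i: "i \<in> {1..n}" and y: "y \<in> D \<union> {0, 1}" and S: "S \<subseteq> worlds n"
    and *: "\<And>\<beta>. achievable n D q {w \<in> S. cdf_of w i y = \<beta>} F"
  shows "achievable n D (Suc q) S F"
proof (cases "y \<in> D")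
  case True
  show ?thesis
  proof (rule achievable_eval_cut_point[OF i True])
    fix \<beta>
    have "{w \<in> S. piece_value (fst w i) {0..y} = \<beta>} = {w \<in> S. cdf_of w i y = \<beta>}"
      using cdf_of_eq[OF subsetD[OF S] i] by auto
    then show "achievable n D q {w \<in> S. piece_value (fst w i) {0..y} = \<beta>} F" using * by simp
  qed
next
  case False
  then have y01: "y = 0 \<or> y = 1" using y by auto
  have "cdf_of w i y = y" if "w \<in> S" for w
  proof -
    interpret valued_cake "fst w i" by (rule worlds_valued_cake[OF subsetD[OF S that] i])
    show ?thesis using y01 by auto
  qed
  then have "{w \<in> S. cdf_of w i y = y} = S" by auto
  then show ?thesis using *[of y] by (intro achievable_mono[of n D q S F "Suc q" S]) auto
qed

lemma achievable_empty: "achievable n D q {} F"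
  by (rule achievable_output) simp

section \<open>Proportional allocations by divide and conquer\<close>

fun even_paz_cost :: "nat \<Rightarrow> nat" where
  "even_paz_cost m = (if m \<le> 1 then 0 else m + even_paz_cost (m div 2) + even_paz_cost (m - m div 2))"

declare even_paz_cost.simps [simp del]

text \<open>Each half has at most \<open>2 * m / 3\<close> players, so its logarithm is smaller by
  at least \<open>1 / 3\<close>, by \<open>ln x \<le> x - 1\<close>. With the factor 3 this pays
  exactly for the \<open>m\<close> queries of the current level.\<close>

lemma even_paz_cost_le: "1 \<le> m \<Longrightarrow> real (even_paz_cost m) \<le> 3 * (real m * ln (real m))"
proof (induction m rule: less_induct)
  case (less m)
  show ?case
  proof (cases "m = 1")
    case True
    then show ?thesis by (simp add: even_paz_cost.simps)
  next
    case False
    then have m: "2 \<le> m" using less.prems by simp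
    let ?h = "m div 2" and ?g = "m - m div 2"
    have b: "1 \<le> ?h" "1 \<le> ?g" "?h < m" "?g < m" "3 * ?h \<le> 2 * m" "3 * ?g \<le> 2 * m" using m by auto
    have half: "real k * ln (real k) \<le> real k * (ln (real m) - 1 / 3)" if k: "1 \<le> k" "3 * k \<le> 2 * m" for k
    proof (intro mult_left_mono)
      have "real k \<le> real m * (2 / 3)" using k(2) by (simp add: of_nat_mono[of "3 * k" "2 * m", simplified])
      then have "ln (real k) \<le> ln (real m * (2 / 3))" using k m by (intro ln_mono) auto
      also have "\<dots> = ln (real m) + ln (2 / 3)" using m by (intro ln_mult_pos) auto
      also have "ln (2 / 3 :: real) \<le> 2 / 3 - 1" by (rule ln_le_minus_one) simp
      finally show "ln (real k) \<le> ln (real m) - 1 / 3" by simp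
    qed simp
    have "real (even_paz_cost m) = m + real (even_paz_cost ?h) + real (even_paz_cost ?g)"
      using m by (subst even_paz_cost.simps) simp
    also have "\<dots> \<le> m + 3 * (real ?h * (ln (real m) - 1 / 3)) + 3 * (real ?g * (ln (real m) - 1 / 3))"
      using less.IH[OF b(3,1)] less.IH[OF b(4,2)] half[OF b(1,5)] half[OF b(2,6)] by linarith
    also have "\<dots> = m + 3 * ((real ?h + real ?g) * (ln (real m) - 1 / 3))" by (simp add: algebra_simps)
    also have "real ?h + real ?g = real m" by (simp add: of_nat_diff)
    also have "m + 3 * (real m * (ln (real m) - 1 / 3)) = 3 * (real m * ln (real m))" by (simp add: algebra_simps)
    finally show ?thesis .
  qed
qed

text \<open>A segment between \<open>a\<close> and \<open>b\<close> whose left neighbours number \<open>s\<close>. Normalising by \<open>s / n\<close> and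
  \<open>(s + m) / n\<close> makes evaluation queries superfluous.\<close>

definition even_paz_cuts ::
    "nat \<Rightarrow> nat \<Rightarrow> real \<Rightarrow> real \<Rightarrow> nat list \<Rightarrow> (nat \<Rightarrow> real) \<Rightarrow> real set \<Rightarrow> world set \<Rightarrow> bool" where
  "even_paz_cuts n s a b ys p D S \<longleftrightarrow> p 0 = a \<and> p (length ys) = b \<and>
     (\<forall>j<length ys. p j \<le> p (Suc j)) \<and> (\<forall>j\<le>length ys. p j \<in> D \<union> {0, 1}) \<and>
     (\<forall>w\<in>S. \<forall>j<length ys. cdf_of w (ys ! j) (p j) \<le> real (s + j) / real n \<and>
        real (s + Suc j) / real n \<le> cdf_of w (ys ! j) (p (Suc j)))"

lemma even_paz_cuts_append:
  assumes 1: "even_paz_cuts n s a c ys1 p1 D1 S1" and 2: "even_paz_cuts n (s + length ys1) c b ys2 p2 D2 S2"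
    and sub: "D1 \<subseteq> D2" "S2 \<subseteq> S1"
  shows "even_paz_cuts n s a b (ys1 @ ys2) (\<lambda>j. if j \<le> length ys1 then p1 j else p2 (j - length ys1)) D2 S2"
    (is "even_paz_cuts n s a b ?ys ?p D2 S2")
proof -
  let ?h = "length ys1"
  have p_right: "?p (?h + j) = p2 j" for j
    using 1 2 by (cases j) (auto simp: even_paz_cuts_def)
  have p_left: "?p j = p1 j" if "j \<le> ?h" for j using that by simp
  have "?p j \<le> ?p (Suc j) \<and> (\<forall>w\<in>S2. cdf_of w (?ys ! j) (?p j) \<le> real (s + j) / real n \<and>
        real (s + Suc j) / real n \<le> cdf_of w (?ys ! j) (?p (Suc j)))" if j: "j < length ?ys" for j
  proof (cases "j < ?h")
    case True
    then have eqs: "?p j = p1 j" "?p (Suc j) = p1 (Suc j)" "?ys ! j = ys1 ! j" by (auto simp: nth_append)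
    have "p1 j \<le> p1 (Suc j)"
      "\<forall>w\<in>S1. cdf_of w (ys1 ! j) (p1 j) \<le> real (s + j) / real n \<and>
        real (s + Suc j) / real n \<le> cdf_of w (ys1 ! j) (p1 (Suc j))"
      using 1 True unfolding even_paz_cuts_def by blast+
    then show ?thesis unfolding eqs using sub(2) by blast
  next
    case False
    then obtain l where l: "j = ?h + l" using le_Suc_ex by (metis not_less)
    then have ll: "l < length ys2" using j by simp
    have "?p j = p2 l" "?p (Suc j) = p2 (Suc l)" using p_right[of l] p_right[of "Suc l"] l by auto
    moreover have "?ys ! j = ys2 ! l" using l by simp
    ultimately show ?thesis using 2 ll l unfolding even_paz_cuts_def by (simp add: add.assoc)
  qed
  moreover have "?p j \<in> D2 \<union> {0, 1}" if j: "j \<le> length ?ys" for j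
  proof (cases "j \<le> ?h")
    case True
    then show ?thesis using 1 sub unfolding even_paz_cuts_def by auto
  next
    case False
    then obtain l where l: "j = ?h + l" using le_Suc_ex by (metis nat_le_linear)
    then show ?thesis using p_right[of l] 2 j unfolding even_paz_cuts_def by auto
  qed
  moreover have "?p 0 = a" using 1 by (simp add: even_paz_cuts_def)
  moreover have "?p (length ?ys) = p2 (length ys2)"
    unfolding length_append by (rule p_right)
  then have "?p (length ?ys) = b" using 2 by (simp only: even_paz_cuts_def)
  ultimately show ?thesis unfolding even_paz_cuts_def by blast
qed

text \<open>The last hypothesis is the continuation of the protocol, which receives a reordering
  \<open>ys\<close> and its cuts. All players of the segment cut at \<open>(s + h) / n\<close>. For
  the \<open>h\<close>-th smallest answer \<open>c\<close>, the cake left of \<open>c\<close> is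
  worth at least that much to the first \<open>h\<close> players and at most that much to the
  others; this restores the value hypothesis on both sides.\<close>

lemma achievable_even_paz:
  assumes "length xs = m" "1 \<le> m" "distinct xs" "set xs \<subseteq> {1..n}" "s + m \<le> n" "S \<subseteq> worlds n"
    and "a \<in> D \<union> {0, 1}" "b \<in> D \<union> {0, 1}" "a \<le> b" "a \<in> {0..1}" "b \<in> {0..1}"
    and "\<And>w i. w \<in> S \<Longrightarrow> i \<in> set xs \<Longrightarrow> cdf_of w i a \<le> real s / real n \<and> real (s + m) / real n \<le> cdf_of w i b"
    and "\<And>D' S' ys p. D \<subseteq> D' \<Longrightarrow> S' \<subseteq> S \<Longrightarrow> mset ys = mset xs \<Longrightarrow> even_paz_cuts n s a b ys p D' S' \<Longrightarrow>
      achievable n D' q S' F"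
  shows "achievable n D (even_paz_cost m + q) S F"
  using assms
proof (induction m arbitrary: xs s S a b D q rule: less_induct)
  case (less m)
  note xs = less.prems(1-4) and sm = less.prems(5) and S = less.prems(6)
    and ab = less.prems(7-11) and val = less.prems(12) and cont = less.prems(13)
  show ?case
  proof (cases "m = 1")
    case True
    then obtain x where x: "xs = [x]" using xs(1) by (auto simp: length_Suc_conv)
    have "even_paz_cuts n s a b xs (\<lambda>j. if j = 0 then a else b) D S"
      unfolding even_paz_cuts_def using x ab val True by auto
    then have "achievable n D q S F" by (intro cont[of D S xs]) auto
    then show ?thesis by (rule achievable_mono) auto
  next
    case False
    then have m: "2 \<le> m" using xs(2) by simp
    define h where "h = m div 2"
    have h: "1 \<le> h" "h < m" using m by (auto simp: h_def)
    define \<alpha> where "\<alpha> = real (s + h) / real n"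
    have n0: "0 < n" using sm m by simp
    have \<alpha>: "\<alpha> \<in> {0..1}" "real s / real n < \<alpha>" "\<alpha> < real (s + m) / real n"
      using sm h n0 by (auto simp: \<alpha>_def divide_simps)
    define Q where "Q = (\<lambda>i. (i, \<alpha>)) ` set xs"
    have Q: "finite Q" "Q \<subseteq> {1..n} \<times> {0..1}" using xs(4) \<alpha>(1) by (auto simp: Q_def)
    have cardQ: "card Q = m" using xs(1,3) by (simp add: Q_def card_image inj_on_def distinct_card)
    have cost: "even_paz_cost m + q = card Q + (even_paz_cost h + (even_paz_cost (m - h) + q))"
      using m by (subst even_paz_cost.simps) (simp add: cardQ h_def)
    show ?thesis
      unfolding cost
    proof (rule achievable_cuts[OF Q])
      fix w1 assume w1: "w1 \<in> S"
      let ?D = "D \<union> (\<lambda>(i, \<alpha>). snd w1 i \<alpha>) ` Q"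
      let ?S = "{w \<in> S. \<forall>(i, \<alpha>)\<in>Q. snd w i \<alpha> = snd w1 i \<alpha>}"
      define y where "y i = snd w1 i \<alpha>" for i
      have agree: "snd w i \<alpha> = y i" if "w \<in> ?S" "i \<in> set xs" for w i
        using that by (auto simp: Q_def y_def)
      have yD: "y i \<in> ?D" if "i \<in> set xs" for i using that by (force simp: Q_def y_def)
      define zs where "zs = sort_key y xs"
      have zs: "mset zs = mset xs" "sorted (map y zs)" "length zs = m" "distinct zs" "set zs = set xs"
        using xs(1,3) by (auto simp: zs_def)
      define c where "c = y (zs ! (h - 1))"
      let ?l = "take h zs" and ?r = "drop h zs"
      have c_mem: "zs ! (h - 1) \<in> set xs" using zs(3,5) h by (metis less_imp_diff_less nth_mem)
      have y_l: "y i \<le> c" if "i \<in> set ?l" for i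
      proof -
        obtain j where j: "j < h" "i = zs ! j" using \<open>i \<in> set ?l\<close> by (auto simp: in_set_conv_nth)
        then show ?thesis
          using sorted_nth_mono[OF zs(2), of j "h - 1"] zs(3) h by (simp add: c_def)
      qed
      have y_r: "c \<le> y i" if "i \<in> set ?r" for i
      proof -
        obtain j where j: "j < m - h" "i = zs ! (h + j)" using \<open>i \<in> set ?r\<close> zs(3) by (auto simp: in_set_conv_nth)
        then show ?thesis
          using sorted_nth_mono[OF zs(2), of "h - 1" "h + j"] zs(3) h by (simp add: c_def)
      qed
      have cut: "y i \<in> {0..1} \<and> cdf_of w i (y i) = \<alpha>" if "w \<in> ?S" "i \<in> set xs" for w i
      proof -
        have "w \<in> worlds n" "i \<in> {1..n}" using that S xs(4) by auto
        then show ?thesis using worlds_cut[of w n i \<alpha>] agree[OF that] \<alpha>(1) by simp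
      qed
      have c01: "c \<in> {0..1}" using cut[of w1 "zs ! (h - 1)"] w1 c_mem by (simp add: c_def)
      have ac: "a \<le> c" "c \<le> b"
      proof -
        let ?i = "zs ! (h - 1)"
        interpret valued_cake "fst w1 ?i"
          by (rule worlds_valued_cake[OF subsetD[OF S w1]]) (use c_mem xs(4) in auto)
        have "cdf c = \<alpha>" using cut[of w1 ?i] w1 c_mem by (simp add: c_def)
        moreover have "cdf a < \<alpha>" "\<alpha> < cdf b" using val[OF w1 c_mem] \<alpha> by auto
        ultimately show "a \<le> c" "c \<le> b"
          using cdf_less_imp[of a c] cdf_less_imp[of c b] ab c01 by auto
      qed
      have sets: "set ?l \<subseteq> set xs" "set ?r \<subseteq> set xs"
        using zs(5) set_take_subset[of h zs] set_drop_subset[of h zs] by auto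
      have val_l: "\<alpha> \<le> cdf_of w i c" if "w \<in> ?S" "i \<in> set ?l" for w i
      proof -
        have i: "i \<in> set xs" using that sets by auto
        interpret valued_cake "fst w i" by (rule worlds_valued_cake[of w n]) (use that i S xs(4) in auto)
        show ?thesis using cut[OF that(1) i] cdf_mono[OF y_l[OF that(2)]] c01 by simp
      qed
      have val_r: "cdf_of w i c \<le> \<alpha>" if "w \<in> ?S" "i \<in> set ?r" for w i
      proof -
        have i: "i \<in> set xs" using that sets by auto
        interpret valued_cake "fst w i" by (rule worlds_valued_cake[of w n]) (use that i S xs(4) in auto)
        show ?thesis using cut[OF that(1) i] cdf_mono[OF y_r[OF that(2)]] by simp
      qed
      have cD: "c \<in> ?D \<union> {0, 1}" using yD[OF c_mem] by (simp add: c_def)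
      show "achievable n ?D (even_paz_cost h + (even_paz_cost (m - h) + q)) ?S F"
      proof (rule less.IH[of h ?l s ?S a ?D c])
        fix D' S' ys1 p1
        assume 1: "?D \<subseteq> D'" "S' \<subseteq> ?S" "mset ys1 = mset ?l" "even_paz_cuts n s a c ys1 p1 D' S'"
        have len1: "length ys1 = h" using 1(3) zs(3) h by (metis length_take min.absorb2 less_imp_le size_mset)
        show "achievable n D' (even_paz_cost (m - h) + q) S' F"
        proof (rule less.IH[of "m - h" ?r "s + h" S' c D' b])
          fix D'' S'' ys2 p2
          assume 2: "D' \<subseteq> D''" "S'' \<subseteq> S'" "mset ys2 = mset ?r" "even_paz_cuts n (s + h) c b ys2 p2 D'' S''"
          have "mset (ys1 @ ys2) = mset zs" using 1(3) 2(3) by (metis append_take_drop_id mset_append)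
          then show "achievable n D'' q S'' F"
            using even_paz_cuts_append[OF 1(4) _ 2(1,2), of b ys2 p2] 2 1 zs(1) len1
            by (intro cont) auto
        next
          fix w i assume "w \<in> S'" "i \<in> set ?r"
          then show "cdf_of w i c \<le> real (s + h) / real n \<and> real (s + h + (m - h)) / real n \<le> cdf_of w i b"
            using val_r[of w i] 1(2) val[of w i] sets h by (auto simp: \<alpha>_def)
        next
          show "c \<in> D' \<union> {0, 1}" "b \<in> D' \<union> {0, 1}" using cD ab 1(1) by auto
        qed (use zs h xs(4) sets sm S ab ac c01 1(2) in auto)
      next
        fix w i assume w: "w \<in> ?S" "i \<in> set ?l"
        then show "cdf_of w i a \<le> real s / real n \<and> real (s + h) / real n \<le> cdf_of w i c"
          using val_l[OF w] val[of w i] sets by (auto simp: \<alpha>_def)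
      qed (use zs h xs(4) sets sm S ab ac c01 cD in auto)
    qed
  qed
qed


section \<open>Equalising the values\<close>

definition cuts_from :: "nat \<Rightarrow> real set \<Rightarrow> (nat \<Rightarrow> real) \<Rightarrow> bool" where
  "cuts_from n D u \<longleftrightarrow> u 0 = 0 \<and> u n = 1 \<and> (\<forall>j<n. u j \<le> u (Suc j)) \<and> (\<forall>j\<le>n. u j \<in> D \<union> {0, 1})"

lemma cuts_from_cut_sequence: "cuts_from n D u \<Longrightarrow> 1 \<le> n \<Longrightarrow> cut_sequence u n"
  by unfold_locales (auto simp: cuts_from_def)

lemma cuts_from_mono: "cuts_from n D u \<Longrightarrow> D \<subseteq> D' \<Longrightarrow> cuts_from n D' u"
  unfolding cuts_from_def by blast

lemma cuts_from_update:
  assumes "cuts_from n D u" "0 < j" "j < n" "u (j - 1) \<le> c" "c \<le> u (Suc j)" "c \<in> D \<union> {0, 1}"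
  shows "cuts_from n D (u(j := c))"
proof -
  have "(u(j := c)) l \<le> (u(j := c)) (Suc l)" if "l < n" for l
    using assms that by (cases "l = j"; cases "Suc l = j") (auto simp: cuts_from_def)
  then show ?thesis using assms by (simp add: cuts_from_def)
qed

text \<open>\<open>P j\<close> owns the \<open>j\<close>-th piece from the left; this order stays
  fixed while the cuts move.\<close>

locale equalising =
  fixes n :: nat and \<epsilon> :: real and P :: "nat \<Rightarrow> nat"
  assumes n: "1 \<le> n" and \<epsilon>: "0 < \<epsilon>" and P: "bij_betw P {..<n} {1..n}"
begin

lemma P_mem: "j < n \<Longrightarrow> P j \<in> {1..n}"
  using P by (auto simp: bij_betw_def)

definition share :: "world \<Rightarrow> (nat \<Rightarrow> real) \<Rightarrow> nat \<Rightarrow> real" where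
  "share w u j = cdf_of w (P j) (u (Suc j)) - cdf_of w (P j) (u j)"

abbreviation goal :: "world \<Rightarrow> real set \<Rightarrow> (nat \<Rightarrow> real set) \<Rightarrow> bool" where
  "goal w D A \<equiv> cake_partition n A \<and> (\<forall>j\<in>{1..n}. frontier (A j) \<subseteq> {0, 1} \<union> D) \<and>
     (equitable \<epsilon> n (fst w) A \<and> proportional n (fst w) A \<and> connected_pieces n A)"

lemma achievable_goal:
  assumes u: "cuts_from n D u" and S: "S \<subseteq> worlds n" and "1 / n \<le> t"
    and sh: "\<And>w j. w \<in> S \<Longrightarrow> j < n \<Longrightarrow> t \<le> share w u j \<and> share w u j \<le> t + \<epsilon>"
  shows "achievable n D q S goal"
proof -
  interpret cut_sequence u n by (rule cuts_from_cut_sequence[OF u n])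
  define \<sigma> where "\<sigma> = inv_into {..<n} P"
  have \<sigma>: "bij_betw \<sigma> {1..n} {..<n}" unfolding \<sigma>_def by (rule bij_betw_inv_into[OF P])
  have \<sigma>P: "\<sigma> i < n" "P (\<sigma> i) = i" if "i \<in> {1..n}" for i
    using \<sigma> P that unfolding \<sigma>_def by (auto simp: bij_betw_def f_inv_into_f)
  note A = allocation[OF \<sigma>]
  show ?thesis
  proof (rule achievable_output)
    fix w assume w: "w \<in> S"
    have val: "t \<le> piece_value (fst w i) (allocation \<sigma> i) \<and> piece_value (fst w i) (allocation \<sigma> i) \<le> t + \<epsilon>"
      if i: "i \<in> {1..n}" for i
    proof -
      have "piece_value (fst w i) (allocation \<sigma> i) = share w u (\<sigma> i)"
        unfolding share_def \<sigma>P(2)[OF i] by (rule A(4)[OF worlds_valued_cake[OF subsetD[OF S w] i] i])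
      then show ?thesis using sh[OF w \<sigma>P(1)[OF i]] by simp
    qed
    have "equitable \<epsilon> n (fst w) (allocation \<sigma>)"
      unfolding equitable_def
    proof (intro ballI)
      fix i j assume "i \<in> {1..n}" "j \<in> {1..n}"
      from val[OF this(1)] val[OF this(2)]
      show "\<bar>piece_value (fst w i) (allocation \<sigma> i) - piece_value (fst w j) (allocation \<sigma> j)\<bar> \<le> \<epsilon>"
        by linarith
    qed
    moreover have "proportional n (fst w) (allocation \<sigma>)"
      unfolding proportional_def using val \<open>1 / n \<le> t\<close> by force
    moreover have "u ` {1..<n} \<subseteq> {0, 1} \<union> D"
    proof (rule image_subsetI)
      fix j assume "j \<in> {1..<n}"
      then have "j \<le> n" by simp
      then show "u j \<in> {0, 1} \<union> D" using u unfolding cuts_from_def by blast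
    qed
    then have "\<forall>j\<in>{1..n}. frontier (allocation \<sigma> j) \<subseteq> {0, 1} \<union> D" using A(3) by blast
    ultimately show "goal w D (allocation \<sigma>)" using A(1,2) by blast
  qed
qed

text \<open>Walking from right to left, each cut moves right until the piece on its right is worth exactly \<open>t\<close>.
  A cut returned by a query may lie left of the old cut when its owner is indifferent, whence the maximum.\<close>

lemma achievable_backward:
  assumes "k < n" "cuts_from n D u" "S \<subseteq> worlds n" "0 < t"
    and "\<And>w j. w \<in> S \<Longrightarrow> j < n \<Longrightarrow> t \<le> share w u j"
    and "\<And>w j. w \<in> S \<Longrightarrow> k < j \<Longrightarrow> j < n \<Longrightarrow> share w u j = t"
    and "\<And>D' S' u'. D \<subseteq> D' \<Longrightarrow> S' \<subseteq> S \<Longrightarrow> cuts_from n D' u' \<Longrightarrow>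
      (\<And>w j. w \<in> S' \<Longrightarrow> j < n \<Longrightarrow> t \<le> share w u' j) \<Longrightarrow>
      (\<And>w j. w \<in> S' \<Longrightarrow> 0 < j \<Longrightarrow> j < n \<Longrightarrow> share w u' j = t) \<Longrightarrow> achievable n D' q S' goal"
  shows "achievable n D (2 * k + q) S goal"
  using assms
proof (induction k arbitrary: D S u)
  case 0
  show ?case using "0.prems" by simp
next
  case (Suc k)
  note k = Suc.prems(1) and u = Suc.prems(2) and S = Suc.prems(3) and t = Suc.prems(4)
    and ge = Suc.prems(5) and ex = Suc.prems(6) and cont = Suc.prems(7)
  let ?j = "Suc k"
  interpret cut_sequence u n by (rule cuts_from_cut_sequence[OF u n])
  have i: "P ?j \<in> {1..n}" using k by (rule P_mem)
  \<comment> \<open>Two queries per cut: once the value \<open>\<beta>\<close> up to the right end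
    of the piece is known, a cut at \<open>\<beta> - t\<close> leaves exactly \<open>t\<close> on
    its right.\<close>
  have "achievable n D (Suc (Suc (2 * k + q))) S goal"
  proof (rule achievable_eval[OF i _ S])
    show "u (Suc ?j) \<in> D \<union> {0, 1}" using u k unfolding cuts_from_def by (simp add: Suc_leI)
    fix \<beta>
    let ?S = "{w \<in> S. cdf_of w (P ?j) (u (Suc ?j)) = \<beta>}"
    show "achievable n D (Suc (2 * k + q)) ?S goal"
    proof (cases "?S = {}")
      case True
      then show ?thesis by (simp only: achievable_empty)
    next
      case False
      then obtain w0 where w0: "w0 \<in> ?S" by blast
      have world: "valued_cake (fst w (P ?j))" if "w \<in> ?S" for w
        by (rule worlds_valued_cake[of w n]) (use that S i in auto)
      have u01: "0 \<le> u ?j" "u ?j \<le> u (Suc ?j)" "u (Suc ?j) \<le> 1"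
        using z_bounds[of ?j] z_bounds[of "Suc ?j"] z_Suc[of ?j] k by auto
      have below: "cdf_of w (P ?j) (u ?j) \<le> \<beta> - t" if "w \<in> ?S" for w
        using ge[of w ?j] that k by (simp add: share_def)
      have \<alpha>: "\<beta> - t \<in> {0..1}"
      proof -
        interpret c: valued_cake "fst w0 (P ?j)" by (rule world[OF w0])
        have "0 \<le> c.cdf (u ?j)" "\<beta> \<le> 1" using c.cdf_bounds u01 w0 by auto
        then show ?thesis using below[OF w0] t by simp
      qed
      show ?thesis
      proof (rule achievable_cut[OF i \<alpha>])
        fix y
        let ?S' = "{w \<in> ?S. snd w (P ?j) (\<beta> - t) = y}"
        show "achievable n (insert y D) (2 * k + q) ?S' goal"
        proof (cases "?S' = {}")
          case True
          then show ?thesis by (simp only: achievable_empty)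
        next
          case False
          then obtain w1 where w1: "w1 \<in> ?S'" by blast
          define c where "c = max y (u ?j)"
          have y: "y \<in> {0..1} \<and> cdf_of w (P ?j) y = \<beta> - t" if "w \<in> ?S'" for w
            using worlds_cut[of w n "P ?j" "\<beta> - t"] that S i \<alpha> by auto
          have c_val: "cdf_of w (P ?j) c = \<beta> - t" if w: "w \<in> ?S'" for w
          proof -
            interpret valued_cake "fst w (P ?j)" by (rule world) (use w in simp)
            show ?thesis
              using below[of w] y[OF w] cdf_mono[of y "u ?j"] u01 w by (cases "y \<le> u ?j") (auto simp: c_def max_def)
          qed
          have c_le: "c \<le> u (Suc ?j)"
          proof -
            interpret valued_cake "fst w1 (P ?j)" by (rule world) (use w1 in simp)
            have "cdf c < cdf (u (Suc ?j))" using c_val[OF w1] w1 t by simp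
            then show ?thesis using cdf_less_imp[of c "u (Suc ?j)"] y[OF w1] u01 by (auto simp: c_def)
          qed
          let ?u = "u(?j := c)"
          have u': "cuts_from n (insert y D) ?u"
          proof (rule cuts_from_update)
            show "cuts_from n (insert y D) u" by (rule cuts_from_mono[OF u]) auto
            show "u (?j - 1) \<le> c" using z_Suc[of k] k by (simp add: c_def)
            have "u ?j \<in> D \<union> {0, 1}" using u k by (simp add: cuts_from_def)
            then show "c \<in> insert y D \<union> {0, 1}" by (auto simp: c_def max_def)
          qed (use k c_le in auto)
          have sh_j: "share w ?u ?j = t" if "w \<in> ?S'" for w
            using c_val[OF that] that by (simp add: share_def)
          \<comment> \<open>The cut moves to the right, so the piece on its left only gains.\<close>
          have sh_k: "t \<le> share w ?u k" if w: "w \<in> ?S'" for w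
          proof -
            interpret valued_cake "fst w (P k)" by (rule worlds_valued_cake[of w n]) (use w S P_mem[of k] k in auto)
            have "cdf (u ?j) \<le> cdf c" using c_le u01 by (intro cdf_mono) (auto simp: c_def)
            moreover have "t \<le> cdf (u ?j) - cdf (u k)" using ge[of w k] w k by (simp add: share_def)
            ultimately show ?thesis by (simp add: share_def)
          qed
          have sh_other: "share w ?u l = share w u l" if "l \<noteq> ?j" "l \<noteq> k" for w l
            using that by (simp add: share_def)
          show ?thesis
          proof (rule Suc.IH[OF _ u' _ t])
            fix w l assume w: "w \<in> ?S'" and l: "l < n"
            then show "t \<le> share w ?u l"
              using sh_j[OF w] sh_k[OF w] sh_other[of l w] ge[of w l] by (cases "l = ?j"; cases "l = k") auto
          next
            fix w l assume w: "w \<in> ?S'" and l: "k < l" "l < n"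
            then show "share w ?u l = t"
              using sh_j[OF w] sh_other[of l w] ex[of w l] by (cases "l = ?j") auto
          next
            fix D' S'' u'
            assume "insert y D \<subseteq> D'" "S'' \<subseteq> ?S'" "cuts_from n D' u'"
              "\<And>w j. w \<in> S'' \<Longrightarrow> j < n \<Longrightarrow> t \<le> share w u' j"
              "\<And>w j. w \<in> S'' \<Longrightarrow> 0 < j \<Longrightarrow> j < n \<Longrightarrow> share w u' j = t"
            then show "achievable n D' q S'' goal" by (intro cont[of D' S'' u']) auto
          qed (use k S in auto)
        qed
      qed
    qed
  qed
  then show ?case by simp
qed

text \<open>Walking from left to right, each cut moves left until the piece on its left is worth exactly
  \<open>t + \<epsilon>\<close>. If a piece is already worth at most that, all pieces are within \<open>[t, t + \<epsilon>]\<close>.\<close>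

lemma achievable_forward:
  assumes "n = k + r" "0 < r" "cuts_from n D u" "S \<subseteq> worlds n" "1 / n \<le> t"
    and "\<And>w j. w \<in> S \<Longrightarrow> j < k \<Longrightarrow> share w u j = t + \<epsilon>"
    and "\<And>w. w \<in> S \<Longrightarrow> t \<le> share w u k"
    and "\<And>w j. w \<in> S \<Longrightarrow> k < j \<Longrightarrow> j < n \<Longrightarrow> share w u j = t"
    and "\<And>D' S' u'. D \<subseteq> D' \<Longrightarrow> S' \<subseteq> S \<Longrightarrow> cuts_from n D' u' \<Longrightarrow>
      (\<And>w j. w \<in> S' \<Longrightarrow> j < n \<Longrightarrow> t + \<epsilon> \<le> share w u' j) \<Longrightarrow> achievable n D' q S' goal"
  shows "achievable n D (3 * r + q) S goal"
  using assms
proof (induction r arbitrary: k D S u)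
  case (Suc r)
  note nk = Suc.prems(1) and u = Suc.prems(3) and S = Suc.prems(4) and t = Suc.prems(5)
    and left = Suc.prems(6) and mid = Suc.prems(7) and right = Suc.prems(8) and cont = Suc.prems(9)
  have k: "k < n" using nk by simp
  have t0: "0 < t" using t n by (auto intro: less_le_trans[of 0 "1 / n"])
  interpret cut_sequence u n by (rule cuts_from_cut_sequence[OF u n])
  have i: "P k \<in> {1..n}" using k by (rule P_mem)
  have u01: "0 \<le> u k" "u k \<le> u (Suc k)" "u (Suc k) \<le> 1"
    using z_bounds[of k] z_bounds[of "Suc k"] z_Suc[of k] k by auto
  have "achievable n D (Suc (Suc (Suc (3 * r + q)))) S goal"
  proof (rule achievable_eval[OF i _ S])
    show "u k \<in> D \<union> {0, 1}" using u k by (simp add: cuts_from_def)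
    fix \<gamma>
    let ?S = "{w \<in> S. cdf_of w (P k) (u k) = \<gamma>}"
    show "achievable n D (Suc (Suc (3 * r + q))) ?S goal"
    proof (rule achievable_eval[OF i])
      show "u (Suc k) \<in> D \<union> {0, 1}" using u k by (simp add: cuts_from_def)
      show "?S \<subseteq> worlds n" using S by auto
      fix \<beta>
      let ?S' = "{w \<in> ?S. cdf_of w (P k) (u (Suc k)) = \<beta>}"
      have sh_k: "share w u k = \<beta> - \<gamma>" if "w \<in> ?S'" for w
        using that by (simp add: share_def)
      show "achievable n D (Suc (3 * r + q)) ?S' goal"
      proof (cases "?S' = {}")
        case True
        then show ?thesis by (simp only: achievable_empty)
      next
        case False
        then obtain w0 where w0: "w0 \<in> ?S'" by blast
        show ?thesis
        proof (cases "\<beta> - \<gamma> \<le> t + \<epsilon>")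
          case True
          show ?thesis
          proof (rule achievable_goal[OF u _ t])
            fix w j assume w: "w \<in> ?S'" and j: "j < n"
            show "t \<le> share w u j \<and> share w u j \<le> t + \<epsilon>"
            proof (cases j k rule: linorder_cases)
              case less
              then show ?thesis using left[of w j] w \<epsilon> by simp
            next
              case equal
              then show ?thesis using mid[of w] sh_k[OF w] w True by simp
            next
              case greater
              then show ?thesis using right[of w j] w j \<epsilon> by simp
            qed
          qed (use S in auto)
        next
          case big: False
          show ?thesis
          proof (cases "r = 0")
            case True
            \<comment> \<open>Even the last piece exceeds \<open>t + \<epsilon>\<close>: the common
              guarantee rises, and the continuation takes over.\<close>
            have "achievable n D q ?S' goal"
            proof (rule cont[OF _ _ u])
              fix w j assume w: "w \<in> ?S'" and j: "j < n"
              then have "j < k \<or> j = k" using nk True by auto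
              then show "t + \<epsilon> \<le> share w u j" using left[of w j] sh_k[OF w] w big by auto
            qed auto
            then show ?thesis by (rule achievable_mono) auto
          next
            case False
            then have k': "Suc k < n" using nk by simp
            have world: "valued_cake (fst w (P k))" if "w \<in> ?S'" for w
              by (rule worlds_valued_cake[of w n]) (use that S i in auto)
            have \<alpha>: "\<gamma> + (t + \<epsilon>) \<in> {0..1}"
            proof -
              interpret c: valued_cake "fst w0 (P k)" by (rule world[OF w0])
              have "0 \<le> \<gamma>" "\<beta> \<le> 1" using c.cdf_bounds(1)[of "u k"] c.cdf_bounds(2)[of "u (Suc k)"] u01 w0 by auto
              then show ?thesis using big t0 \<epsilon> by simp
            qed
            show ?thesis
            proof (rule achievable_cut[OF i \<alpha>])
              fix y
              let ?T = "{w \<in> ?S'. snd w (P k) (\<gamma> + (t + \<epsilon>)) = y}"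
              show "achievable n (insert y D) (3 * r + q) ?T goal"
              proof (cases "?T = {}")
                case True
                then show ?thesis by (simp only: achievable_empty)
              next
                case False
                then obtain w1 where w1: "w1 \<in> ?T" by blast
                have y: "y \<in> {0..1} \<and> cdf_of w (P k) y = \<gamma> + (t + \<epsilon>)" if "w \<in> ?T" for w
                  using worlds_cut[of w n "P k" "\<gamma> + (t + \<epsilon>)"] that S i \<alpha> by auto
                \<comment> \<open>The value at the new cut lies strictly between the two end values,
                  so a tie cannot put it outside the piece.\<close>
                have y_between: "u k < y" "y < u (Suc k)"
                proof -
                  interpret c: valued_cake "fst w1 (P k)" by (rule world) (use w1 in simp)
                  have "c.cdf (u k) < c.cdf y" "c.cdf y < c.cdf (u (Suc k))" using y[OF w1] w1 big t0 \<epsilon> by auto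
                  then show "u k < y" "y < u (Suc k)"
                    using c.cdf_less_imp[of "u k" y] c.cdf_less_imp[of y "u (Suc k)"] u01 y[OF w1] by auto
                qed
                let ?u = "u(Suc k := y)"
                have u': "cuts_from n (insert y D) ?u"
                proof (rule cuts_from_update)
                  show "cuts_from n (insert y D) u" by (rule cuts_from_mono[OF u]) auto
                  show "y \<le> u (Suc (Suc k))" using y_between z_Suc[of "Suc k"] k' by simp
                qed (use k' y_between in auto)
                have new_k: "share w ?u k = t + \<epsilon>" if "w \<in> ?T" for w
                  using y[OF that] that by (simp add: share_def)
                have new_Suc: "t \<le> share w ?u (Suc k)" if w: "w \<in> ?T" for w
                proof -
                  interpret c: valued_cake "fst w (P (Suc k))"
                    by (rule worlds_valued_cake[of w n]) (use w S P_mem[of "Suc k"] k' in auto)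
                  have "c.cdf y \<le> c.cdf (u (Suc k))" using y_between u01 by (intro c.cdf_mono) auto
                  then show ?thesis using right[of w "Suc k"] w k' by (simp add: share_def)
                qed
                have other: "share w ?u l = share w u l" if "l \<noteq> Suc k" "l \<noteq> k" for w l
                  using that by (simp add: share_def)
                show ?thesis
                proof (rule Suc.IH[OF _ _ u' _ t])
                  fix w l assume w: "w \<in> ?T" and l: "l < Suc k"
                  then show "share w ?u l = t + \<epsilon>"
                    using new_k[OF w] other[of l w] left[of w l] by (cases "l = k") auto
                next
                  fix w assume w: "w \<in> ?T"
                  then show "t \<le> share w ?u (Suc k)" by (rule new_Suc)
                next
                  fix w l assume w: "w \<in> ?T" and l: "Suc k < l" "l < n"
                  then show "share w ?u l = t" using other[of l w] right[of w l] by auto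
                next
                  fix D' S'' u'
                  assume "insert y D \<subseteq> D'" "S'' \<subseteq> ?T" "cuts_from n D' u'"
                    "\<And>w j. w \<in> S'' \<Longrightarrow> j < n \<Longrightarrow> t + \<epsilon> \<le> share w u' j"
                  then show "achievable n D' q S'' goal" by (intro cont[of D' S'' u']) auto
                qed (use nk \<open>r \<noteq> 0\<close> S in auto)
              qed
            qed
          qed
        qed
      qed
    qed
  qed
  moreover have "Suc (Suc (Suc (3 * r + q))) = 3 * Suc r + q" by simp
  ultimately show ?case by (simp only:)
qed simp

text \<open>A level either ends with an output or raises \<open>t\<close> by \<epsilon>, with at
  most \<open>2 * (n - 1) + 3 * n\<close> queries. No piece is worth more than 1, so beyond that
  value no world remains and the recursion stops.\<close>

lemma achievable_levels:
  assumes "cuts_from n D u" "S \<subseteq> worlds n" "1 / n \<le> t" "1 < t + real r * \<epsilon>"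
    and "\<And>w j. w \<in> S \<Longrightarrow> j < n \<Longrightarrow> t \<le> share w u j"
  shows "achievable n D (r * (5 * n)) S goal"
  using assms
proof (induction r arbitrary: D u S t)
  case 0
  have "S = {}"
  proof (rule ccontr)
    assume "S \<noteq> {}"
    then obtain w where w: "w \<in> S" by auto
    interpret cut_sequence u n by (rule cuts_from_cut_sequence[OF "0.prems"(1) n])
    interpret valued_cake "fst w (P 0)"
      by (rule worlds_valued_cake[of w n]) (use w "0.prems"(2) P_mem[of 0] n in auto)
    have "share w u 0 \<le> 1"
      using cdf_bounds(1)[of "u 0"] cdf_bounds(2)[of "u (Suc 0)"] z_bounds[of 0] z_bounds[of "Suc 0"] n
      by (simp add: share_def)
    then show False using "0.prems"(4) "0.prems"(5)[OF w, of 0] n by simp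
  qed
  then show ?case by (simp only: achievable_empty)
next
  case (Suc r)
  note u = Suc.prems(1) and S = Suc.prems(2) and t = Suc.prems(3) and big = Suc.prems(4) and sh = Suc.prems(5)
  have t0: "0 < t" using t n by (auto intro: less_le_trans[of 0 "1 / n"])
  have "achievable n D (2 * (n - 1) + (3 * n + r * (5 * n))) S goal"
  proof (rule achievable_backward[OF _ u S t0])
    fix D' S' u'
    assume D': "D \<subseteq> D'" "S' \<subseteq> S" and u': "cuts_from n D' u'"
      and ge: "\<And>w j. w \<in> S' \<Longrightarrow> j < n \<Longrightarrow> t \<le> share w u' j"
      and ex: "\<And>w j. w \<in> S' \<Longrightarrow> 0 < j \<Longrightarrow> j < n \<Longrightarrow> share w u' j = t"
    show "achievable n D' (3 * n + r * (5 * n)) S' goal"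
    proof (rule achievable_forward[of 0 n D' u' S' t])
      fix D'' S'' u''
      assume "D' \<subseteq> D''" "S'' \<subseteq> S'" "cuts_from n D'' u''"
        "\<And>w j. w \<in> S'' \<Longrightarrow> j < n \<Longrightarrow> t + \<epsilon> \<le> share w u'' j"
      then show "achievable n D'' (r * (5 * n)) S'' goal"
        using S D' t big \<epsilon> by (intro Suc.IH[of D'' u'' S'' "t + \<epsilon>"]) (auto simp: algebra_simps)
    qed (use n u' D' S t ge ex in auto)
  qed (use n sh in auto)
  then show ?case by (rule achievable_mono) auto
qed

end

text \<open>The start costs at most \<open>3 * n * ln n\<close>, followed by at most
  \<open>1 / \<epsilon> + 1\<close> levels of \<open>5 * n\<close> queries. For
  \<open>2 \<le> n\<close> the summand 1 is at most \<open>2 * ln n\<close>, so the constant is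
  \<open>3 + 5 * 3 = 18\<close>. A single player has \<open>ln n = 0\<close> and gets the uncut cake
  without queries.\<close>

lemma rw_computable_equitable:
  assumes "1 \<le> n" "0 < \<epsilon>"
  shows "rw_computable n n (18 * (real n * max (1 / \<epsilon>) (ln (real n))))
    (\<lambda>v A. equitable \<epsilon> n v A \<and> proportional n v A \<and> connected_pieces n A)"
proof (cases "n = 1")
  case True
  have P: "bij_betw Suc {..<n} {1..n}" using True by (simp add: bij_betw_def lessThan_Suc)
  interpret equalising n \<epsilon> Suc by unfold_locales (use assms P in auto)
  have "achievable n {} 0 (worlds n) goal"
  proof (rule achievable_goal[where u = real and t = 1])
    show "cuts_from n {} real" using True by (auto simp: cuts_from_def le_Suc_eq)
    fix w j assume w: "w \<in> worlds n" and j: "j < n"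
    have "j = 0" using True j by simp
    interpret valued_cake "fst w (Suc 0)" by (rule worlds_valued_cake[OF w]) (use True in auto)
    show "1 \<le> share w real j \<and> share w real j \<le> 1 + \<epsilon>"
      using cdf_0 cdf_1 assms \<open>j = 0\<close> by (simp add: share_def)
  qed (use True in auto)
  then show ?thesis using True assms by (intro rw_computableI) auto
next
  case False
  then have n: "2 \<le> n" using assms by simp
  define r where "r = nat \<lceil>1 / \<epsilon>\<rceil>"
  have r: "1 / \<epsilon> \<le> real r" "real r \<le> 1 / \<epsilon> + 1"
    using assms by (auto simp: r_def of_nat_nat) 
  have "achievable n {} (even_paz_cost n + r * (5 * n)) (worlds n) (\<lambda>w D A. cake_partition n A \<and>
     (\<forall>j\<in>{1..n}. frontier (A j) \<subseteq> {0, 1} \<union> D) \<and>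
     (equitable \<epsilon> n (fst w) A \<and> proportional n (fst w) A \<and> connected_pieces n A))"
  proof (rule achievable_even_paz[of "[1..<Suc n]" n n 0 "worlds n" 0 "{}" 1])
    fix w i assume w: "w \<in> worlds n" "i \<in> set [1..<Suc n]"
    interpret valued_cake "fst w i" by (rule worlds_valued_cake[OF w(1)]) (use w in auto)
    show "cdf 0 \<le> real 0 / real n \<and> real (0 + n) / real n \<le> cdf 1" using n by simp
  next
    fix D S ys p
    assume D: "{} \<subseteq> D" "S \<subseteq> worlds n" and ys: "mset ys = mset [1..<Suc n]" and p: "even_paz_cuts n 0 0 1 ys p D S"
    have len: "length ys = n" using ys by (metis length_upt diff_Suc_1 size_mset)
    have "distinct ys" "set ys = {1..n}"
      using ys by (metis distinct_upt mset_eq_imp_distinct_iff, metis atLeastLessThanSuc_atLeastAtMost set_upt mset_eq_setD)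
    then have "bij_betw (\<lambda>j. ys ! j) {..<n} {1..n}" using bij_betw_nth[of ys "{..<n}" "{1..n}"] len by simp
    then interpret equalising n \<epsilon> "\<lambda>j. ys ! j" using assms by unfold_locales
    show "achievable n D (r * (5 * n)) S goal"
    proof (rule achievable_levels[where t = "1 / n" and u = p])
      show "cuts_from n D p" using p len by (simp add: even_paz_cuts_def cuts_from_def)
      have "1 \<le> real r * \<epsilon>" using r(1) assms by (simp add: field_simps)
      moreover have "0 < 1 / real n" using n by simp
      ultimately show "1 < 1 / real n + real r * \<epsilon>" by linarith
      fix w j assume w: "w \<in> S" and j: "j < n"
      have "cdf_of w (ys ! j) (p j) \<le> real j / real n" "real (Suc j) / real n \<le> cdf_of w (ys ! j) (p (Suc j))"
        using p w j len by (auto simp: even_paz_cuts_def)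
      moreover have "real (Suc j) / real n = real j / real n + 1 / real n" by (simp add: add_divide_distrib)
      ultimately show "1 / real n \<le> share w p j" by (simp add: share_def)
    qed (use D in auto)
  qed (use n in auto)
  moreover have "real (even_paz_cost n + r * (5 * n)) \<le> 18 * (real n * max (1 / \<epsilon>) (ln (real n)))"
  proof -
    let ?m = "max (1 / \<epsilon>) (ln (real n))"
    have "1 / 2 \<le> ln (2 :: real)" using ln_le_minus_one[of "1 / 2"] by (simp add: ln_div)
    also have "ln 2 \<le> ln (real n)" using n by (intro ln_mono) auto
    finally have l: "1 \<le> 2 * ?m" by linarith
    have "real (even_paz_cost n) \<le> 3 * (real n * ln (real n))" using n by (intro even_paz_cost_le) simp
    also have "\<dots> \<le> 3 * (real n * ?m)" by (intro mult_left_mono) auto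
    finally have 1: "real (even_paz_cost n) \<le> 3 * (real n * ?m)" .
    have "real r \<le> ?m + 2 * ?m" using r(2) l by linarith
    then have "real (r * (5 * n)) \<le> (?m + 2 * ?m) * (5 * real n)"
      unfolding of_nat_mult of_nat_numeral by (intro mult_right_mono) auto
    also have "\<dots> = 15 * (real n * ?m)" by simp
    finally show ?thesis unfolding of_nat_add using 1 by linarith
  qed
  ultimately show ?thesis by (intro rw_computableI)
qed

theorem corollary1:
  shows
    "(\<exists>C::real. C > 0 \<and> (\<forall>(n::nat)\<ge>1. \<forall>(\<epsilon>::real)>0.
        rw_computable n n (C * (n / \<epsilon>))
          (\<lambda>v A. envy_free \<epsilon> n v A \<and> connected_pieces n A)))
   \<and> (\<exists>C::real. C > 0 \<and> (\<forall>(n::nat)\<ge>1. \<forall>(\<epsilon>::real)>0.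
        rw_computable n n (C * (n * max (1 / \<epsilon>) (ln n)))
          (\<lambda>v A. equitable \<epsilon> n v A \<and> proportional n v A \<and> connected_pieces n A)))
   \<and> (\<exists>C::real. C > 0 \<and> (\<forall>(n::nat)\<ge>1. \<forall>(k::nat)\<ge>1. \<forall>(\<epsilon>::real)>0.
        rw_computable n k (C * (k * n\<^sup>2 / \<epsilon>))
          (\<lambda>v A. measure_splitting \<epsilon> k n v A)))
   \<and> (\<exists>C::real. C > 0 \<and> (\<forall>(n::nat)\<ge>1. \<forall>(\<epsilon>::real)>0.
        rw_computable n n (C * (n ^ 3 / \<epsilon>))
          (\<lambda>v A. perfect \<epsilon> n v A)))"
proof (intro conjI)
  show "\<exists>C::real. C > 0 \<and> (\<forall>(n::nat)\<ge>1. \<forall>(\<epsilon>::real)>0.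
        rw_computable n n (C * (n / \<epsilon>))
          (\<lambda>v A. envy_free \<epsilon> n v A \<and> connected_pieces n A))"
    using rw_computable_envy_free by (intro exI[of _ 9]) auto
  show "\<exists>C::real. C > 0 \<and> (\<forall>(n::nat)\<ge>1. \<forall>(\<epsilon>::real)>0.
        rw_computable n n (C * (n * max (1 / \<epsilon>) (ln n)))
          (\<lambda>v A. equitable \<epsilon> n v A \<and> proportional n v A \<and> connected_pieces n A))"
    using rw_computable_equitable by (intro exI[of _ 18]) auto
  show "\<exists>C::real. C > 0 \<and> (\<forall>(n::nat)\<ge>1. \<forall>(k::nat)\<ge>1. \<forall>(\<epsilon>::real)>0.
        rw_computable n k (C * (k * n\<^sup>2 / \<epsilon>))
          (\<lambda>v A. measure_splitting \<epsilon> k n v A))"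
    using rw_computable_measure_splitting by (intro exI[of _ 3200]) auto
  show "\<exists>C::real. C > 0 \<and> (\<forall>(n::nat)\<ge>1. \<forall>(\<epsilon>::real)>0.
        rw_computable n n (C * (n ^ 3 / \<epsilon>))
          (\<lambda>v A. perfect \<epsilon> n v A))"
    using rw_computable_perfect by (intro exI[of _ 3200]) auto
qed

end
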